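(* Let $\upsilon,b,\lambda\in\mathbb{C}$ and $y\in\mathbb{R}$ with $\Re(\upsilon)>0$, $y>0$, $\Re(\lambda)>0$, $\Re(b)>0$, and define \[ I_{C}(\upsilon,b,\lambda,y)=\int_{0}^{\infty}\frac{x^{\upsilon-1}\cos(xy)}{\{\exp(b\sqrt{x})-1\}^{\lambda}}\,dx . \] Writing $w_k=\lambda b+bk$ and $z_k=\dfrac{64y^{2}}{w_k^{4}}$, and $(\lambda)_k=\Gamma(\lambda+k)/\Gamma(\lambda)$, each of the following holds: \[ I_{C}(\upsilon,b,\lambda,y)=\frac{2^{4\upsilon-\frac{3}{2}}}{\pi}\sum_{k=0}^{\infty}\frac{(\lambda)_k}{k!\,w_k^{2\upsilon}}\,G^{1,4}_{4,2}\!\left(z_k\,\middle|\,\begin{matrix}\frac{4-2\upsilon}{4},\frac{3-2\upsilon}{4},\frac{2-2\upsilon}{4},\frac{1-2\upsilon}{4};-\\ 0;\ \frac12\end{matrix}\right), \] \[ I_{C}(\upsilon,b,\lambda,y)=\frac{2^{4\upsilon}\sqrt{y}}{\pi}\sum_{k=0}^{\infty}\frac{(\lambda)_k}{k!\,w_k^{2\upsilon+1}}\,G^{1,4}_{4,2}\!\left(z_k\,\middle|\,\begin{matrix}\frac{3-2\upsilon}{4},\frac{2-2\upsilon}{4},\frac{1-2\upsilon}{4},\frac{-2\upsilon}{4};-\\ -\frac14;\ \frac14\end{matrix}\right), \] \[ I_{C}(\upsilon,b,\lambda,y)=\frac{2^{4\upsilon-\frac{9}{2}}}{\pi y}\sum_{k=0}^{\infty}\frac{(\lambda)_k}{k!\,w_k^{2\upsilon-2}}\,G^{1,4}_{4,2}\!\left(z_k\,\middle|\,\begin{matrix}\frac{6-2\upsilon}{4},\frac{5-2\upsilon}{4},\frac{4-2\upsilon}{4},\frac{3-2\upsilon}{4};-\\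 \frac12;\ 1\end{matrix}\right), \] \[ I_{C}(\upsilon,b,\lambda,y)=\frac{y\,2^{4\upsilon+\frac{3}{2}}}{\pi}\sum_{k=0}^{\infty}\frac{(\lambda)_k}{k!\,w_k^{2\upsilon+2}}\,G^{1,4}_{4,2}\!\left(z_k\,\middle|\,\begin{matrix}\frac{2-2\upsilon}{4},\frac{1-2\upsilon}{4},\frac{-2\upsilon}{4},\frac{-1-2\upsilon}{4};-\\ -\frac12;\ 0\end{matrix}\right), \] \[ I_{C}(\upsilon,b,\lambda,y)=\frac{2^{6\upsilon-\frac{7}{2}}}{\pi^{3}}\sum_{k=0}^{\infty}\frac{(\lambda)_k}{k!\,w_k^{2\upsilon}}\,G^{2,8}_{8,4}\!\left(\frac{4^{8}y^{4}}{w_k^{8}}\,\middle|\,\begin{matrix}\frac{8-2\upsilon}{8},\frac{7-2\upsilon}{8},\frac{6-2\upsilon}{8},\frac{5-2\upsilon}{8},\frac{4-2\upsilon}{8},\frac{3-2\upsilon}{8},\frac{2-2\upsilon}{8},\frac{1-2\upsilon}{8};-\\ 0,\frac12;\ \frac14,\frac34\end{matrix}\right). \]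
   Context: Meijer's $G$-function is defined by the Mellin–Barnes integral \[ G^{m,n}_{p,q}\!\left(z\,\middle|\,\begin{matrix}\alpha_1,\dots,\alpha_n;\alpha_{n+1},\dots,\alpha_p\\ \beta_1,\dots,\beta_m;\beta_{m+1},\dots,\beta_q\end{matrix}\right)=\frac{1}{2\pi i}\int_{L}\frac{\prod_{j=1}^{m}\Gamma(\beta_j-\zeta)\prod_{j=1}^{n}\Gamma(1-\alpha_j+\zeta)}{\prod_{j=m+1}^{q}\Gamma(1-\beta_j+\zeta)\prod_{j=n+1}^{p}\Gamma(\alpha_j-\zeta)}\,z^{\zeta}\,d\zeta, \] where $L$ is an upward-oriented contour from $-i\infty$ to $+i\infty$ separating the poles of the $\Gamma(\beta_j-\zeta)$ ($j\le m$) from those of the $\Gamma(1-\alpha_j+\zeta)$ ($j\le n$), and $z\neq0$. In the parameter display, the upper row lists $\alpha_1,\dots,\alpha_n$ then (after the semicolon) $\alpha_{n+1},\dots,\alpha_p$, with "$-$" meaning that this second group is empty; the lower row lists $\beta_1,\dots,\beta_m$ then $\beta_{m+1},\dots,\beta_q$.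
   Formalization: The integral I_C is assumed absolutely convergent (it diverges e.g. for υ=1/4, λ=b=1); for complex b, λ the power in the denominator is the branch continuous in x, and G is taken at arg z_k = -4 Arg w_k (in the fifth formula -8 Arg w_k) rather than at the principal argument. *)

theory Defs
  imports "HOL-Analysis.Analysis"
begin

text \<open>
  Meijer's function is many-valued in its argument \<open>z\<close>: the integrand contains
  \<open>z powr \<zeta> = exp (\<zeta> * log z)\<close>.  It is therefore taken here as a function of a value
  \<open>s\<close> of \<open>log z\<close>, that is, of a point of the Riemann surface of the logarithm.  The four lists
  are the four groups of parameters \<open>\<alpha>\<^sub>1,\<dots>,\<alpha>\<^sub>n; \<alpha>\<^sub>n\<^sub>+\<^sub>1,\<dots>,\<alpha>\<^sub>p\<close> and
  \<open>\<beta>\<^sub>1,\<dots>,\<beta>\<^sub>m; \<beta>\<^sub>m\<^sub>+\<^sub>1,\<dots>,\<beta>\<^sub>q\<close>; the orders \<open>m, n, p, q\<close> are determined by their lengths.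

  Since \<open>Gamma\<close> is 0 at its poles and division by 0 gives 0, the factors in the denominator are
  the entire function \<open>rGamma\<close>.
\<close>

definition meijer_integrand ::
  "complex list \<Rightarrow> complex list \<Rightarrow> complex list \<Rightarrow> complex list \<Rightarrow> complex \<Rightarrow> complex \<Rightarrow> complex"
  where
  "meijer_integrand as as' bs bs' s \<zeta> =
     (\<Prod>\<beta>\<leftarrow>bs. Gamma (\<beta> - \<zeta>)) * (\<Prod>\<alpha>\<leftarrow>as. Gamma (1 - \<alpha> + \<zeta>)) /
     ((\<Prod>\<beta>\<leftarrow>bs'. Gamma (1 - \<beta> + \<zeta>)) * (\<Prod>\<alpha>\<leftarrow>as'. Gamma (\<alpha> - \<zeta>))) * exp (\<zeta> * s)"

text \<open>
  An upward contour from \<open>-\<i>\<infinity>\<close> to \<open>+\<i>\<infinity>\<close>: an arbitrary piecewise smooth curve that is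
  vertical outside a bounded set.  Its left (right) side is the component of the complement that
  contains a left (right) half-plane.
\<close>

definition upward_contour :: "(real \<Rightarrow> complex) \<Rightarrow> bool" where
  "upward_contour \<gamma> \<longleftrightarrow>
     (\<forall>u v. \<gamma> piecewise_C1_differentiable_on {u..v}) \<and>
     (\<exists>c T. \<forall>t. \<bar>t\<bar> \<ge> T \<longrightarrow> \<gamma> t = Complex c t)"

definition left_side :: "(real \<Rightarrow> complex) \<Rightarrow> complex set" where
  "left_side \<gamma> = {p. \<exists>M. \<forall>z. Re z < M \<longrightarrow> connected_component (- range \<gamma>) p z}"

definition right_side :: "(real \<Rightarrow> complex) \<Rightarrow> complex set" where
  "right_side \<gamma> = {p. \<exists>M. \<forall>z. Re z > M \<longrightarrow> connected_component (- range \<gamma>) p z}"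

definition meijer_contour :: "complex list \<Rightarrow> complex list \<Rightarrow> (real \<Rightarrow> complex) \<Rightarrow> bool" where
  "meijer_contour as bs \<gamma> \<longleftrightarrow>
     upward_contour \<gamma> \<and>
     (\<forall>\<beta>\<in>set bs. \<forall>\<zeta>. \<beta> - \<zeta> \<in> \<int>\<^sub>\<le>\<^sub>0 \<longrightarrow> \<zeta> \<in> right_side \<gamma>) \<and>
     (\<forall>\<alpha>\<in>set as. \<forall>\<zeta>. 1 - \<alpha> + \<zeta> \<in> \<int>\<^sub>\<le>\<^sub>0 \<longrightarrow> \<zeta> \<in> left_side \<gamma>)"

text \<open>
  The description by \<open>THE\<close> is legitimate where the integral converges, as its value does not depend
  on the separating contour.
\<close>

definition meijer_G ::
  "complex list \<Rightarrow> complex list \<Rightarrow> complex list \<Rightarrow> complex list \<Rightarrow> complex \<Rightarrow> complex" where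
  "meijer_G as as' bs bs' s =
     (THE v. \<exists>\<gamma> J. meijer_contour as bs \<gamma> \<and>
        ((\<lambda>t. meijer_integrand as as' bs bs' s (\<gamma> t) * vector_derivative \<gamma> (at t))
           has_integral J) UNIV \<and>
        v = 1 / (2 * complex_of_real pi * \<i>) * J)"

text \<open>
  The logarithm of \<open>c / w ^ n\<close> whose argument is \<open>- n * Arg w\<close>.  For complex \<open>w\<close> it need not be
  the principal one.
\<close>

definition log_quot :: "real \<Rightarrow> complex \<Rightarrow> nat \<Rightarrow> complex" where
  "log_quot c w n = complex_of_real (ln c) - of_nat n * Ln w"

lemma exp_log_quot:
  assumes "c > 0" "w \<noteq> 0"
  shows "exp (log_quot c w n) = complex_of_real c / w ^ n"
  using assms
  by (simp add: log_quot_def exp_diff exp_of_nat_mult exp_of_real)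

lemma log_quot_pos_real:
  assumes "c > 0" "r > 0"
  shows "log_quot c (complex_of_real r) n = Ln (complex_of_real c / complex_of_real r ^ n)"
proof -
  have "Ln (complex_of_real c / complex_of_real r ^ n) = Ln (complex_of_real (c / r ^ n))"
    by simp
  also have "\<dots> = complex_of_real (ln (c / r ^ n))"
    using assms by (subst Ln_of_real) auto
  finally show ?thesis
    using assms by (simp add: log_quot_def Ln_of_real ln_div ln_realpow)
qed

text \<open>
  The power \<open>(exp u - 1) powr l\<close> for \<open>Re u > 0\<close>, with the branch that is analytic in \<open>u\<close> on this
  half-plane and positive for positive \<open>u\<close> and real \<open>l\<close>.  For complex \<open>u\<close> the principal branch
  would jump whenever \<open>exp u - 1\<close> crosses the negative real axis.
\<close>

definition exp_minus_one_pow :: "complex \<Rightarrow> complex \<Rightarrow> complex" where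
  "exp_minus_one_pow u l = exp (l * (u + Ln (1 - exp (- u))))"

lemma exp_minus_one_pow_of_nat:
  assumes "Re u > 0"
  shows "exp_minus_one_pow u (of_nat n) = (exp u - 1) ^ n"
proof -
  have "norm (exp (- u)) < 1" using assms by simp
  hence "exp (- u) \<noteq> 1" by (metis less_irrefl norm_one)
  hence "1 - exp (- u) \<noteq> 0" by simp
  hence "exp (u + Ln (1 - exp (- u))) = exp u - 1"
    by (simp add: exp_add exp_minus field_simps)
  thus ?thesis by (simp add: exp_minus_one_pow_def exp_of_nat_mult)
qed

lemma exp_minus_one_pow_pos_real:
  assumes "r > 0"
  shows "exp_minus_one_pow (complex_of_real r) l = (exp (complex_of_real r) - 1) powr l"
proof -
  have pos: "exp (- r) < 1" "exp r > 1" using assms by auto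
  have "Ln (1 - exp (- complex_of_real r)) = Ln (complex_of_real (1 - exp (- r)))"
    by (simp add: exp_of_real[symmetric])
  also have "\<dots> = complex_of_real (ln (1 - exp (- r)))"
    using pos by (subst Ln_of_real) auto
  finally have 1: "Ln (1 - exp (- complex_of_real r)) = complex_of_real (ln (1 - exp (- r)))" .
  have "exp r - 1 = exp r * (1 - exp (- r))"
    by (simp add: algebra_simps exp_minus_inverse)
  hence 2: "ln (exp r - 1) = r + ln (1 - exp (- r))"
    using pos by (simp add: ln_mult)
  have "Ln (exp (complex_of_real r) - 1) = Ln (complex_of_real (exp r - 1))"
    by (simp add: exp_of_real[symmetric])
  also have "\<dots> = complex_of_real (ln (exp r - 1))"
    using pos by (subst Ln_of_real) auto
  finally have 3: "Ln (exp (complex_of_real r) - 1) = complex_of_real r + Ln (1 - exp (- complex_of_real r))"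
    using 1 2 by simp
  have "exp (complex_of_real r) - 1 = complex_of_real (exp r - 1)"
    by (simp add: exp_of_real[symmetric])
  hence "exp (complex_of_real r) - 1 \<noteq> 0"
    using pos by (metis diff_gt_0_iff_gt less_irrefl of_real_eq_0_iff)
  thus ?thesis by (simp add: exp_minus_one_pow_def powr_def 3)
qed

definition IC_integrand ::
  "complex \<Rightarrow> complex \<Rightarrow> complex \<Rightarrow> real \<Rightarrow> real \<Rightarrow> complex" where
  "IC_integrand \<upsilon> b l y x =
     complex_of_real x powr (\<upsilon> - 1) * complex_of_real (cos (x * y)) /
     exp_minus_one_pow (b * complex_of_real (sqrt x)) l"

definition IC :: "complex \<Rightarrow> complex \<Rightarrow> complex \<Rightarrow> real \<Rightarrow> complex" where
  "IC \<upsilon> b l y = (LINT x:{0<..}|lborel. IC_integrand \<upsilon> b l y x)"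

end

theory Submission
  imports Defs "HOL-Complex_Analysis.Complex_Analysis"
begin

text \<open>
  Integrability of the integrand at infinity forces \<open>Re (l * b) > 0\<close>, so all \<open>w\<^sub>k\<close> lie in the right
  half-plane. The binomial series for \<open>(exp u - 1) powr (- l)\<close>, \<open>u = b * sqrt x\<close>, may then be integrated
  term by term, because its partial sums are dominated by a multiple of the integrand itself near 0
  and by \<open>x powr (Re \<upsilon> - 1) * exp (- Re (l * b) * sqrt x)\<close> elsewhere. There remain the integrals of
  \<open>x powr (\<upsilon> - 1) * cos (x * y) * exp (- w * sqrt x)\<close>. For \<open>exp (- v * x)\<close> with \<open>Re v > 0\<close> in place of the
  cosine, inserting the Cahen-Mellin integral for \<open>exp (- v * x)\<close> and Fubini give a Mellin-Barnes
  integral over \<open>Gamma s * Gamma (2 * (\<upsilon> - s)) * v powr (- s) * w powr (2 * (s - \<upsilon>))\<close>, and \<open>v\<close> may tend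
  to \<open>\<plusminus> \<i> * y\<close> since \<open>\<bar>Arg w\<bar> < \<pi> / 2\<close> leaves exponential decay to spare. The duplication and
  reflection formulas identify the result with the integrands of the \<open>G\<close>-functions at \<open>\<zeta> = - s / 2\<close> and
  \<open>\<zeta> = - s / 4\<close>; the middle three \<open>G\<close>-functions arise from the first by a translation of \<open>\<zeta>\<close>. That every
  separating contour gives the same value as a vertical line is Cauchy's theorem in its homology form:
  a path joining a pole to the far left or right shows that its winding number vanishes.
\<close>

section \<open>Laplace transforms of powers\<close>

text \<open>\<open>Re l > 0\<close> and \<open>Re b > 0\<close> do not give
  \<open>Re (l * b) > 0\<close>, since the arguments of \<open>l\<close> and \<open>b\<close> may
  add up to more than a right angle; only the existence of the integral can supply it. Existence
  also settles the behaviour at 0: with absolute values inside, the binomial series has the order of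
  \<open>x powr (- Re l / 2)\<close> there, which is the order of the integrand's own denominator,
  so the integrand is its own majorant. The other difficulty is the balance of exponentials on
  vertical lines. The decay of \<open>Gamma s\<close>, of rate pi / 2, is used up by the growth of
  the powers of \<open>\<i> * y\<close> and \<open>- \<i> * y\<close>. The surplus comes from
  \<open>Gamma (2 * (\<upsilon> - s))\<close>, of rate pi, against a power of \<open>w\<close> that
  grows at rate at most \<open>2 * \<bar>Arg w\<bar>\<close>. Since every estimate tolerates an
  arbitrarily small loss in the rate, Stirling's formula is avoided: the Laplace integral with
  complex \<open>w\<close> already contains the decay of Gamma.\<close>

lemma laplace_powr_measurable [measurable]:
  "(\<lambda>t. indicator {0<..} t *\<^sub>R (complex_of_real t powr a * exp (- w * of_real t))) \<in> borel_measurable borel"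
  by (intro borel_measurable_continuous_on_indicator) (auto intro!: continuous_intros)

lemma norm_laplace_powr:
  "norm (indicator {0<..} t *\<^sub>R (complex_of_real t powr a * exp (- w * of_real t)))
     = indicator {0<..} t * (t powr Re a * exp (- Re w * t))"
  by (auto simp: indicator_def norm_mult norm_powr_real_powr)

lemma integrable_laplace_powr_real:
  fixes s r :: real
  assumes "s > 0" "r > 0"
  shows "integrable lborel (\<lambda>t. indicator {0<..} t * (t powr (s - 1) * exp (- r * t)))"
proof -
  have "set_integrable lebesgue {0<..} (\<lambda>t. complex_of_real t powr (complex_of_real s - 1) / of_real (exp (r * t)))"
    using absolutely_integrable_Gamma_integral[of "of_real s" r] assms by simp
  hence "integrable lebesgue (\<lambda>t. norm (indicator {0<..} t *\<^sub>R (complex_of_real t powr (complex_of_real s - 1) / of_real (exp (r * t)))))"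
    unfolding set_integrable_def by (rule integrable_norm)
  also have "(\<lambda>t. norm (indicator {0<..} t *\<^sub>R (complex_of_real t powr (complex_of_real s - 1) / of_real (exp (r * t)))))
     = (\<lambda>t. indicator {0<..} t * (t powr (s - 1) * exp (- r * t)))"
    by (auto simp: indicator_def fun_eq_iff norm_mult norm_divide norm_powr_real_powr exp_minus field_simps)
  finally show ?thesis
    by (subst (asm) integrable_completion) measurable
qed

lemma integrable_laplace_powr:
  assumes "Re s > 0" "Re w > 0"
  shows "integrable lborel (\<lambda>t. indicator {0<..} t *\<^sub>R (complex_of_real t powr (s - 1) * exp (- w * of_real t)))"
proof (rule Bochner_Integration.integrable_bound[OF integrable_laplace_powr_real[of "Re s" "Re w"]])
  show "AE t in lborel. norm (indicator {0<..} t *\<^sub>R (complex_of_real t powr (s - 1) * exp (- w * of_real t)))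
     \<le> norm (indicator {0<..} t * (t powr (Re s - 1) * exp (- Re w * t)))"
    by (subst norm_laplace_powr) (simp add: indicator_def)
qed (use assms in auto)

lemma laplace_powr_real:
  assumes "Re s > 0" "r > 0"
  shows "(LINT t|lborel. indicator {0<..} t *\<^sub>R (complex_of_real t powr (s - 1) * exp (- of_real r * of_real t)))
           = Gamma s * of_real r powr (- s)"
proof -
  let ?f = "\<lambda>r t. indicator {0<..} t *\<^sub>R (complex_of_real t powr (s - 1) * exp (- of_real r * of_real t))"
  have "integrable lborel (?f 1)"
    using integrable_laplace_powr[of s 1] assms by simp
  hence "(?f 1 has_integral (LINT t|lborel. ?f 1 t)) UNIV"
    by (rule has_integral_integral_lborel)
  moreover have "?f 1 = (\<lambda>t. if t \<in> {0<..} then complex_of_real t powr (s - 1) / of_real (exp t) else 0)"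
    by (auto simp: fun_eq_iff exp_minus field_simps exp_of_real)
  ultimately have "((\<lambda>t. if t \<in> {0<..} then complex_of_real t powr (s - 1) / of_real (exp t) else 0)
      has_integral (LINT t|lborel. ?f 1 t)) UNIV"
    by metis
  hence "((\<lambda>t. complex_of_real t powr (s - 1) / of_real (exp t)) has_integral (LINT t|lborel. ?f 1 t)) {0<..}"
    by (subst (asm) has_integral_restrict_UNIV)
  with Gamma_integral_complex'[OF assms(1)] have G: "(LINT t|lborel. ?f 1 t) = Gamma s"
    by (rule has_integral_unique[rotated])
  have "(LINT t|lborel. ?f 1 t) = \<bar>r\<bar> *\<^sub>R (LINT t|lborel. ?f 1 (0 + r * t))"
    using assms by (intro lborel_integral_real_affine) auto
  also have "(\<lambda>t. ?f 1 (0 + r * t)) = (\<lambda>t. of_real r powr (s - 1) * ?f r t)"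
    using assms
    by (auto simp: fun_eq_iff indicator_def powr_times_real zero_less_mult_iff)
  finally have "Gamma s = of_real r * of_real r powr (s - 1) * (LINT t|lborel. ?f r t)"
    using G assms by (simp add: scaleR_conv_of_real mult.assoc)
  also have "of_real r * of_real r powr (s - 1) = complex_of_real r powr s"
    using assms by (simp add: powr_diff)
  finally show ?thesis
    using assms by (simp add: powr_minus field_simps)
qed

text \<open>For \<open>r > \<bar>w\<bar>\<^sup>2 / (2 Re w)\<close> the point \<open>w\<close> lies in the disc of radius \<open>r\<close> around \<open>r\<close>, where
  both sides are given by their binomial expansion at \<open>r\<close>.\<close>

lemma laplace_powr:
  assumes "Re s > 0" "Re w > 0"
  shows "(LINT t|lborel. indicator {0<..} t *\<^sub>R (complex_of_real t powr (s - 1) * exp (- w * of_real t)))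
           = Gamma s * w powr (- s)"
proof -
  have s0: "s \<notin> \<int>\<^sub>\<le>\<^sub>0" using assms by (auto elim!: nonpos_Ints_cases')
  define r where "r = (cmod w)^2 / (2 * Re w) + 1"
  have r: "r > 0" "(cmod w)^2 < 2 * r * Re w"
    using assms by (auto simp: r_def field_simps intro!: add_nonneg_pos)
  define h where "h = w - of_real r"
  have "(cmod h)^2 = (cmod w)^2 - 2 * r * Re w + r^2"
    unfolding h_def cmod_power2 by (simp add: power2_eq_square algebra_simps)
  hence "(cmod h)^2 < r^2" using r by simp
  hence hr: "cmod h < r" using r by (simp add: power2_less_imp_less)
  let ?f = "\<lambda>w s t. indicator {0<..} t *\<^sub>R (complex_of_real t powr (s - 1) * exp (- w * of_real t))"
  let ?g = "\<lambda>n t. ?f (of_real r) s t * ((- h * of_real t) ^ n / fact n)"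
  have g: "?g n = (\<lambda>t. (- h) ^ n / fact n * ?f (of_real r) (s + of_nat n) t)" for n
  proof
    fix t :: real
    show "?g n t = (- h) ^ n / fact n * ?f (of_real r) (s + of_nat n) t"
    proof (cases "t > 0")
      case True
      have "complex_of_real t powr (s + of_nat n - 1) = of_real t powr (s - 1) * of_real t ^ n"
        using True by (simp add: powr_add powr_diff powr_nat field_simps)
      thus ?thesis using True by (simp add: power_mult_distrib power_minus[of "h * _"] power_minus[of h])
    qed auto
  qed
  have int_g: "integrable lborel (?g n)" for n
    unfolding g using assms r by (intro integrable_mult_right integrable_laplace_powr) auto
  have "(\<lambda>N. LINT t|lborel. (\<Sum>n<N. ?g n t)) \<longlonglongrightarrow> (LINT t|lborel. ?f w s t)"
  proof (rule integral_dominated_convergence)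
    \<comment> \<open>The partial sums of the exponential series of \<open>- h * t\<close> are at
      most \<open>exp (cmod h * t)\<close>, and \<open>cmod h < r\<close> leaves an integrable
      majorant.\<close>
    show "integrable lborel (\<lambda>t. indicator {0<..} t * (t powr (Re s - 1) * exp (- (r - cmod h) * t)))"
      using assms hr by (intro integrable_laplace_powr_real) auto
    show "AE t in lborel. (\<lambda>N. \<Sum>n<N. ?g n t) \<longlonglongrightarrow> ?f w s t"
    proof (intro AE_I2)
      fix t :: real
      have "(\<lambda>n. (- h * of_real t) ^ n / fact n) sums exp (- h * of_real t)"
        using exp_converges[of "- h * of_real t"] by (simp add: scaleR_conv_of_real field_simps)
      from sums_mult[OF this, of "?f (of_real r) s t"]
      have "(\<lambda>n. ?g n t) sums (?f (of_real r) s t * exp (- h * of_real t))" .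
      also have "?f (of_real r) s t * exp (- h * of_real t) = ?f w s t"
        by (auto simp: indicator_def h_def algebra_simps exp_diff exp_add exp_minus field_simps)
      finally show "(\<lambda>N. \<Sum>n<N. ?g n t) \<longlonglongrightarrow> ?f w s t" by (simp add: sums_def)
    qed
    fix N :: nat
    show "AE t in lborel. norm (\<Sum>n<N. ?g n t) \<le> indicator {0<..} t * (t powr (Re s - 1) * exp (- (r - cmod h) * t))"
    proof (intro AE_I2)
      fix t :: real
      show "norm (\<Sum>n<N. ?g n t) \<le> indicator {0<..} t * (t powr (Re s - 1) * exp (- (r - cmod h) * t))"
      proof (cases "t > 0")
        case True
        have "(\<Sum>n<N. ?g n t) = ?f (of_real r) s t * (\<Sum>n<N. (- h * of_real t) ^ n / fact n)"
          by (simp only: sum_distrib_left)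
        hence "norm (\<Sum>n<N. ?g n t) = t powr (Re s - 1) * exp (- r * t) * norm (\<Sum>n<N. (- h * of_real t) ^ n / fact n)"
          using norm_laplace_powr[of t "s-1" "of_real r"] True by (simp add: norm_mult)
        also have "norm (\<Sum>n<N. (- h * of_real t) ^ n / fact n) \<le> (\<Sum>n<N. (cmod h * t) ^ n / fact n)"
          using True by (intro sum_norm_le) (simp add: norm_divide norm_mult norm_power)
        also have "\<dots> \<le> exp (cmod h * t)"
          using exp_converges[of "cmod h * t"] True
          by (intro sum_le_suminf[THEN order_trans, OF _ _ _ eq_refl[OF sums_unique[symmetric]]])
             (auto simp: sums_iff field_simps)
        finally show ?thesis using True
          by (simp add: mult_left_mono algebra_simps exp_diff exp_add exp_minus field_simps)
      qed auto
    qed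
  qed (auto intro!: borel_measurable_sum)
  also have "(\<lambda>N. LINT t|lborel. (\<Sum>n<N. ?g n t)) = (\<lambda>N. \<Sum>n<N. LINT t|lborel. ?g n t)"
    using int_g by (intro ext Bochner_Integration.integral_sum) auto
  also have "(\<lambda>n. LINT t|lborel. ?g n t) = (\<lambda>n. Gamma s * of_real r powr (- s) * ((- s gchoose n) * (h / of_real r) ^ n))"
  proof
    fix n
    have "(LINT t|lborel. ?g n t) = (- h) ^ n / fact n * (Gamma (s + of_nat n) * of_real r powr (- (s + of_nat n)))"
      using assms r by (subst g, subst integral_mult_right_zero, subst laplace_powr_real) auto
    also have "Gamma (s + of_nat n) = pochhammer s n * Gamma s"
      using pochhammer_Gamma[OF s0, of n] Gamma_eq_zero_iff[of s] s0 by simp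
    also have "of_real r powr (- (s + of_nat n)) = of_real r powr (- s) / of_real r ^ n"
      using r by (simp add: powr_diff powr_minus powr_nat powr_add field_simps)
    also have "(- h) ^ n / fact n * (pochhammer s n * Gamma s * (of_real r powr (- s) / of_real r ^ n)) =
        Gamma s * of_real r powr (- s) * ((- s gchoose n) * (h / of_real r) ^ n)"
      by (simp add: gbinomial_pochhammer power_minus[of h] power_divide mult_ac)
    finally show "(LINT t|lborel. ?g n t) = Gamma s * of_real r powr (- s) * ((- s gchoose n) * (h / of_real r) ^ n)" .
  qed
  finally have A: "(\<lambda>n. Gamma s * of_real r powr (- s) * ((- s gchoose n) * (h / of_real r) ^ n)) sums
      (LINT t|lborel. ?f w s t)"
    by (simp add: sums_def)
  have B: "(\<lambda>n. Gamma s * of_real r powr (- s) * ((- s gchoose n) * (h / of_real r) ^ n)) sums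
      (Gamma s * of_real r powr (- s) * (1 + h / of_real r) powr (- s))"
    using hr r by (intro sums_mult gen_binomial_complex) (simp add: norm_divide)
  \<comment> \<open>Principal powers multiply here because \<open>r\<close> is positive: dividing
    \<open>w\<close> by \<open>r\<close> does not change its argument.\<close>
  have C: "of_real r powr (- s) * (1 + h / of_real r) powr (- s) = w powr (- s)"
  proof -
    have w0: "w \<noteq> 0" using assms by auto
    have 1: "1 + h / of_real r = of_real (inverse r) * w" using r by (simp add: h_def field_simps)
    have "Ln (of_real (inverse r) * w) = of_real (ln (inverse r)) + Ln w"
      using Ln_times_of_real[of "inverse r" w] r w0 by (simp add: Ln_of_real del: of_real_inverse)
    moreover have "Ln (complex_of_real r) = of_real (ln r)" using r by (simp add: Ln_of_real)
    ultimately have e: "Ln w = Ln (of_real r) + Ln (of_real (inverse r) * w)"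
      using r by (simp only: ln_inverse of_real_minus add.assoc[symmetric] right_minus add_0)
    have "exp (- s * Ln (of_real r)) * exp (- s * Ln (of_real (inverse r) * w)) = exp (- s * Ln w)"
      by (simp only: e exp_add[symmetric] distrib_left)
    thus ?thesis unfolding 1 using r w0 by (simp add: powr_def)
  qed
  from sums_unique2[OF A B] show ?thesis by (simp only: mult.assoc C)
qed

section \<open>Decay of the Gamma function on vertical strips\<close>

lemma integrable_exp_minus_abs:
  fixes a :: real
  assumes "a > 0"
  shows "integrable lborel (\<lambda>t. exp (- a * \<bar>t\<bar>))"
proof -
  let ?f = "\<lambda>t. indicator {0<..} t * (t powr (1 - 1) * exp (- a * t)) :: real"
  have 1: "integrable lborel ?f"
    using assms by (intro integrable_laplace_powr_real) auto
  hence 2: "integrable lborel (\<lambda>t. ?f (0 + (-1) * t))"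
    by (intro lborel_integrable_real_affine) auto
  from 1 2 have "integrable lborel (\<lambda>t. ?f t + ?f (0 + (-1) * t))"
    by (rule Bochner_Integration.integrable_add)
  \<comment> \<open>The sum of the two reflected halves equals
    \<open>exp (- a * \<bar>t\<bar>)\<close> except at 0, where both indicators vanish; hence the
    bound holds only almost everywhere.\<close>
  then show ?thesis
    by (rule Bochner_Integration.integrable_bound)
       (use AE_lborel_singleton[of 0] in \<open>auto elim!: eventually_mono simp: indicator_def\<close>)
qed

lemma integrable_exp_decay:
  fixes f :: "real \<Rightarrow> complex"
  assumes "continuous_on UNIV f" "a > 0" "\<And>t. \<bar>t\<bar> \<ge> R \<Longrightarrow> norm (f t) \<le> C * exp (- a * \<bar>t\<bar>)"
  shows "integrable lborel f"
proof -
  have "compact (f ` {-\<bar>R\<bar>..\<bar>R\<bar>})"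
    using assms(1) by (intro compact_continuous_image) (auto intro: continuous_on_subset)
  then obtain M where M: "\<And>t. t \<in> {-\<bar>R\<bar>..\<bar>R\<bar>} \<Longrightarrow> norm (f t) \<le> M"
    by (fastforce dest!: compact_imp_bounded simp: bounded_iff)
  have M0: "M \<ge> 0" using order_trans[OF norm_ge_zero M[of 0]] by simp
  show ?thesis
  proof (rule Bochner_Integration.integrable_bound)
    \<comment> \<open>The second summand takes care of the compact middle part, on which the
      function is only known to be bounded by \<open>M\<close>.\<close>
    show "integrable lborel (\<lambda>t. (\<bar>C\<bar> + M * exp (a * \<bar>R\<bar>)) * exp (- a * \<bar>t\<bar>))"
      using assms(2) by (intro integrable_mult_right integrable_exp_minus_abs)
    show "f \<in> borel_measurable lborel"
      using assms(1) by (simp add: borel_measurable_continuous_onI)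
    show "AE t in lborel. norm (f t) \<le> norm ((\<bar>C\<bar> + M * exp (a * \<bar>R\<bar>)) * exp (- a * \<bar>t\<bar>))"
    proof (rule AE_I2)
      fix t :: real
      have "norm (f t) \<le> (\<bar>C\<bar> + M * exp (a * \<bar>R\<bar>)) * exp (- a * \<bar>t\<bar>)"
      proof (cases "\<bar>t\<bar> \<ge> R")
        case True
        have "norm (f t) \<le> C * exp (- a * \<bar>t\<bar>)" by (rule assms(3)[OF True])
        also have "\<dots> \<le> (\<bar>C\<bar> + M * exp (a * \<bar>R\<bar>)) * exp (- a * \<bar>t\<bar>)"
          using M0 by (intro mult_right_mono) (auto intro!: add_increasing2)
        finally show ?thesis .
      next
        case False
        hence "a * \<bar>t\<bar> \<le> a * \<bar>R\<bar>" using assms(2) by (intro mult_left_mono) auto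
        hence "1 \<le> exp (a * \<bar>R\<bar>) * exp (- a * \<bar>t\<bar>)" by (simp add: exp_add[symmetric])
        hence "M * 1 \<le> M * (exp (a * \<bar>R\<bar>) * exp (- a * \<bar>t\<bar>))" using M0 by (rule mult_left_mono)
        moreover have "norm (f t) \<le> M" using False by (intro M) auto
        ultimately show ?thesis by (simp add: distrib_right add_increasing mult.assoc)
      qed
      thus "norm (f t) \<le> norm ((\<bar>C\<bar> + M * exp (a * \<bar>R\<bar>)) * exp (- a * \<bar>t\<bar>))"
        by (rule order_trans) auto
    qed
  qed
qed

text \<open>In the Laplace formula with \<open>w = exp (\<i> * \<phi>)\<close> the factor
  \<open>w powr (- s)\<close> has modulus \<open>exp (\<phi> * Im s)\<close>, while the integral of
  the absolute values depends on \<open>Re s\<close> and \<open>\<phi>\<close> only. Dividing yields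
  exponential decay at any rate below pi / 2.\<close>

lemma norm_Gamma_rotate_bound:
  assumes "Re s > 0" "\<bar>\<phi>\<bar> < pi / 2"
  shows "norm (Gamma s) \<le> exp (- \<phi> * Im s) * (LINT t|lborel. indicator {0<..} t * (t powr (Re s - 1) * exp (- cos \<phi> * t)))"
proof -
  define w where "w = exp (\<i> * of_real \<phi>)"
  have c: "cos \<phi> > 0" using assms by (intro cos_gt_zero_pi) auto
  have rw: "Re w = cos \<phi>" by (simp add: w_def Re_exp)
  have lw: "Ln w = \<i> * of_real \<phi>" unfolding w_def using assms by (intro Ln_exp) auto
  have w0: "w \<noteq> 0" by (simp add: w_def)
  have "norm (Gamma s * w powr (- s)) \<le> (LINT t|lborel. norm (indicator {0<..} t *\<^sub>R (complex_of_real t powr (s - 1) * exp (- w * of_real t))))"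
    using assms c rw by (subst laplace_powr[symmetric]) (auto simp del: norm_scaleR)
  also have "norm (Gamma s * w powr (- s)) = norm (Gamma s) * exp (\<phi> * Im s)"
    using w0 lw by (simp add: norm_mult powr_def)
  finally show ?thesis
    unfolding norm_laplace_powr rw by (simp add: exp_minus field_simps)
qed

lemma norm_Gamma_right_strip_bound:
  assumes "0 < a" "0 \<le> \<theta>" "\<theta> < pi / 2"
  obtains C where "C > 0" "\<And>s. a \<le> Re s \<Longrightarrow> Re s \<le> b \<Longrightarrow> norm (Gamma s) \<le> C * exp (- \<theta> * \<bar>Im s\<bar>)"
proof -
  let ?I = "\<lambda>\<sigma> t. indicator {0<..} t * (t powr (\<sigma> - 1) * exp (- cos \<theta> * t)) :: real"
  \<comment> \<open>A power with exponent between those for \<open>a\<close> and \<open>b\<close> is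
    below the sum of the two extreme ones. The maximum keeps the exponent admissible when
    \<open>b < a\<close>, and adding 1 makes \<open>C\<close> positive.\<close>
  define C where "C = (LINT t|lborel. ?I a t + ?I (max a b) t) + 1"
  have c: "cos \<theta> > 0" using assms by (intro cos_gt_zero_pi) auto
  have int: "integrable lborel (?I \<sigma>)" if "\<sigma> > 0" for \<sigma>
    using that c by (intro integrable_laplace_powr_real) auto
  have "(LINT t|lborel. ?I a t + ?I (max a b) t) \<ge> 0"
    by (intro Bochner_Integration.integral_nonneg) auto
  hence C: "C > 0" unfolding C_def by linarith
  show ?thesis
  proof (rule that[OF C])
    fix s assume s: "a \<le> Re s" "Re s \<le> b"
    have "(LINT t|lborel. ?I (Re s) t) \<le> (LINT t|lborel. ?I a t + ?I (max a b) t)"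
    proof (intro integral_mono int Bochner_Integration.integrable_add)
      fix t :: real
      have "t powr (Re s - 1) \<le> t powr (a - 1) + t powr (max a b - 1)" if "t > 0"
      proof (cases "t \<le> 1")
        case True
        hence "t powr (Re s - 1) \<le> t powr (a - 1)" using s that by (intro powr_mono') auto
        thus ?thesis by (simp add: add_increasing2)
      next
        case False
        hence "t powr (Re s - 1) \<le> t powr (max a b - 1)" using s by (intro powr_mono) auto
        thus ?thesis by (simp add: add_increasing)
      qed
      thus "?I (Re s) t \<le> ?I a t + ?I (max a b) t"
        by (auto simp: indicator_def distrib_right[symmetric])
    qed (use assms s in auto)
    hence le: "(LINT t|lborel. ?I (Re s) t) \<le> C" by (simp add: C_def)
    \<comment> \<open>The ray is turned in the direction that produces decay for the given sign of
      \<open>Im s\<close>.\<close>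
    define \<phi> where "\<phi> = (if Im s \<ge> 0 then \<theta> else - \<theta>)"
    have \<phi>: "cos \<phi> = cos \<theta>" "\<phi> * Im s = \<theta> * \<bar>Im s\<bar>" "\<bar>\<phi>\<bar> < pi / 2"
      using assms by (auto simp: \<phi>_def)
    have "norm (Gamma s) \<le> exp (- \<theta> * \<bar>Im s\<bar>) * (LINT t|lborel. ?I (Re s) t)"
      using norm_Gamma_rotate_bound[of s \<phi>] assms s \<phi> by simp
    also have "\<dots> \<le> exp (- \<theta> * \<bar>Im s\<bar>) * C"
      using le by (intro mult_left_mono) auto
    finally show "norm (Gamma s) \<le> C * exp (- \<theta> * \<bar>Im s\<bar>)" by (simp add: mult.commute)
  qed
qed

text \<open>The functional equation moves \<open>s\<close> into the right half-plane. Since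
  \<open>\<bar>Im s\<bar> \<ge> 1\<close>, every factor of \<open>pochhammer s n\<close> has modulus
  at least 1, so dividing by it costs nothing.\<close>

lemma norm_Gamma_strip_bound:
  assumes "0 \<le> \<theta>" "\<theta> < pi / 2"
  obtains C where "C > 0"
    "\<And>s. a \<le> Re s \<Longrightarrow> Re s \<le> b \<Longrightarrow> \<bar>Im s\<bar> \<ge> 1 \<Longrightarrow> norm (Gamma s) \<le> C * exp (- \<theta> * \<bar>Im s\<bar>)"
proof -
  define n where "n = nat \<lceil>- a\<rceil> + 1"
  have n: "a + n > 0" unfolding n_def by linarith
  obtain C where C: "C > 0"
     "\<And>s. a + n \<le> Re s \<Longrightarrow> Re s \<le> b + n \<Longrightarrow> norm (Gamma s) \<le> C * exp (- \<theta> * \<bar>Im s\<bar>)"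
    using norm_Gamma_right_strip_bound[OF n assms] by blast
  show ?thesis
  proof (rule that[OF C(1)])
    fix s :: complex assume s: "a \<le> Re s" "Re s \<le> b" "\<bar>Im s\<bar> \<ge> 1"
    have s0: "s \<notin> \<int>\<^sub>\<le>\<^sub>0" using s by (auto elim!: nonpos_Ints_cases')
    have "norm (pochhammer s n) = (\<Prod>k=0..<n. norm (s + of_nat k))"
      by (simp add: pochhammer_prod prod_norm)
    also have "\<dots> \<ge> (\<Prod>k=0..<n. 1)"
    proof (rule prod_mono)
      fix k :: nat
      have "1 \<le> \<bar>Im (s + of_nat k)\<bar>" using s by simp
      also have "\<dots> \<le> norm (s + of_nat k)" by (rule abs_Im_le_cmod)
      finally show "0 \<le> (1::real) \<and> 1 \<le> norm (s + of_nat k)" by simp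
    qed
    finally have p: "norm (pochhammer s n) \<ge> 1" by simp
    have "norm (Gamma s) * 1 \<le> norm (Gamma s) * norm (pochhammer s n)"
      using p by (intro mult_left_mono) auto
    also have "\<dots> = norm (Gamma (s + of_nat n))"
      using pochhammer_Gamma[OF s0, of n] Gamma_eq_zero_iff[of s] s0 by (simp add: norm_mult[symmetric])
    also have "\<dots> \<le> C * exp (- \<theta> * \<bar>Im (s + of_nat n)\<bar>)"
      using s by (intro C) auto
    finally show "norm (Gamma s) \<le> C * exp (- \<theta> * \<bar>Im s\<bar>)" by simp
  qed
qed

section \<open>The Cahen-Mellin integral\<close>

text \<open>The integrals in \<open>meijer_G\<close> are gauge integrals and need not converge
  absolutely. Symmetric truncation is all that is used of them.\<close>

lemma has_integral_UNIV_tendsto: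
  fixes f :: "real \<Rightarrow> 'a::banach"
  assumes "(f has_integral J) UNIV"
  shows "((\<lambda>T. integral {-T..T} f) \<longlongrightarrow> J) at_top"
proof (rule tendstoI)
  fix e :: real assume "e > 0"
  moreover have "\<nexists>a b. (UNIV :: real set) = cbox a b"
    by (metis bounded_cbox not_bounded_UNIV)
  ultimately obtain B where B: "B > 0"
    "\<And>a b. ball 0 B \<subseteq> cbox a b \<Longrightarrow> \<exists>z. (f has_integral z) (cbox a b) \<and> norm (z - J) < e"
    using has_integral_altD[OF assms] by (simp add: cbox_interval) metis
  show "\<forall>\<^sub>F T in at_top. dist (integral {-T..T} f) J < e"
    using eventually_ge_at_top[of B]
  proof eventually_elim
    case (elim T)
    hence "ball 0 B \<subseteq> cbox (-T) T" by (auto simp: dist_norm)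
    from B(2)[OF this] show ?case by (auto simp: dist_norm dest: integral_unique)
  qed
qed

lemma integral_lborel_tendsto:
  fixes f :: "real \<Rightarrow> complex"
  assumes "integrable lborel f"
  shows "((\<lambda>T. integral {-T..T} f) \<longlongrightarrow> (LINT t|lborel. f t)) at_top"
  by (rule has_integral_UNIV_tendsto) (rule has_integral_integral_lborel[OF assms])

lemma norm_powr_complex:
  assumes "z \<noteq> 0"
  shows "norm (z powr s) = exp (Re s * ln (norm z) - Im s * Arg z)"
  using assms by (simp add: powr_def Arg_eq_Im_Ln)

lemma norm_powr_strip_bound:
  assumes "z \<noteq> 0"
  obtains K where "K > 0" "\<And>s. a \<le> Re s \<Longrightarrow> Re s \<le> b \<Longrightarrow> norm (z powr s) \<le> K * exp (\<bar>Arg z\<bar> * \<bar>Im s\<bar>)"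
proof
  show "exp (max \<bar>a\<bar> \<bar>b\<bar> * \<bar>ln (norm z)\<bar>) > 0" by simp
  fix s :: complex assume s: "a \<le> Re s" "Re s \<le> b"
  have "Re s * ln (norm z) \<le> \<bar>Re s\<bar> * \<bar>ln (norm z)\<bar>"
    by (metis abs_ge_self abs_mult)
  also have "\<dots> \<le> max \<bar>a\<bar> \<bar>b\<bar> * \<bar>ln (norm z)\<bar>"
    using s by (intro mult_right_mono) auto
  finally have 1: "Re s * ln (norm z) \<le> max \<bar>a\<bar> \<bar>b\<bar> * \<bar>ln (norm z)\<bar>" .
  have "- (Im s * Arg z) \<le> \<bar>Arg z\<bar> * \<bar>Im s\<bar>"
    by (metis abs_ge_minus_self abs_mult mult.commute)
  with 1 show "norm (z powr s) \<le> exp (max \<bar>a\<bar> \<bar>b\<bar> * \<bar>ln (norm z)\<bar>) * exp (\<bar>Arg z\<bar> * \<bar>Im s\<bar>)"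
    by (simp add: norm_powr_complex[OF assms] exp_add[symmetric])
qed

lemma Gamma_powr_strip_bound:
  assumes "Re z > 0"
  obtains C a where "a > 0"
    "\<And>s. x1 \<le> Re s \<Longrightarrow> Re s \<le> x2 \<Longrightarrow> \<bar>Im s\<bar> \<ge> 1 \<Longrightarrow>
        norm (Gamma s * z powr (- s)) \<le> C * exp (- a * \<bar>Im s\<bar>)"
proof -
  have z0: "z \<noteq> 0" using assms by auto
  have A: "\<bar>Arg z\<bar> < pi / 2" using Arg_Re_pos[of z] assms z0 by auto
  \<comment> \<open>Midway between the growth rate of \<open>z powr (- s)\<close> and the unattained
    decay rate pi / 2 of Gamma.\<close>
  define \<theta> where "\<theta> = (\<bar>Arg z\<bar> + pi / 2) / 2"
  have \<theta>: "0 \<le> \<theta>" "\<theta> < pi / 2" "\<theta> - \<bar>Arg z\<bar> > 0" using A by (auto simp: \<theta>_def field_simps)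
  obtain C where C: "C > 0" "\<And>s. x1 \<le> Re s \<Longrightarrow> Re s \<le> x2 \<Longrightarrow> \<bar>Im s\<bar> \<ge> 1 \<Longrightarrow> norm (Gamma s) \<le> C * exp (- \<theta> * \<bar>Im s\<bar>)"
    using norm_Gamma_strip_bound[OF \<theta>(1,2)] by blast
  obtain K where K: "K > 0" "\<And>s. -x2 \<le> Re s \<Longrightarrow> Re s \<le> -x1 \<Longrightarrow> norm (z powr s) \<le> K * exp (\<bar>Arg z\<bar> * \<bar>Im s\<bar>)"
    using norm_powr_strip_bound[OF z0] by blast
  show ?thesis
  proof (rule that[OF \<theta>(3)])
    fix s assume s: "x1 \<le> Re s" "Re s \<le> x2" "\<bar>Im s\<bar> \<ge> 1"
    have "norm (Gamma s) * norm (z powr (- s)) \<le> (C * exp (- \<theta> * \<bar>Im s\<bar>)) * (K * exp (\<bar>Arg z\<bar> * \<bar>Im s\<bar>))"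
      using C(2)[OF s] K(2)[of "- s"] s C(1) by (intro mult_mono) auto
    also have "\<dots> = C * K * exp (- (\<theta> - \<bar>Arg z\<bar>) * \<bar>Im s\<bar>)"
      by (simp add: exp_diff exp_minus algebra_simps field_simps)
    finally show "norm (Gamma s * z powr (- s)) \<le> C * K * exp (- (\<theta> - \<bar>Arg z\<bar>) * \<bar>Im s\<bar>)"
      by (simp add: norm_mult)
  qed
qed

lemma continuous_on_Complex [continuous_intros]:
  assumes "continuous_on A f" "continuous_on A g"
  shows "continuous_on A (\<lambda>x. Complex (f x) (g x))"
  unfolding Complex_eq using assms by (intro continuous_intros)

lemma continuous_on_powr_const:
  fixes w :: complex
  assumes "continuous_on A f"
  shows "continuous_on A (\<lambda>x. w powr f x)"
  unfolding powr_def using assms by (cases "w = 0") (auto intro!: continuous_intros)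

lemma continuous_on_Gamma_compose:
  fixes f :: "'a::topological_space \<Rightarrow> complex"
  assumes "continuous_on A f" "\<And>x. x \<in> A \<Longrightarrow> f x \<notin> \<int>\<^sub>\<le>\<^sub>0"
  shows "continuous_on A (\<lambda>x. Gamma (f x))"
  by (rule continuous_on_compose2[OF continuous_on_Gamma assms(1), of "f ` A"]) (use assms(2) in auto)

lemma Complex_notin_nonpos_Ints:
  assumes "c \<notin> \<int>"
  shows "Complex c t \<notin> \<int>\<^sub>\<le>\<^sub>0"
  using assms by (auto elim!: nonpos_Ints_cases simp: complex_eq_iff)

lemma integrable_Gamma_powr:
  assumes "Re z > 0" "\<And>t. Complex c t \<notin> \<int>\<^sub>\<le>\<^sub>0"
  shows "integrable lborel (\<lambda>t. Gamma (Complex c t) * z powr (- Complex c t))"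
proof -
  have z0: "z \<noteq> 0" using assms by auto
  obtain C a where C: "a > 0" "\<And>s. c \<le> Re s \<Longrightarrow> Re s \<le> c \<Longrightarrow> \<bar>Im s\<bar> \<ge> 1 \<Longrightarrow>
        norm (Gamma s * z powr (- s)) \<le> C * exp (- a * \<bar>Im s\<bar>)"
    using Gamma_powr_strip_bound[OF assms(1)] by blast
  show ?thesis
  proof (rule integrable_exp_decay[OF _ C(1)])
    show "continuous_on UNIV (\<lambda>t. Gamma (Complex c t) * z powr (- Complex c t))"
      using assms(2)
      by (intro continuous_on_mult continuous_on_Gamma_compose continuous_on_powr_const continuous_on_minus
            continuous_on_Complex continuous_on_const continuous_on_id) auto
    show "\<And>t. 1 \<le> \<bar>t\<bar> \<Longrightarrow> cmod (Gamma (Complex c t) * z powr - Complex c t) \<le> C * exp (- a * \<bar>t\<bar>)"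
      using C(2)[of "Complex c _"] by simp
  qed
qed

section \<open>Shifting the line of integration across the poles of Gamma\<close>

lemma norm_contour_integral_horizontal_le:
  assumes "continuous_on (closed_segment (Complex a y) (Complex b y)) f"
    and "\<And>x. min a b \<le> x \<Longrightarrow> x \<le> max a b \<Longrightarrow> norm (f (Complex x y)) \<le> B"
  shows "norm (contour_integral (linepath (Complex a y) (Complex b y)) f) \<le> B * \<bar>b - a\<bar>"
proof -
  have B: "0 \<le> B" using assms(2)[of a] norm_ge_zero[of "f (Complex a y)"] by linarith
  have "norm (contour_integral (linepath (Complex a y) (Complex b y)) f) \<le> B * norm (Complex b y - Complex a y)"
  proof (rule contour_integral_bound_linepath)
    fix x assume "x \<in> closed_segment (Complex a y) (Complex b y)"
    then obtain u where u: "0 \<le> u" "u \<le> 1" and x: "x = (1 - u) *\<^sub>R Complex a y + u *\<^sub>R Complex b y"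
      by (auto simp: closed_segment_def)
    have "Im x = y" unfolding x by (simp add: algebra_simps)
    moreover have "Re x \<in> closed_segment a b"
      unfolding x closed_segment_def using u by auto
    moreover from calculation(2) have "min a b \<le> Re x" "Re x \<le> max a b"
      by (auto simp: closed_segment_eq_real_ivl split: if_splits)
    ultimately show "norm (f x) \<le> B"
      using assms(2)[of "Re x"] by (metis complex_surj)
  qed (use assms B in \<open>auto intro!: contour_integrable_continuous_linepath\<close>)
  also have "Complex b y - Complex a y = of_real (b - a)" by (simp add: complex_eq_iff)
  finally show ?thesis by (simp del: of_real_diff)
qed

text \<open>The left-hand side is minus the contribution of the two horizontal sides, each of length
  \<open>b - a\<close>.\<close>

lemma contour_integral_rectpath_eq:
  assumes "a < b" "T > 0" "continuous_on (path_image (rectpath (Complex a (-T)) (Complex b T))) f"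
    and bd: "\<And>x y. a \<le> x \<Longrightarrow> x \<le> b \<Longrightarrow> \<bar>y\<bar> = T \<Longrightarrow> norm (f (Complex x y)) \<le> B"
  shows "norm (\<i> * integral {-T..T} (\<lambda>t. f (Complex b t)) - \<i> * integral {-T..T} (\<lambda>t. f (Complex a t))
            - contour_integral (rectpath (Complex a (-T)) (Complex b T)) f) \<le> 2 * B * (b - a)"
proof -
  let ?a1 = "Complex a (-T)" and ?a2 = "Complex b (-T)" and ?a3 = "Complex b T" and ?a4 = "Complex a T"
  have pimg: "path_image (rectpath ?a1 ?a3) = closed_segment ?a1 ?a2 \<union> closed_segment ?a2 ?a3 \<union>
       closed_segment ?a3 ?a4 \<union> closed_segment ?a4 ?a1"
    by (auto simp: rectpath_def Let_def path_image_join)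
  have ci: "f contour_integrable_on linepath ?a1 ?a2" "f contour_integrable_on linepath ?a2 ?a3"
           "f contour_integrable_on linepath ?a3 ?a4" "f contour_integrable_on linepath ?a4 ?a1"
    using assms(3) unfolding pimg
    by (auto intro!: contour_integrable_continuous_linepath intro: continuous_on_subset)
  have "contour_integral (rectpath ?a1 ?a3) f = contour_integral (linepath ?a1 ?a2) f
     + contour_integral (linepath ?a2 ?a3) f + contour_integral (linepath ?a3 ?a4) f + contour_integral (linepath ?a4 ?a1) f"
    using ci by (simp add: rectpath_def Let_def add_ac)
  also have "contour_integral (linepath ?a2 ?a3) f = \<i> * integral {-T..T} (\<lambda>t. f (Complex b t))"
    using assms by (intro contour_integral_linepath_same_Re) auto
  also have "contour_integral (linepath ?a4 ?a1) f = - contour_integral (linepath ?a1 ?a4) f"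
    using assms(3) unfolding pimg
    by (intro contour_integral_reverse_linepath) (auto intro: continuous_on_subset simp: closed_segment_commute)
  also have "contour_integral (linepath ?a1 ?a4) f = \<i> * integral {-T..T} (\<lambda>t. f (Complex a t))"
    using assms by (intro contour_integral_linepath_same_Re) auto
  finally have eq: "\<i> * integral {-T..T} (\<lambda>t. f (Complex b t)) - \<i> * integral {-T..T} (\<lambda>t. f (Complex a t))
            - contour_integral (rectpath ?a1 ?a3) f =
      - (contour_integral (linepath ?a1 ?a2) f + contour_integral (linepath ?a3 ?a4) f)" by simp
  have 1: "norm (contour_integral (linepath ?a1 ?a2) f) \<le> B * \<bar>b - a\<bar>"
    using assms(3) unfolding pimg
    by (intro norm_contour_integral_horizontal_le) (use assms in \<open>auto intro: continuous_on_subset\<close>)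
  have 2: "norm (contour_integral (linepath ?a3 ?a4) f) \<le> B * \<bar>a - b\<bar>"
    using assms(3) unfolding pimg
    by (intro norm_contour_integral_horizontal_le) (use assms in \<open>auto intro: continuous_on_subset\<close>)
  have "norm (contour_integral (linepath ?a1 ?a2) f + contour_integral (linepath ?a3 ?a4) f) \<le> B * \<bar>b - a\<bar> + B * \<bar>a - b\<bar>"
    by (rule norm_triangle_mono[OF 1 2])
  thus ?thesis unfolding eq norm_minus_cancel using assms(1) by simp
qed

lemma residue_Gamma_powr:
  assumes "z \<noteq> 0"
  shows "residue (\<lambda>s. Gamma s * z powr (- s)) (- of_nat k) = (- z) ^ k / fact k"
proof (rule residue_simple')
  \<comment> \<open>The plane without the other poles is a neighbourhood of the pole in
    question.\<close>
  show "open (- (\<int>\<^sub>\<le>\<^sub>0 - {-of_nat k}) :: complex set)"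
    by (intro open_Compl closed_subset_Ints) auto
  show "(\<lambda>s. Gamma s * z powr (- s)) holomorphic_on (- (\<int>\<^sub>\<le>\<^sub>0 - {-of_nat k}) - {- of_nat k})"
    using assms by (auto intro!: holomorphic_intros)
  have "continuous_on UNIV (\<lambda>s. z powr (- s))"
    by (intro continuous_on_powr_const continuous_intros)
  hence "((\<lambda>s. z powr (- s)) \<longlongrightarrow> z powr (- (- of_nat k))) (at (- of_nat k))"
    unfolding continuous_on_eq_continuous_at[OF open_UNIV] isCont_def by (rule bspec) simp
  from tendsto_mult[OF Gamma_residues[of k] this] assms
  show "((\<lambda>s. Gamma s * z powr (- s) * (s - (- of_nat k))) \<longlongrightarrow> (- z) ^ k / fact k) (at (- of_nat k))"
    by (simp add: mult_ac power_minus[of z])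
qed auto

text \<open>Moving the line from \<open>c\<close> to \<open>c - N\<close> crosses exactly the poles
  0, -1, ..., -(N-1), whose residues are the first \<open>N\<close> terms of the series of
  \<open>exp (- z)\<close>. The horizontal sides vanish by
  \<open>Gamma_powr_strip_bound\<close>.\<close>

lemma Gamma_powr_shift:
  assumes "Re z > 0" "0 < c" "c < 1"
  shows "(LINT t|lborel. Gamma (Complex c t) * z powr (- Complex c t)) -
         (LINT t|lborel. Gamma (Complex (c - real N) t) * z powr (- Complex (c - real N) t)) =
         2 * of_real pi * (\<Sum>k<N. (- z) ^ k / fact k)"
proof (cases "N = 0")
  case False
  hence N: "N > 0" by simp
  define F where "F = (\<lambda>s. Gamma s * z powr (- s))"
  have z0: "z \<noteq> 0" using assms by auto
  have cI: "c \<notin> \<int>" using assms by (auto elim!: Ints_cases)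
  have cI': "c - real N \<notin> \<int>" using cI by (metis Ints_add Ints_of_nat diff_add_cancel)
  note notin = Complex_notin_nonpos_Ints[OF cI] Complex_notin_nonpos_Ints[OF cI']
  obtain C a where C: "a > 0" "\<And>s. c - real N \<le> Re s \<Longrightarrow> Re s \<le> c \<Longrightarrow> \<bar>Im s\<bar> \<ge> 1 \<Longrightarrow>
        norm (F s) \<le> C * exp (- a * \<bar>Im s\<bar>)"
    unfolding F_def using Gamma_powr_strip_bound[OF assms(1)] by blast
  let ?R = "2 * of_real pi * \<i> * (\<Sum>k<N. (- z) ^ k / fact k)"
  let ?D = "\<lambda>T. \<i> * integral {-T..T} (\<lambda>t. F (Complex c t)) - \<i> * integral {-T..T} (\<lambda>t. F (Complex (c - real N) t))"
  have le: "norm (?D T - ?R) \<le> 2 * (C * exp (- a * T)) * N" if T: "T \<ge> 1" for T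
  proof -
    let ?g = "rectpath (Complex (c - real N) (-T)) (Complex c T)"
    let ?pts = "(\<lambda>k. - of_nat k) ` {..<N} :: complex set"
    \<comment> \<open>This half-plane contains the rectangle, since \<open>c > 0\<close>, and
      excludes the pole \<open>- N\<close> and all later ones, so that only finitely many
      singularities remain.\<close>
    let ?S = "{s. Re s > - real N}"
    have pts: "x \<in> ?pts" if x: "x \<in> ?S" "x \<in> \<int>\<^sub>\<le>\<^sub>0" for x
      using x by (auto elim!: nonpos_Ints_cases')
    have gS: "path_image ?g \<subseteq> ?S"
      using path_image_rectpath_subset_cbox[of "Complex (c - real N) (-T)" "Complex c T"] assms T
      by (auto simp: in_cbox_complex_iff)
    have gpts: "path_image ?g \<inter> \<int>\<^sub>\<le>\<^sub>0 = {}"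
    proof -
      have "Re x = c - real N \<or> Re x = c \<or> \<bar>Im x\<bar> = T" if "x \<in> path_image ?g" for x
        using that T N by (subst (asm) path_image_rectpath) auto
      moreover have "Im x = 0 \<and> Re x \<in> \<int>" if "x \<in> \<int>\<^sub>\<le>\<^sub>0" for x :: complex
        using that by (auto elim!: nonpos_Ints_cases)
      ultimately show ?thesis using cI cI' T by fastforce
    qed
    have "contour_integral ?g F = 2 * pi * \<i> * (\<Sum>p\<in>?pts. winding_number ?g p * residue F p)"
    proof (rule Residue_theorem)
      show "open ?S" by (rule open_halfspace_Re_gt)
      show "connected ?S" by (intro convex_connected convex_halfspace_Re_gt)
      show "F holomorphic_on ?S - ?pts"
        unfolding F_def using pts z0 by (intro holomorphic_intros) auto
      show "path_image ?g \<subseteq> ?S - ?pts"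
        using gS gpts by (auto simp: disjoint_iff)
      show "\<forall>x. x \<notin> ?S \<longrightarrow> winding_number ?g x = 0"
        using assms T by (auto intro!: winding_number_rectpath_outside simp: in_cbox_complex_iff)
    qed auto
    also have "(\<Sum>p\<in>?pts. winding_number ?g p * residue F p) = (\<Sum>p\<in>?pts. residue F p)"
    proof (rule sum.cong)
      fix p assume "p \<in> ?pts"
      then obtain k where "k < N" "p = - of_nat k" by auto
      hence "winding_number ?g p = 1"
        using assms T by (intro winding_number_rectpath) (auto simp: in_box_complex_iff)
      thus "winding_number ?g p * residue F p = residue F p" by simp
    qed auto
    also have "\<dots> = (\<Sum>k<N. (- z) ^ k / fact k)"
      by (subst sum.reindex) (auto simp: inj_on_def F_def residue_Gamma_powr[OF z0])
    finally have ci: "contour_integral ?g F = ?R" by simp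
    have "norm (?D T - contour_integral ?g F) \<le> 2 * (C * exp (- a * T)) * (c - (c - N))"
    proof (rule contour_integral_rectpath_eq)
      show "continuous_on (path_image ?g) F"
        unfolding F_def using gpts
        by (intro continuous_on_mult continuous_on_Gamma continuous_on_powr_const continuous_on_minus
              continuous_on_id) auto
      show "\<And>x y. \<lbrakk>c - real N \<le> x; x \<le> c; \<bar>y\<bar> = T\<rbrakk> \<Longrightarrow> cmod (F (Complex x y)) \<le> C * exp (- a * T)"
        using C(2)[of "Complex _ _"] T by auto
    qed (use T N in auto)
    thus ?thesis by (simp add: ci)
  qed
  have "(?D \<longlongrightarrow> ?R) at_top"
  proof (rule Lim_null_comparison[THEN LIM_zero_cancel])
    show "\<forall>\<^sub>F T in at_top. norm (?D T - ?R) \<le> 2 * (C * exp (- a * T)) * N"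
      using eventually_ge_at_top[of 1] by eventually_elim (rule le)
    have "filterlim (\<lambda>T. - a * T) at_bot at_top"
      using C(1) filterlim_tendsto_pos_mult_at_top[OF tendsto_const C(1) filterlim_ident]
      by (simp add: filterlim_uminus_at_bot)
    hence "((\<lambda>T. exp (- a * T)) \<longlongrightarrow> 0) at_top"
      by (rule filterlim_compose[OF exp_at_bot])
    from tendsto_mult_left[OF tendsto_mult_left[OF this], of "2 * N" C]
    show "((\<lambda>T. 2 * (C * exp (- a * T)) * N) \<longlongrightarrow> 0) at_top" by (simp add: mult_ac)
  qed
  moreover have "(?D \<longlongrightarrow> \<i> * (LINT t|lborel. F (Complex c t)) - \<i> * (LINT t|lborel. F (Complex (c - real N) t))) at_top"
    using integrable_Gamma_powr[OF assms(1) notin(1)] integrable_Gamma_powr[OF assms(1) notin(2)]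
    unfolding F_def by (intro tendsto_intros integral_lborel_tendsto)
  ultimately have "?R = \<i> * (LINT t|lborel. F (Complex c t)) - \<i> * (LINT t|lborel. F (Complex (c - real N) t))"
    by (intro tendsto_unique[of at_top ?D]) auto
  also have "\<dots> = \<i> * ((LINT t|lborel. F (Complex c t)) - (LINT t|lborel. F (Complex (c - real N) t)))"
    by (simp add: algebra_simps)
  finally have "\<i> * ((LINT t|lborel. F (Complex c t)) - (LINT t|lborel. F (Complex (c - real N) t))) =
    \<i> * (2 * of_real pi * (\<Sum>k<N. (- z) ^ k / fact k))" by (simp add: mult_ac)
  thus ?thesis unfolding F_def by simp
qed auto

text \<open>By the functional equation Gamma on the shifted line is Gamma on the original line
  divided by a Pochhammer symbol of modulus at least \<open>(1 - c) * fact n\<close>, while the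
  power contributes \<open>norm z ^ Suc n\<close>.\<close>

lemma Gamma_powr_line_le:
  assumes "Re z > 0" "0 < c" "c < 1"
  shows "norm (Gamma (Complex (c - real (Suc n)) t) * z powr (- Complex (c - real (Suc n)) t)) \<le>
     norm z ^ Suc n / ((1 - c) * fact n) * norm (Gamma (Complex c t) * z powr (- Complex c t))"
proof -
  define s where "s = Complex (c - real (Suc n)) t"
  have z0: "z \<noteq> 0" using assms by auto
  have cI: "c \<notin> \<int>" using assms by (auto elim!: Ints_cases)
  have cI': "c - real (Suc n) \<notin> \<int>" using cI by (metis Ints_add Ints_of_nat diff_add_cancel)
  have s0: "s \<notin> \<int>\<^sub>\<le>\<^sub>0" unfolding s_def by (rule Complex_notin_nonpos_Ints[OF cI'])
  have ss: "s + of_nat (Suc n) = Complex c t" by (simp add: s_def complex_eq_iff)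
  \<comment> \<open>The factors after the first are \<open>k - c + 1\<close> for
    \<open>k = 1, ..., n\<close>, each at least \<open>k\<close>.\<close>
  have "(1 - c) * fact n \<le> pochhammer (1 - c) (Suc n)"
  proof (induction n)
    case (Suc n)
    have "(1 - c) * fact n * (1 + real n) \<le> pochhammer (1 - c) (Suc n) * (1 - c + real (Suc n))"
      using Suc assms by (intro mult_mono) (auto intro!: pochhammer_nonneg)
    thus ?case by (simp add: pochhammer_Suc algebra_simps)
  qed auto
  \<comment> \<open>Read backwards, the factors of \<open>pochhammer s (Suc n)\<close> have real
    parts \<open>c - 1 - k\<close>, so their moduli dominate those of
    \<open>pochhammer (1 - c) (Suc n)\<close> one by one.\<close>
  also have "\<dots> \<le> (\<Prod>k=0..<Suc n. norm (s + of_nat (Suc n - Suc k)))"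
    unfolding pochhammer_prod
  proof (rule prod_mono, intro conjI)
    fix k assume k: "k \<in> {0..<Suc n}"
    have "1 - c + real k = \<bar>Re (s + of_nat (Suc n - Suc k))\<bar>"
      using k assms by (simp add: s_def of_nat_diff)
    also have "\<dots> \<le> norm (s + of_nat (Suc n - Suc k))" by (rule abs_Re_le_cmod)
    finally show "1 - c + real k \<le> norm (s + of_nat (Suc n - Suc k))" .
  qed (use assms in auto)
  also have "\<dots> = norm (pochhammer s (Suc n))"
    unfolding pochhammer_prod prod_norm[symmetric] atLeast0LessThan
    by (rule prod.nat_diff_reindex)
  finally have p: "(1 - c) * fact n \<le> norm (pochhammer s (Suc n))" .
  have fp: "(1 - c) * fact n > 0" using assms by simp
  have "norm (Gamma s) * ((1 - c) * fact n) \<le> norm (Gamma s) * norm (pochhammer s (Suc n))"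
    using p by (intro mult_left_mono) auto
  also have "\<dots> = norm (Gamma (Complex c t))"
    using pochhammer_Gamma[OF s0, of "Suc n", unfolded ss] Gamma_eq_zero_iff[of s] s0 by (simp add: norm_divide)
  finally have "norm (Gamma s) \<le> norm (Gamma (Complex c t)) / ((1 - c) * fact n)"
    using fp by (simp add: pos_le_divide_eq)
  moreover have "norm (z powr (- s)) = norm z ^ Suc n * norm (z powr (- Complex c t))"
  proof -
    have "z powr (- s) = z powr (- Complex c t + of_nat (Suc n))"
      unfolding ss[symmetric] by simp
    moreover have "z powr of_nat (Suc n) = z ^ Suc n"
      using z0 by (intro powr_nat') auto
    ultimately have "z powr (- s) = z powr (- Complex c t) * z ^ Suc n"
      by (simp only: powr_add)
    thus ?thesis by (simp only: norm_mult norm_power mult.commute)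
  qed
  ultimately have "norm (Gamma s) * norm (z powr (- s)) \<le>
      norm (Gamma (Complex c t)) / ((1 - c) * fact n) * (norm z ^ Suc n * norm (z powr (- Complex c t)))"
    by (intro mult_mono) (use fp in auto)
  thus ?thesis by (simp add: s_def norm_mult mult_ac)
qed

text \<open>The line is pushed to the left without end. The integral over it tends to 0, because
  \<open>norm z ^ Suc n / fact n\<close> does, and the collected residues sum to the exponential
  series.\<close>

lemma cahen_mellin:
  assumes "Re z > 0" "0 < c" "c < 1"
  shows "(LINT t|lborel. Gamma (Complex c t) * z powr (- Complex c t)) = 2 * of_real pi * exp (- z)"
proof -
  let ?I = "\<lambda>c. LINT t|lborel. Gamma (Complex c t) * z powr (- Complex c t)"
  let ?M = "LINT t|lborel. norm (Gamma (Complex c t) * z powr (- Complex c t))"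
  have cI: "c \<notin> \<int>" using assms by (auto elim!: Ints_cases)
  have int: "integrable lborel (\<lambda>t. Gamma (Complex c t) * z powr (- Complex c t))"
    by (intro integrable_Gamma_powr assms Complex_notin_nonpos_Ints cI)
  have "(\<lambda>n. ?I (c - real (Suc n))) \<longlonglongrightarrow> 0"
  proof (rule Lim_null_comparison)
    show "\<forall>\<^sub>F n in sequentially. norm (?I (c - real (Suc n))) \<le> norm z ^ Suc n / ((1 - c) * fact n) * ?M"
    proof (rule always_eventually, rule allI)
      fix n
      have cI': "c - real (Suc n) \<notin> \<int>" using cI by (metis Ints_add Ints_of_nat diff_add_cancel)
      have "norm (?I (c - real (Suc n))) \<le> (LINT t|lborel. norm (Gamma (Complex (c - real (Suc n)) t) * z powr (- Complex (c - real (Suc n)) t)))"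
        by (rule integral_norm_bound)
      also have "\<dots> \<le> (LINT t|lborel. norm z ^ Suc n / ((1 - c) * fact n) * norm (Gamma (Complex c t) * z powr (- Complex c t)))"
        by (intro integral_mono integrable_mult_right integrable_norm int integrable_Gamma_powr assms
              Complex_notin_nonpos_Ints cI' Gamma_powr_line_le)
      finally show "norm (?I (c - real (Suc n))) \<le> norm z ^ Suc n / ((1 - c) * fact n) * ?M"
        by simp
    qed
    have "(\<lambda>n. norm z ^ n / fact n) \<longlonglongrightarrow> 0"
      using summable_LIMSEQ_zero[OF summable_exp[of "norm z"]] by (simp add: field_simps)
    hence "(\<lambda>n. norm z ^ n / fact n * (norm z / (1 - c) * ?M)) \<longlonglongrightarrow> 0 * (norm z / (1 - c) * ?M)"
      by (rule tendsto_mult_right)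
    thus "(\<lambda>n. norm z ^ Suc n / ((1 - c) * fact n) * ?M) \<longlonglongrightarrow> 0"
      by (simp add: mult_ac)
  qed
  hence "(\<lambda>n. ?I c - ?I (c - real (Suc n))) \<longlonglongrightarrow> ?I c - 0"
    by (intro tendsto_intros)
  also have "(\<lambda>n. ?I c - ?I (c - real (Suc n))) = (\<lambda>n. 2 * of_real pi * (\<Sum>k<Suc n. (- z) ^ k / fact k))"
    using Gamma_powr_shift[OF assms, of "Suc _"] by (intro ext) simp
  finally have 1: "(\<lambda>n. 2 * of_real pi * (\<Sum>k<Suc n. (- z) ^ k / fact k)) \<longlonglongrightarrow> ?I c" by simp
  have "(\<lambda>k. (- z) ^ k / fact k) sums exp (- z)"
    using exp_converges[of "- z"] by (simp add: scaleR_conv_of_real field_simps)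
  hence "(\<lambda>n. \<Sum>k<Suc n. (- z) ^ k / fact k) \<longlonglongrightarrow> exp (- z)"
    unfolding sums_def by (rule LIMSEQ_Suc)
  hence "(\<lambda>n. 2 * of_real pi * (\<Sum>k<Suc n. (- z) ^ k / fact k)) \<longlonglongrightarrow> 2 * of_real pi * exp (- z)"
    by (intro tendsto_intros)
  with 1 show ?thesis by (rule LIMSEQ_unique)
qed

section \<open>Independence of the contour\<close>

definition truncated_contour :: "(real \<Rightarrow> complex) \<Rightarrow> real \<Rightarrow> real \<Rightarrow> complex" where
  "truncated_contour \<gamma> T = (\<lambda>x. \<gamma> (2 * T * x - T))"

text \<open>Leads from the upper end of a truncated contour to its lower end along a vertical side
  at abscissa \<open>B\<close>. With \<open>B\<close> the abscissa of the comparison line it enters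
  Cauchy's theorem; with \<open>B\<close> far away it serves to compute winding numbers.\<close>

definition return_path :: "real \<Rightarrow> real \<Rightarrow> real \<Rightarrow> real \<Rightarrow> complex" where
  "return_path c B T =
     linepath (Complex c T) (Complex B T) +++ linepath (Complex B T) (Complex B (-T)) +++
     linepath (Complex B (-T)) (Complex c (-T))"

lemma return_path_simps [simp]:
  "valid_path (return_path c B T)" "path (return_path c B T)"
  "pathstart (return_path c B T) = Complex c T" "pathfinish (return_path c B T) = Complex c (-T)"
  by (auto simp: return_path_def intro!: valid_path_join)

lemma path_image_return_path:
  assumes "T \<ge> 0"
  shows "path_image (return_path c B T) =
     {w. \<bar>Im w\<bar> = T \<and> Re w \<in> closed_segment c B} \<union> {w. Re w = B \<and> \<bar>Im w\<bar> \<le> T}"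
proof -
  have "closed_segment (Complex B T) (Complex B (-T)) = {w. Re w = B \<and> \<bar>Im w\<bar> \<le> T}"
    using assms by (auto simp: closed_segment_same_Re closed_segment_eq_real_ivl)
  moreover have "closed_segment (Complex c T) (Complex B T) = {w. Im w = T \<and> Re w \<in> closed_segment c B}"
    "closed_segment (Complex B (-T)) (Complex c (-T)) = {w. Im w = -T \<and> Re w \<in> closed_segment c B}"
    by (auto simp: closed_segment_same_Im closed_segment_commute)
  ultimately show ?thesis
    using assms by (auto simp: return_path_def path_image_join)
qed

text \<open>Along the return path \<open>Ln (\<sigma> * (p - w))\<close> is a primitive of \<open>1 / (w - p)\<close>, hence the
  winding number does not change when the vertical part is moved away from \<open>p\<close>.\<close>

lemma winding_number_return_path:
  assumes "\<bar>\<sigma>\<bar> = 1" "\<sigma> * (Re p - B) > 0" "\<bar>Im p\<bar> < T"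
  shows "winding_number (return_path c B T) p =
     1 / (2 * pi * \<i>) * (Ln (of_real \<sigma> * (p - Complex c (-T))) - Ln (of_real \<sigma> * (p - Complex c T)))"
proof -
  \<comment> \<open>The plane cut along the horizontal ray from \<open>p\<close> that points away
    from the vertical side. The path avoids the cut, as its horizontal sides lie at heights
    \<open>T\<close> and \<open>- T\<close> with \<open>T > \<bar>Im p\<bar>\<close>.\<close>
  let ?S = "{w. of_real \<sigma> * (p - w) \<notin> \<real>\<^sub>\<le>\<^sub>0}"
  have \<sigma>: "\<sigma> = 1 \<or> \<sigma> = -1" using assms(1) by auto
  have sub: "path_image (return_path c B T) \<subseteq> ?S"
  proof -
    have "T \<ge> 0" using assms(3) by linarith
    thus ?thesis using \<sigma> assms(2,3) by (auto simp: path_image_return_path complex_nonpos_Reals_iff)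
  qed
  have p: "p \<notin> path_image (return_path c B T)" using sub by auto
  have "((\<lambda>w. 1 / (w - p)) has_contour_integral
      (Ln (of_real \<sigma> * (p - pathfinish (return_path c B T))) - Ln (of_real \<sigma> * (p - pathstart (return_path c B T))))) (return_path c B T)"
  proof (rule contour_integral_primitive)
    fix w assume w: "w \<in> ?S"
    hence "w \<noteq> p" by auto
    thus "((\<lambda>w. Ln (of_real \<sigma> * (p - w))) has_field_derivative 1 / (w - p)) (at w within ?S)"
      using w \<sigma> by (auto intro!: derivative_eq_intros simp: field_simps)
  qed (use sub in auto)
  thus ?thesis using p
    by (subst winding_number_valid_path) (auto dest: contour_integral_unique)
qed

locale upward_curve =
  fixes \<gamma> :: "real \<Rightarrow> complex" and c T0 :: real
  assumes smooth: "\<And>u v. \<gamma> piecewise_C1_differentiable_on {u..v}"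
    and vertical: "\<And>t. \<bar>t\<bar> \<ge> T0 \<Longrightarrow> \<gamma> t = Complex c t"
    and T0_pos: "T0 > 0"
begin

lemma continuous: "continuous_on A \<gamma>"
proof -
  have "isCont \<gamma> t" for t
    using smooth[of "t - 1" "t + 1"] unfolding piecewise_C1_differentiable_on_def
    by (intro continuous_on_interior[of "{t - 1..t + 1}"]) auto
  thus ?thesis by (intro continuous_at_imp_continuous_on) auto
qed

lemma path_image_truncated: "T > 0 \<Longrightarrow> path_image (truncated_contour \<gamma> T) = \<gamma> ` {-T..T}"
proof -
  assume T: "T > 0"
  have "(\<lambda>x. 2 * T * x - T) ` {0..1} = {-T..T}"
  proof -
    have "(\<lambda>x. 2 * T * x + (- T)) ` {0..1} = {-T..T}"
      unfolding image_affinity_atLeastAtMost using T by simp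
    thus ?thesis by (simp only: add_uminus_conv_diff)
  qed
  thus ?thesis
    unfolding path_image_def truncated_contour_def image_image[symmetric, of \<gamma> "\<lambda>x. 2 * T * x - T"] by simp
qed

lemma valid_path_truncated: "T > 0 \<Longrightarrow> valid_path (truncated_contour \<gamma> T)"
proof -
  assume T: "T > 0"
  have "\<gamma> \<circ> (\<lambda>x. (2 * T) *\<^sub>R x + (- T)) piecewise_C1_differentiable_on {0..1}"
  proof (rule piecewise_C1_differentiable_affine)
    have "(\<lambda>x. 2 * T * x + (- T)) ` {0..1} = {-T..T}"
      unfolding image_affinity_atLeastAtMost using T by simp
    thus "\<gamma> piecewise_C1_differentiable_on (\<lambda>x. 2 * T * x + (- T)) ` {0..1}"
      by (simp only: smooth)
  qed
  thus ?thesis by (simp add: valid_path_def truncated_contour_def o_def)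
qed

lemma truncated_ends:
  assumes "T \<ge> T0"
  shows "pathstart (truncated_contour \<gamma> T) = Complex c (-T)" "pathfinish (truncated_contour \<gamma> T) = Complex c T"
  using assms T0_pos by (auto simp: pathstart_def pathfinish_def truncated_contour_def vertical)

text \<open>Makes the complement open, so that connected components are path components and a point
  can be joined to infinity by a compact path.\<close>

lemma closed_range: "closed (range \<gamma>)"
proof -
  have "range \<gamma> = \<gamma> ` {-T0..T0} \<union> ({w. Re w = c} \<inter> {w. Im w \<ge> T0}) \<union> ({w. Re w = c} \<inter> {w. Im w \<le> - T0})"
    (is "_ = ?A \<union> ?B \<union> ?C")
  proof (intro equalityI subsetI)
    fix w assume "w \<in> range \<gamma>"
    then obtain t where t: "w = \<gamma> t" by auto
    show "w \<in> ?A \<union> ?B \<union> ?C"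
      using vertical[of t] T0_pos by (cases "t \<ge> T0"; cases "t \<le> - T0") (auto simp: t)
  next
    fix w assume "w \<in> ?A \<union> ?B \<union> ?C"
    moreover have "w = \<gamma> (Im w)" if "Re w = c" "\<bar>Im w\<bar> \<ge> T0"
      using vertical[OF that(2)] that(1) by (simp add: complex_eq_iff)
    ultimately show "w \<in> range \<gamma>" using T0_pos by fastforce
  qed
  moreover have "closed ?A"
    by (intro compact_imp_closed compact_continuous_image continuous) auto
  moreover have "closed ?B" "closed ?C"
    by (intro closed_Int closed_halfspace_Re_eq closed_halfspace_Im_ge closed_halfspace_Im_le)+
  ultimately show ?thesis by (simp only: closed_Un)
qed

lemma bounded_Re: obtains A where "\<And>t. \<bar>Re (\<gamma> t)\<bar> \<le> A"
proof -
  have "compact (\<gamma> ` {-T0..T0})" by (intro compact_continuous_image continuous) auto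
  then obtain M where M: "\<And>w. w \<in> \<gamma> ` {-T0..T0} \<Longrightarrow> norm w \<le> M"
    using compact_imp_bounded[of "\<gamma> ` {-T0..T0}"] unfolding bounded_iff by blast
  show ?thesis
  proof (rule that)
    fix t show "\<bar>Re (\<gamma> t)\<bar> \<le> max M \<bar>c\<bar>"
    proof (cases "\<bar>t\<bar> \<ge> T0")
      case True
      thus ?thesis by (simp add: vertical)
    next
      case False
      hence "norm (\<gamma> t) \<le> M" by (intro M imageI) auto
      thus ?thesis using abs_Re_le_cmod[of "\<gamma> t"] by linarith
    qed
  qed
qed

text \<open>Passes from the improper integral in \<open>meijer_G\<close> to a contour integral by an
  affine change of variable. The chain rule may fail only at the finitely many preimages of break
  points, which do not affect the integral.\<close>

lemma contour_integral_truncated: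
  assumes "((\<lambda>t. f (\<gamma> t) * vector_derivative \<gamma> (at t)) has_integral J) UNIV" "T > 0"
  shows "contour_integral (truncated_contour \<gamma> T) f = integral {-T..T} (\<lambda>t. f (\<gamma> t) * vector_derivative \<gamma> (at t))"
proof -
  define h where "h = (\<lambda>t. f (\<gamma> t) * vector_derivative \<gamma> (at t))"
  have "h integrable_on UNIV" using assms by (auto simp: h_def integrable_on_def)
  hence "h integrable_on cbox (-T) T" by (rule integrable_on_subcbox) auto
  hence "(h has_integral integral {-T..T} h) (cbox (-T) T)"
    by (simp add: integrable_integral cbox_interval)
  from has_integral_affinity[OF this, of "2 * T" "- T"]
  have 1: "((\<lambda>x. h (2 * T * x - T)) has_integral (1 / (2 * T)) *\<^sub>R integral {-T..T} h) {0..1}"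
    using assms(2) image_affinity_atLeastAtMost[of "1 / (2 * T)" "1 / 2" "- T" T]
    by (simp add: cbox_interval)
  have 2: "((\<lambda>x. of_real (2 * T) * h (2 * T * x - T)) has_integral integral {-T..T} h) {0..1}"
    using has_integral_mult_right[OF 1, of "of_real (2 * T)"] assms(2) by (simp add: scaleR_conv_of_real)
  obtain S where S: "finite S" "\<gamma> C1_differentiable_on {-T..T} - S"
    using smooth[of "-T" T] unfolding piecewise_C1_differentiable_on_def by blast
  let ?S = "(\<lambda>x. (x + T) / (2 * T)) ` S"
  have "((\<lambda>x. f (truncated_contour \<gamma> T x) * vector_derivative (truncated_contour \<gamma> T) (at x)) has_integral integral {-T..T} h) {0..1}"
  proof (rule has_integral_spike_finite[OF _ _ 2])
    show "finite ?S" using S by auto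
    fix x assume x: "x \<in> {0..1} - ?S"
    have "2 * T * x - T \<notin> S"
    proof
      assume "2 * T * x - T \<in> S"
      hence "(2 * T * x - T + T) / (2 * T) \<in> ?S" by (rule imageI)
      thus False using x assms(2) by simp
    qed
    moreover have "2 * T * x - T \<in> {-T..T}" using x assms(2) by (auto simp: mult_left_le)
    ultimately have "\<gamma> differentiable at (2 * T * x - T)"
      using S(2) by (auto simp: C1_differentiable_on_eq)
    hence "(\<gamma> has_vector_derivative vector_derivative \<gamma> (at (2 * T * x - T))) (at (2 * T * x - T))"
      by (simp add: vector_derivative_works)
    moreover have "((\<lambda>x. 2 * T * x - T) has_vector_derivative (2 * T)) (at x)"
      by (auto intro!: derivative_eq_intros simp flip: has_real_derivative_iff_has_vector_derivative)
    ultimately have "(truncated_contour \<gamma> T has_vector_derivative (2 * T) *\<^sub>R vector_derivative \<gamma> (at (2 * T * x - T))) (at x)"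
      using vector_diff_chain_at[of "\<lambda>x. 2 * T * x - T" "2 * T" x \<gamma>] unfolding truncated_contour_def o_def by blast
    thus "f (truncated_contour \<gamma> T x) * vector_derivative (truncated_contour \<gamma> T) (at x) = of_real (2 * T) * h (2 * T * x - T)"
      by (simp add: vector_derivative_at h_def truncated_contour_def scaleR_conv_of_real)
  qed
  thus ?thesis
    unfolding h_def contour_integral_integral by (rule integral_unique)
qed

text \<open>Compactness is the point: the connection is bounded and hence stays clear of closing
  sides that are far enough away.\<close>

lemma compact_connection:
  assumes "connected_component (- range \<gamma>) p z"
  obtains K where "compact K" "connected K" "K \<inter> range \<gamma> = {}" "p \<in> K" "z \<in> K"
proof -
  have "path_component (- range \<gamma>) p z"
    using assms closed_range by (subst open_path_connected_component) auto
  then obtain g where g: "path g" "path_image g \<subseteq> - range \<gamma>" "pathstart g = p" "pathfinish g = z"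
    by (auto simp: path_component_def)
  show ?thesis
  proof (rule that)
    show "p \<in> path_image g" "z \<in> path_image g" using g by auto
  qed (use g in \<open>auto intro: compact_path_image connected_path_image\<close>)
qed

text \<open>The sign \<open>\<sigma>\<close> is 1 for the right side and -1 for the left side, so
  that one argument treats both kinds of poles.\<close>

lemma side_connection:
  assumes "if \<sigma> = 1 then p \<in> right_side \<gamma> else p \<in> left_side \<gamma>" "\<bar>\<sigma>\<bar> = (1::real)"
  obtains z where "\<sigma> * Re z > A" "connected_component (- range \<gamma>) p z"
proof (cases "\<sigma> = 1")
  case True
  with assms obtain M where "\<And>z. Re z > M \<Longrightarrow> connected_component (- range \<gamma>) p z"
    by (auto simp: right_side_def)
  with that[of "Complex (max M A + 1) 0"] True show ?thesis by auto
next
  case False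
  with assms obtain M where "\<And>z. Re z < M \<Longrightarrow> connected_component (- range \<gamma>) p z"
    by (auto simp: left_side_def)
  moreover have "\<sigma> = -1" using False assms(2) by auto
  ultimately show ?thesis using that[of "Complex (min M (- A) - 1) 0"] by auto
qed

lemma side_not_range: "p \<in> left_side \<gamma> \<or> p \<in> right_side \<gamma> \<Longrightarrow> p \<notin> range \<gamma>"
  using side_connection[of 1 p 0] side_connection[of "-1" p 0]
  by (auto dest!: connected_component_in split: if_splits)

section \<open>Winding numbers of the closed contour and Cauchy's theorem\<close>

definition closed_contour :: "real \<Rightarrow> real \<Rightarrow> real \<Rightarrow> complex" where
  "closed_contour B T = truncated_contour \<gamma> T +++ return_path c B T"

lemma closed_contour:
  assumes "T \<ge> T0"
  shows "valid_path (closed_contour B T)" "path (closed_contour B T)"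
    "pathfinish (closed_contour B T) = pathstart (closed_contour B T)"
    "path_image (closed_contour B T) = \<gamma> ` {-T..T} \<union> path_image (return_path c B T)"
proof -
  have T: "T > 0" using assms T0_pos by simp
  show v: "valid_path (closed_contour B T)"
    using truncated_ends[OF assms] valid_path_truncated[OF T]
    by (auto simp: closed_contour_def intro!: valid_path_join)
  thus "path (closed_contour B T)" by (rule valid_path_imp_path)
  show "pathfinish (closed_contour B T) = pathstart (closed_contour B T)"
    using truncated_ends[OF assms] by (simp add: closed_contour_def)
  show "path_image (closed_contour B T) = \<gamma> ` {-T..T} \<union> path_image (return_path c B T)"
    using truncated_ends[OF assms] path_image_truncated[OF T]
    by (simp add: closed_contour_def path_image_join)
qed

lemma winding_number_closed_contour:
  assumes "T \<ge> T0" "p \<notin> range \<gamma>" "p \<notin> path_image (return_path c B T)"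
  shows "winding_number (closed_contour B T) p =
     winding_number (truncated_contour \<gamma> T) p + winding_number (return_path c B T) p"
proof -
  have T: "T > 0" using assms T0_pos by simp
  show ?thesis unfolding closed_contour_def
    using assms truncated_ends[OF assms(1)] path_image_truncated[OF T] valid_path_imp_path[OF valid_path_truncated[OF T]]
    by (intro winding_number_join) auto
qed

text \<open>The set \<open>K\<close> that joins \<open>p\<close> to a distant point \<open>z\<close>
  may cross the line through \<open>c0\<close>, so the winding number cannot be transported along it
  directly. The vertical side is therefore first moved to an abscissa \<open>B\<close> beyond
  \<open>K\<close>. This changes nothing, because \<open>p\<close> lies on the same side of both
  positions. Then \<open>K\<close> misses the closed contour, and \<open>z\<close> lies outside a
  half-plane that contains it.\<close>

lemma winding_number_side_eventually:
  assumes \<sigma>: "if \<sigma> = 1 then p \<in> right_side \<gamma> else p \<in> left_side \<gamma>" "\<bar>\<sigma>\<bar> = (1::real)"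
    and p: "\<sigma> * (Re p - c0) > 0"
  shows "\<forall>\<^sub>F T in at_top. winding_number (closed_contour c0 T) p = 0"
proof -
  have \<sigma>': "\<sigma> = 1 \<or> \<sigma> = -1" using \<sigma>(2) by auto
  obtain A where A: "\<And>t. \<bar>Re (\<gamma> t)\<bar> \<le> A" using bounded_Re by blast
  have A0: "A \<ge> 0" using A[of 0] by linarith
  have cA: "\<bar>c\<bar> \<le> A" using A[of T0] vertical[of T0] T0_pos by simp
  obtain z where z: "\<sigma> * Re z > A" "connected_component (- range \<gamma>) p z"
    using side_connection[OF \<sigma>] by blast
  obtain K where K: "compact K" "connected K" "K \<inter> range \<gamma> = {}" "p \<in> K" "z \<in> K"
    using compact_connection[OF z(2)] by blast
  obtain R where R: "\<And>w. w \<in> K \<Longrightarrow> norm w \<le> R"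
    using compact_imp_bounded[OF K(1)] unfolding bounded_iff by blast
  have pR: "\<bar>Re p\<bar> \<le> R" "\<bar>Im p\<bar> \<le> R"
    using R[OF K(4)] abs_Re_le_cmod[of p] abs_Im_le_cmod[of p] by linarith+
  \<comment> \<open>Opposite to the side of \<open>p\<close>, and beyond both \<open>K\<close>
    (contained in the disc of radius \<open>R\<close>) and the curve (contained in the strip of
    half-width \<open>A\<close>).\<close>
  define B where "B = - \<sigma> * (R + A + 1)"
  have Bp: "\<sigma> * (Re p - B) > 0" using \<sigma>' pR A0 by (auto simp: B_def)
  have pr: "p \<notin> range \<gamma>" using K by blast
  show ?thesis
    using eventually_ge_at_top[of T0] eventually_gt_at_top[of R]
  proof eventually_elim
    case (elim T)
    have T: "T > 0" using elim T0_pos by simp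
    have pT: "\<bar>Im p\<bar> < T" using elim pR by simp
    have p_ret: "p \<notin> path_image (return_path c c0 T)" "p \<notin> path_image (return_path c B T)"
      using p Bp pT T by (auto simp: path_image_return_path)
    have "winding_number (closed_contour c0 T) p = winding_number (closed_contour B T) p"
      using winding_number_return_path[OF \<sigma>(2) p pT, of c] winding_number_return_path[OF \<sigma>(2) Bp pT, of c]
      by (simp add: winding_number_closed_contour[OF elim(1) pr] p_ret)
    also have "\<dots> = winding_number (closed_contour B T) z"
    proof -
      have "w \<notin> path_image (closed_contour B T)" if w: "w \<in> K" for w
      proof -
        have wR: "\<bar>Re w\<bar> \<le> R" "\<bar>Im w\<bar> \<le> R"
          using R[OF w] abs_Re_le_cmod[of w] abs_Im_le_cmod[of w] by linarith+
        have "w \<notin> path_image (return_path c B T)"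
          using wR elim T \<sigma>' A0 by (auto simp: path_image_return_path B_def)
        moreover have "w \<notin> \<gamma> ` {-T..T}" using K w by auto
        ultimately show ?thesis by (simp add: closed_contour(4)[OF elim(1)])
      qed
      hence "K \<inter> path_image (closed_contour B T) = {}" by blast
      from winding_number_constant[OF closed_contour(2,3)[OF elim(1)] K(2) this]
      show ?thesis using K(4,5) by (auto simp: constant_on_def)
    qed
    also have "\<dots> = 0"
    proof (rule winding_number_zero_outside)
      show "convex {w. \<sigma> * Re w \<le> A}"
        using \<sigma>' convex_halfspace_Re_le[of A] convex_halfspace_Re_ge[of "- A"]
        by (auto simp: minus_le_iff)
      have "\<sigma> * Re (\<gamma> t) \<le> A" for t using A[of t] \<sigma>' by auto
      moreover have "\<sigma> * x \<le> A" if "x \<in> closed_segment c B" for x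
        using that \<sigma>' cA A0 pR by (auto simp: B_def closed_segment_eq_real_ivl split: if_splits)
      ultimately show "path_image (closed_contour B T) \<subseteq> {w. \<sigma> * Re w \<le> A}"
        using T by (auto simp: closed_contour(4)[OF elim(1)] path_image_return_path)
      show "z \<notin> {w. \<sigma> * Re w \<le> A}" using z by auto
    qed (use closed_contour[OF elim(1)] in auto)
    finally show ?case .
  qed
qed

text \<open>Disposes of the possibly infinitely many poles outside the strip for every admissible
  \<open>T\<close> at once; only finitely many others require \<open>T\<close> to be large.\<close>

lemma winding_number_closed_contour_outside:
  assumes "T \<ge> T0" "\<And>t. \<bar>Re (\<gamma> t)\<bar> \<le> A" "\<bar>c0\<bar> \<le> A" "\<bar>Re p\<bar> > A"
  shows "winding_number (closed_contour c0 T) p = 0"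
proof (rule winding_number_zero_outside)
  have T: "T > 0" using assms T0_pos by simp
  have cA: "\<bar>c\<bar> \<le> A" using assms(2)[of T0] vertical[of T0] T0_pos by simp
  have "{w. \<bar>Re w\<bar> \<le> A} = {w. Re w \<le> A} \<inter> {w. Re w \<ge> - A}" by auto
  thus "convex {w. \<bar>Re w\<bar> \<le> A}"
    by (simp add: convex_Int convex_halfspace_Re_le convex_halfspace_Re_ge)
  have "\<bar>x\<bar> \<le> A" if "x \<in> closed_segment c c0" for x
    using that cA assms(3) by (auto simp: closed_segment_eq_real_ivl split: if_splits)
  thus "path_image (closed_contour c0 T) \<subseteq> {w. \<bar>Re w\<bar> \<le> A}"
    using T assms(2,3) by (auto simp: closed_contour(4)[OF assms(1)] path_image_return_path)
qed (use closed_contour[OF assms(1)] assms in auto)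

theorem contour_integral_eq_line_integral:
  assumes holo: "f holomorphic_on - P" and P: "closed P" "\<And>A. finite {p \<in> P. \<bar>Re p\<bar> \<le> A}"
    and sides: "\<And>p. p \<in> P \<Longrightarrow> Re p < c0 \<and> p \<in> left_side \<gamma> \<or> Re p > c0 \<and> p \<in> right_side \<gamma>"
    and decay: "\<And>a b e. e > 0 \<Longrightarrow> \<exists>T. \<forall>s. a \<le> Re s \<and> Re s \<le> b \<and> \<bar>Im s\<bar> \<ge> T \<longrightarrow> norm (f s) \<le> e"
    and J: "((\<lambda>t. f (\<gamma> t) * vector_derivative \<gamma> (at t)) has_integral J) UNIV"
    and I: "((\<lambda>t. f (Complex c0 t)) has_integral I) UNIV"
  shows "J = \<i> * I"
proof -
  obtain A' where A': "\<And>t. \<bar>Re (\<gamma> t)\<bar> \<le> A'" using bounded_Re by blast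
  define A where "A = max A' \<bar>c0\<bar>"
  have A: "\<bar>Re (\<gamma> t)\<bar> \<le> A" for t using A'[of t] by (simp add: A_def)
  have c0A: "\<bar>c0\<bar> \<le> A" by (simp add: A_def)
  have cA: "\<bar>c\<bar> \<le> A" using A[of T0] vertical[of T0] T0_pos by simp
  \<comment> \<open>Finitely many poles, hence a common \<open>T\<close> for which all their winding
    numbers vanish and none of them lies on a horizontal side.\<close>
  define Q where "Q = {p \<in> P. \<bar>Re p\<bar> \<le> A}"
  have Q: "finite Q" unfolding Q_def by (rule P)
  have "\<forall>p\<in>Q. \<forall>\<^sub>F T in at_top. winding_number (closed_contour c0 T) p = 0 \<and> \<bar>Im p\<bar> < T"
  proof
    fix p assume "p \<in> Q"
    hence "Re p < c0 \<and> p \<in> left_side \<gamma> \<or> Re p > c0 \<and> p \<in> right_side \<gamma>"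
      using sides by (auto simp: Q_def)
    hence "\<forall>\<^sub>F T in at_top. winding_number (closed_contour c0 T) p = 0"
      using winding_number_side_eventually[of 1 p c0] winding_number_side_eventually[of "-1" p c0] by auto
    thus "\<forall>\<^sub>F T in at_top. winding_number (closed_contour c0 T) p = 0 \<and> \<bar>Im p\<bar> < T"
      using eventually_gt_at_top by (rule eventually_conj)
  qed
  hence evQ: "\<forall>\<^sub>F T in at_top. \<forall>p\<in>Q. winding_number (closed_contour c0 T) p = 0 \<and> \<bar>Im p\<bar> < T"
    by (rule eventually_ball_finite[OF Q])
  let ?h = "\<lambda>t. f (\<gamma> t) * vector_derivative \<gamma> (at t)"
  let ?D = "\<lambda>T. integral {-T..T} ?h - \<i> * integral {-T..T} (\<lambda>t. f (Complex c0 t))"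
  have "(?D \<longlongrightarrow> 0) at_top"
  proof (rule tendstoI)
    fix e :: real assume e: "e > 0"
    \<comment> \<open>The two horizontal sides have length \<open>\<bar>c0 - c\<bar>\<close> each;
      the summand 1 makes the estimate strict and the divisor positive.\<close>
    define e' where "e' = e / (2 * \<bar>c0 - c\<bar> + 1)"
    have e': "e' > 0" unfolding e'_def using e by (intro divide_pos_pos add_nonneg_pos) auto
    obtain T1 where T1: "\<And>s. -A \<le> Re s \<Longrightarrow> Re s \<le> A \<Longrightarrow> \<bar>Im s\<bar> \<ge> T1 \<Longrightarrow> norm (f s) \<le> e'"
      using decay[OF e'] by blast
    show "\<forall>\<^sub>F T in at_top. dist (?D T) 0 < e"
      using evQ eventually_ge_at_top[of T0] eventually_ge_at_top[of T1]
    proof eventually_elim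
      case (elim T)
      have T: "T > 0" using elim T0_pos by simp
      have seg: "\<bar>x\<bar> \<le> A" if "x \<in> closed_segment c c0" for x
        using that cA c0A by (auto simp: closed_segment_eq_real_ivl split: if_splits)
      have retP: "path_image (return_path c c0 T) \<subseteq> - P"
      proof
        fix w assume w: "w \<in> path_image (return_path c c0 T)"
        show "w \<in> - P"
        proof
          assume wP: "w \<in> P"
          hence "Re w \<noteq> c0" using sides by blast
          hence "\<bar>Im w\<bar> = T" "\<bar>Re w\<bar> \<le> A" using w T seg by (auto simp: path_image_return_path)
          thus False using elim(1) wP by (auto simp: Q_def)
        qed
      qed
      have \<gamma>P: "\<gamma> ` {-T..T} \<subseteq> - P" using sides side_not_range by blast
      \<comment> \<open>With all winding numbers about the singular set equal to 0, the homology
        form of Cauchy's theorem applies on its complement.\<close>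
      have "winding_number (closed_contour c0 T) p = 0" if "p \<in> P" for p
        using that elim(1) winding_number_closed_contour_outside[OF elim(2) A c0A, of p]
        by (cases "\<bar>Re p\<bar> \<le> A") (auto simp: Q_def)
      hence "(f has_contour_integral 0) (closed_contour c0 T)"
        using retP \<gamma>P P(1) holo closed_contour[OF elim(2), of c0]
        by (intro Cauchy_theorem_global[of "- P"]) auto
      hence "contour_integral (closed_contour c0 T) f = 0" by (rule contour_integral_unique)
      moreover have ci: "f contour_integrable_on truncated_contour \<gamma> T"
        using \<gamma>P P(1) valid_path_truncated[OF T]
        by (intro contour_integrable_holomorphic_simple[OF holo]) (auto simp: path_image_truncated[OF T])
      let ?l1 = "linepath (Complex c T) (Complex c0 T)" and ?l2 = "linepath (Complex c0 T) (Complex c0 (-T))"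
        and ?l3 = "linepath (Complex c0 (-T)) (Complex c (-T))"
      have pimg: "path_image ?l1 \<subseteq> - P" "path_image ?l2 \<subseteq> - P" "path_image ?l3 \<subseteq> - P"
        using retP by (auto simp: return_path_def path_image_join)
      have contf: "continuous_on (- P) f" using holo by (rule holomorphic_on_imp_continuous_on)
      have ci3: "f contour_integrable_on ?l1" "f contour_integrable_on ?l2" "f contour_integrable_on ?l3"
        using pimg contf by (auto intro!: contour_integrable_continuous_linepath intro: continuous_on_subset)
      have "contour_integral (closed_contour c0 T) f = contour_integral (truncated_contour \<gamma> T) f +
          (contour_integral ?l1 f + (contour_integral ?l2 f + contour_integral ?l3 f))"
        unfolding closed_contour_def return_path_def
        using ci ci3 valid_path_truncated[OF T] truncated_ends[OF elim(2)] by (simp add: valid_path_join)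
      moreover have "contour_integral ?l2 f = - contour_integral (linepath (Complex c0 (-T)) (Complex c0 T)) f"
        using pimg contf
        by (intro contour_integral_reverse_linepath) (auto intro: continuous_on_subset simp: closed_segment_commute)
      moreover have "contour_integral (linepath (Complex c0 (-T)) (Complex c0 T)) f = \<i> * integral {-T..T} (\<lambda>t. f (Complex c0 t))"
        using T by (intro contour_integral_linepath_same_Re) auto
      ultimately have D: "?D T = - (contour_integral ?l1 f + contour_integral ?l3 f)"
        using contour_integral_truncated[OF J T] by (simp add: algebra_simps eq_neg_iff_add_eq_0)
      have 1: "norm (contour_integral ?l1 f) \<le> e' * \<bar>c0 - c\<bar>"
        using pimg contf cA c0A elim T
        by (intro norm_contour_integral_horizontal_le T1) (auto intro: continuous_on_subset)
      have 2: "norm (contour_integral ?l3 f) \<le> e' * \<bar>c - c0\<bar>"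
        using pimg contf cA c0A elim T
        by (intro norm_contour_integral_horizontal_le T1) (auto intro: continuous_on_subset)
      have "norm (?D T) \<le> e' * \<bar>c0 - c\<bar> + e' * \<bar>c - c0\<bar>"
        unfolding D norm_minus_cancel by (rule norm_triangle_mono[OF 1 2])
      also have "\<dots> = e' * (2 * \<bar>c0 - c\<bar>)" by (simp add: abs_minus_commute)
      also have "\<dots> < e' * (2 * \<bar>c0 - c\<bar> + 1)" using e' by (intro mult_strict_left_mono) auto
      also have "\<dots> = e" unfolding e'_def by (simp add: add_nonneg_eq_0_iff)
      finally show ?case by simp
    qed
  qed
  moreover have "(?D \<longlongrightarrow> J - \<i> * I) at_top"
    by (intro tendsto_intros has_integral_UNIV_tendsto J I)
  ultimately have "J - \<i> * I = 0" by (intro tendsto_unique[of at_top ?D]) auto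
  thus ?thesis by simp
qed

end

section \<open>Meijer functions as integrals along vertical lines\<close>

lemma holomorphic_on_prod_list:
  assumes "\<And>x. x \<in> set xs \<Longrightarrow> f x holomorphic_on S"
  shows "(\<lambda>z. \<Prod>x\<leftarrow>xs. f x z) holomorphic_on S"
  using assms by (induction xs) (auto intro!: holomorphic_intros)

lemma inverse_prod_list: "inverse (\<Prod>x\<leftarrow>xs. f x) = (\<Prod>x\<leftarrow>xs. inverse (f x :: 'a::field))"
  by (induction xs) auto

text \<open>In this form the denominator is a product of entire functions, so the integrand is
  visibly holomorphic away from the poles of the numerator.\<close>

lemma meijer_integrand_rGamma:
  "meijer_integrand as as' bs bs' s \<zeta> =
     (\<Prod>\<beta>\<leftarrow>bs. Gamma (\<beta> - \<zeta>)) * (\<Prod>\<alpha>\<leftarrow>as. Gamma (1 - \<alpha> + \<zeta>)) *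
     ((\<Prod>\<beta>\<leftarrow>bs'. rGamma (1 - \<beta> + \<zeta>)) * (\<Prod>\<alpha>\<leftarrow>as'. rGamma (\<alpha> - \<zeta>))) * exp (\<zeta> * s)"
  by (simp add: meijer_integrand_def rGamma_inverse_Gamma divide_inverse inverse_prod_list)

definition meijer_poles :: "complex list \<Rightarrow> complex list \<Rightarrow> complex set" where
  "meijer_poles as bs = (\<Union>\<beta>\<in>set bs. {\<zeta>. \<beta> - \<zeta> \<in> \<int>\<^sub>\<le>\<^sub>0}) \<union> (\<Union>\<alpha>\<in>set as. {\<zeta>. 1 - \<alpha> + \<zeta> \<in> \<int>\<^sub>\<le>\<^sub>0})"

lemma holomorphic_meijer_integrand:
  "meijer_integrand as as' bs bs' s holomorphic_on - meijer_poles as bs"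
  unfolding meijer_integrand_rGamma[abs_def] meijer_poles_def
  by (intro holomorphic_on_mult holomorphic_on_prod_list holomorphic_Gamma' holomorphic_rGamma'
        holomorphic_intros) auto

lemma closed_meijer_poles: "closed (meijer_poles as bs)"
proof -
  have "closed {\<zeta>. \<beta> - \<zeta> \<in> \<int>\<^sub>\<le>\<^sub>0}" for \<beta> :: complex
  proof -
    have "closed ((\<lambda>\<zeta>. \<beta> - \<zeta>) -` \<int>\<^sub>\<le>\<^sub>0)"
      by (intro closed_vimage closed_nonpos_Ints continuous_intros)
    thus ?thesis by (simp add: vimage_def)
  qed
  moreover have "closed {\<zeta>. 1 - \<alpha> + \<zeta> \<in> \<int>\<^sub>\<le>\<^sub>0}" for \<alpha> :: complex
  proof -
    have "closed ((\<lambda>\<zeta>. 1 - \<alpha> + \<zeta>) -` \<int>\<^sub>\<le>\<^sub>0)"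
      by (intro closed_vimage closed_nonpos_Ints continuous_intros)
    thus ?thesis by (simp add: vimage_def)
  qed
  ultimately show ?thesis
    unfolding meijer_poles_def by (intro closed_Un closed_UN) auto
qed

lemma finite_meijer_poles_strip: "finite {\<zeta> \<in> meijer_poles as bs. \<bar>Re \<zeta>\<bar> \<le> A}"
proof -
  have "finite {\<zeta>. \<beta> - \<zeta> \<in> \<int>\<^sub>\<le>\<^sub>0 \<and> \<bar>Re \<zeta>\<bar> \<le> A}" for \<beta> :: complex
  proof (rule finite_subset)
    show "{\<zeta>. \<beta> - \<zeta> \<in> \<int>\<^sub>\<le>\<^sub>0 \<and> \<bar>Re \<zeta>\<bar> \<le> A} \<subseteq> (\<lambda>n. \<beta> + of_nat n) ` {..nat \<lceil>A + \<bar>Re \<beta>\<bar>\<rceil>}"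
    proof
      fix \<zeta> assume "\<zeta> \<in> {\<zeta>. \<beta> - \<zeta> \<in> \<int>\<^sub>\<le>\<^sub>0 \<and> \<bar>Re \<zeta>\<bar> \<le> A}"
      then obtain n where n: "\<beta> - \<zeta> = - of_nat n" "\<bar>Re \<zeta>\<bar> \<le> A" by (auto elim!: nonpos_Ints_cases')
      hence \<zeta>: "\<zeta> = \<beta> + of_nat n" by (simp add: algebra_simps)
      hence "n \<le> nat \<lceil>A + \<bar>Re \<beta>\<bar>\<rceil>" using n(2) by simp linarith
      thus "\<zeta> \<in> (\<lambda>n. \<beta> + of_nat n) ` {..nat \<lceil>A + \<bar>Re \<beta>\<bar>\<rceil>}" using \<zeta> by auto
    qed
  qed auto
  moreover have "finite {\<zeta>. 1 - \<alpha> + \<zeta> \<in> \<int>\<^sub>\<le>\<^sub>0 \<and> \<bar>Re \<zeta>\<bar> \<le> A}" for \<alpha> :: complex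
  proof (rule finite_subset)
    show "{\<zeta>. 1 - \<alpha> + \<zeta> \<in> \<int>\<^sub>\<le>\<^sub>0 \<and> \<bar>Re \<zeta>\<bar> \<le> A} \<subseteq> (\<lambda>n. \<alpha> - 1 - of_nat n) ` {..nat \<lceil>A + \<bar>Re \<alpha>\<bar>\<rceil>}"
    proof
      fix \<zeta> assume "\<zeta> \<in> {\<zeta>. 1 - \<alpha> + \<zeta> \<in> \<int>\<^sub>\<le>\<^sub>0 \<and> \<bar>Re \<zeta>\<bar> \<le> A}"
      then obtain n where n: "1 - \<alpha> + \<zeta> = - of_nat n" "\<bar>Re \<zeta>\<bar> \<le> A" by (auto elim!: nonpos_Ints_cases')
      have \<zeta>: "\<zeta> = \<alpha> - 1 - of_nat n" using n(1) by (simp add: algebra_simps)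
      hence "n \<le> nat \<lceil>A + \<bar>Re \<alpha>\<bar>\<rceil>" using n(2) by simp linarith
      thus "\<zeta> \<in> (\<lambda>n. \<alpha> - 1 - of_nat n) ` {..nat \<lceil>A + \<bar>Re \<alpha>\<bar>\<rceil>}" using \<zeta> by auto
    qed
  qed auto
  ultimately have "finite ((\<Union>\<beta>\<in>set bs. {\<zeta>. \<beta> - \<zeta> \<in> \<int>\<^sub>\<le>\<^sub>0 \<and> \<bar>Re \<zeta>\<bar> \<le> A}) \<union>
      (\<Union>\<alpha>\<in>set as. {\<zeta>. 1 - \<alpha> + \<zeta> \<in> \<int>\<^sub>\<le>\<^sub>0 \<and> \<bar>Re \<zeta>\<bar> \<le> A}))"
    by (intro finite_UnI finite_UN_I) auto
  thus ?thesis by (rule finite_subset[rotated]) (auto simp: meijer_poles_def)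
qed

definition vanishes_vertically :: "(complex \<Rightarrow> complex) \<Rightarrow> bool" where
  "vanishes_vertically f \<longleftrightarrow>
     (\<forall>a b e. e > 0 \<longrightarrow> (\<exists>T. \<forall>s. a \<le> Re s \<and> Re s \<le> b \<and> \<bar>Im s\<bar> \<ge> T \<longrightarrow> norm (f s) \<le> e))"

text \<open>Collects what makes a vertical line compute \<open>meijer_G\<close>: the first two
  conditions make it a separating contour, integrability makes its value a candidate for
  \<open>THE\<close>, and the decay lets any other contour be compared with it.\<close>

definition meijer_line ::
  "complex list \<Rightarrow> complex list \<Rightarrow> complex list \<Rightarrow> complex list \<Rightarrow> complex \<Rightarrow> real \<Rightarrow> bool" where
  "meijer_line as as' bs bs' s c \<longleftrightarrow>
     (\<forall>\<beta>\<in>set bs. c < Re \<beta>) \<and> (\<forall>\<alpha>\<in>set as. Re \<alpha> - 1 < c) \<and>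
     vanishes_vertically (meijer_integrand as as' bs bs' s) \<and>
     integrable lborel (\<lambda>t. meijer_integrand as as' bs bs' s (Complex c t))"

lemma vertical_line_sides:
  "Re p > c \<Longrightarrow> p \<in> right_side (Complex c)" "Re p < c \<Longrightarrow> p \<in> left_side (Complex c)"
proof -
  assume p: "Re p > c"
  have "connected_component (- range (Complex c)) p z" if "Re z > c" for z
    by (rule connected_component_of_subset[of "{z. Re z > c}"], subst connected_component_def)
       (use p that convex_connected[OF convex_halfspace_Re_gt[of c]] in auto)
  thus "p \<in> right_side (Complex c)" by (auto simp: right_side_def)
next
  assume p: "Re p < c"
  have "connected_component (- range (Complex c)) p z" if "Re z < c" for z
    by (rule connected_component_of_subset[of "{z. Re z < c}"], subst connected_component_def)
       (use p that convex_connected[OF convex_halfspace_Re_lt[of c]] in auto)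
  thus "p \<in> left_side (Complex c)" by (auto simp: left_side_def)
qed

lemma has_vector_derivative_vertical_line: "(Complex c has_vector_derivative \<i>) (at t within A)"
proof -
  have "((\<lambda>t. of_real c + of_real t * \<i>) has_vector_derivative \<i>) (at t within A)"
    by (auto intro!: derivative_eq_intros)
  thus ?thesis by (simp add: Complex_eq[abs_def] mult.commute)
qed

lemma meijer_contour_vertical_line:
  assumes "\<forall>\<beta>\<in>set bs. c < Re \<beta>" "\<forall>\<alpha>\<in>set as. Re \<alpha> - 1 < c"
  shows "meijer_contour as bs (Complex c)"
  unfolding meijer_contour_def
proof (intro conjI ballI allI impI)
  have "Complex c C1_differentiable_on A" for A
    unfolding C1_differentiable_on_def
    by (auto intro!: exI[of _ "\<lambda>_. \<i>"] has_vector_derivative_vertical_line)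
  thus "upward_contour (Complex c)"
    unfolding upward_contour_def by (auto intro!: C1_differentiable_imp_piecewise)
next
  fix \<beta> \<zeta> assume "\<beta> \<in> set bs" "\<beta> - \<zeta> \<in> \<int>\<^sub>\<le>\<^sub>0"
  moreover from this obtain n where "\<beta> - \<zeta> = - of_nat n" by (auto elim!: nonpos_Ints_cases')
  hence "Re \<beta> - Re \<zeta> = - real n" by (metis minus_complex.sel(1) uminus_complex.sel(1) complex_Re_of_nat)
  ultimately show "\<zeta> \<in> right_side (Complex c)" using assms(1) by (intro vertical_line_sides) force
next
  fix \<alpha> \<zeta> assume "\<alpha> \<in> set as" "1 - \<alpha> + \<zeta> \<in> \<int>\<^sub>\<le>\<^sub>0"
  moreover from this obtain n where "1 - \<alpha> + \<zeta> = - of_nat n" by (auto elim!: nonpos_Ints_cases')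
  hence "1 - Re \<alpha> + Re \<zeta> = - real n"
    by (metis minus_complex.sel(1) plus_complex.sel(1) one_complex.sel(1) uminus_complex.sel(1) complex_Re_of_nat)
  ultimately show "\<zeta> \<in> left_side (Complex c)" using assms(2) by (intro vertical_line_sides) force
qed

text \<open>Existence is witnessed by the line itself, whose derivative \<i> cancels the one in the
  normalising factor. Uniqueness is the comparison of contours.\<close>

lemma meijer_G_line:
  assumes "meijer_line as as' bs bs' s c"
  shows "meijer_G as as' bs bs' s = 1 / (2 * of_real pi) * (LINT t|lborel. meijer_integrand as as' bs bs' s (Complex c t))"
proof -
  let ?f = "meijer_integrand as as' bs bs' s"
  let ?I = "LINT t|lborel. ?f (Complex c t)"
  have int: "((\<lambda>t. ?f (Complex c t)) has_integral ?I) UNIV"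
    using assms unfolding meijer_line_def by (intro has_integral_integral_lborel) auto
  have sep: "\<forall>\<beta>\<in>set bs. c < Re \<beta>" "\<forall>\<alpha>\<in>set as. Re \<alpha> - 1 < c"
    using assms by (auto simp: meijer_line_def)
  show ?thesis unfolding meijer_G_def
  proof (rule the_equality)
    have "((\<lambda>t. ?f (Complex c t) * vector_derivative (Complex c) (at t)) has_integral (?I * \<i>)) UNIV"
      using has_integral_mult_left[OF int, of \<i>]
      by (simp add: vector_derivative_at[OF has_vector_derivative_vertical_line])
    thus "\<exists>\<gamma> J. meijer_contour as bs \<gamma> \<and>
        ((\<lambda>t. ?f (\<gamma> t) * vector_derivative \<gamma> (at t)) has_integral J) UNIV \<and>
        1 / (2 * of_real pi) * ?I = 1 / (2 * complex_of_real pi * \<i>) * J"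
      using meijer_contour_vertical_line[OF sep] by (intro exI[of _ "Complex c"] exI[of _ "?I * \<i>"]) simp
  next
    fix v assume "\<exists>\<gamma> J. meijer_contour as bs \<gamma> \<and>
        ((\<lambda>t. ?f (\<gamma> t) * vector_derivative \<gamma> (at t)) has_integral J) UNIV \<and>
        v = 1 / (2 * complex_of_real pi * \<i>) * J"
    then obtain \<gamma> J where \<gamma>: "meijer_contour as bs \<gamma>"
        "((\<lambda>t. ?f (\<gamma> t) * vector_derivative \<gamma> (at t)) has_integral J) UNIV"
        "v = 1 / (2 * complex_of_real pi * \<i>) * J" by blast
    from \<gamma>(1) obtain c' T where cT: "\<And>t. \<bar>t\<bar> \<ge> T \<Longrightarrow> \<gamma> t = Complex c' t"
      "\<And>u v. \<gamma> piecewise_C1_differentiable_on {u..v}"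
      by (auto simp: meijer_contour_def upward_contour_def)
    \<comment> \<open>The locale wants a positive bound, whereas the \<open>T\<close> of
      \<open>upward_contour\<close> may have any sign.\<close>
    interpret upward_curve \<gamma> c' "max T 1"
      by unfold_locales (use cT in auto)
    have "J = \<i> * ?I"
    proof (rule contour_integral_eq_line_integral[OF holomorphic_meijer_integrand closed_meijer_poles
            finite_meijer_poles_strip _ _ \<gamma>(2) int])
      fix p assume "p \<in> meijer_poles as bs"
      then consider \<beta> where "\<beta> \<in> set bs" "\<beta> - p \<in> \<int>\<^sub>\<le>\<^sub>0" | \<alpha> where "\<alpha> \<in> set as" "1 - \<alpha> + p \<in> \<int>\<^sub>\<le>\<^sub>0"
        by (auto simp: meijer_poles_def)
      thus "Re p < c \<and> p \<in> left_side \<gamma> \<or> c < Re p \<and> p \<in> right_side \<gamma>"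
      proof cases
        case 1
        obtain n where "\<beta> - p = - of_nat n" using 1(2) by (auto elim!: nonpos_Ints_cases')
        hence "Re \<beta> - Re p = - real n" by (metis minus_complex.sel(1) uminus_complex.sel(1) complex_Re_of_nat)
        thus ?thesis using 1 sep(1) \<gamma>(1) unfolding meijer_contour_def by force
      next
        case 2
        obtain n where "1 - \<alpha> + p = - of_nat n" using 2(2) by (auto elim!: nonpos_Ints_cases')
        hence "1 - Re \<alpha> + Re p = - real n"
          by (metis minus_complex.sel(1) plus_complex.sel(1) one_complex.sel(1) uminus_complex.sel(1) complex_Re_of_nat)
        thus ?thesis using 2 sep(2) \<gamma>(1) unfolding meijer_contour_def by force
      qed
    qed (use assms in \<open>auto simp: meijer_line_def vanishes_vertically_def\<close>)
    thus "v = 1 / (2 * of_real pi) * ?I" using \<gamma>(3) by simp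
  qed
qed

text \<open>Adding \<rho> to all parameters amounts to translating the variable, and
  \<open>exp (\<zeta> * s)\<close> then releases the factor \<open>z\<close> to the power \<rho>. On
  the logarithmic surface this holds without any choice of branch.\<close>

lemma meijer_integrand_shift:
  "meijer_integrand (map (\<lambda>x. x + \<rho>) as) (map (\<lambda>x. x + \<rho>) as') (map (\<lambda>x. x + \<rho>) bs) (map (\<lambda>x. x + \<rho>) bs') s \<zeta> =
     exp (\<rho> * s) * meijer_integrand as as' bs bs' s (\<zeta> - \<rho>)"
proof -
  have 1: "(x + \<rho>) - \<zeta> = x - (\<zeta> - \<rho>)" "1 - (x + \<rho>) + \<zeta> = 1 - x + (\<zeta> - \<rho>)" for x
    by (simp_all add: algebra_simps)
  have "exp (\<rho> * s) * exp ((\<zeta> - \<rho>) * s) = exp (\<zeta> * s)"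
    by (simp add: exp_add[symmetric] algebra_simps)
  thus ?thesis
    unfolding meijer_integrand_def map_map o_def 1 by simp
qed

lemma meijer_line_shift:
  assumes "meijer_line as as' bs bs' s c"
  shows "meijer_line (map (\<lambda>x. x + of_real \<rho>) as) (map (\<lambda>x. x + of_real \<rho>) as')
     (map (\<lambda>x. x + of_real \<rho>) bs) (map (\<lambda>x. x + of_real \<rho>) bs') s (c + \<rho>)"
proof -
  have 1: "Complex (c + \<rho>) t - of_real \<rho> = Complex c t" for t by (simp add: complex_eq_iff)
  have "vanishes_vertically (\<lambda>\<zeta>. exp (of_real \<rho> * s) * meijer_integrand as as' bs bs' s (\<zeta> - of_real \<rho>))"
    unfolding vanishes_vertically_def
  proof (intro allI impI)
    fix a b e :: real assume e: "e > 0"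
    let ?E = "norm (exp (of_real \<rho> * s))"
    have "e / ?E > 0" using e by simp
    then obtain T where T: "\<And>s'. a - \<rho> \<le> Re s' \<Longrightarrow> Re s' \<le> b - \<rho> \<Longrightarrow> \<bar>Im s'\<bar> \<ge> T \<Longrightarrow>
        norm (meijer_integrand as as' bs bs' s s') \<le> e / ?E"
      using assms unfolding meijer_line_def vanishes_vertically_def by metis
    have "norm (exp (of_real \<rho> * s) * meijer_integrand as as' bs bs' s (\<zeta> - of_real \<rho>)) \<le> e"
      if "a \<le> Re \<zeta>" "Re \<zeta> \<le> b" "\<bar>Im \<zeta>\<bar> \<ge> T" for \<zeta>
    proof -
      have "norm (meijer_integrand as as' bs bs' s (\<zeta> - of_real \<rho>)) \<le> e / ?E"
        using that by (intro T) auto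
      thus ?thesis by (simp add: norm_mult pos_le_divide_eq mult.commute)
    qed
    thus "\<exists>T. \<forall>\<zeta>. a \<le> Re \<zeta> \<and> Re \<zeta> \<le> b \<and> T \<le> \<bar>Im \<zeta>\<bar> \<longrightarrow>
        norm (exp (of_real \<rho> * s) * meijer_integrand as as' bs bs' s (\<zeta> - of_real \<rho>)) \<le> e" by blast
  qed
  thus ?thesis
    using assms by (auto simp: meijer_line_def meijer_integrand_shift[abs_def] 1)
qed

lemma meijer_G_shift:
  assumes "meijer_line as as' bs bs' s c"
  shows "meijer_G (map (\<lambda>x. x + of_real \<rho>) as) (map (\<lambda>x. x + of_real \<rho>) as')
     (map (\<lambda>x. x + of_real \<rho>) bs) (map (\<lambda>x. x + of_real \<rho>) bs') s =
     exp (of_real \<rho> * s) * meijer_G as as' bs bs' s"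
proof -
  have 1: "Complex (c + \<rho>) t - of_real \<rho> = Complex c t" for t by (simp add: complex_eq_iff)
  show ?thesis
    unfolding meijer_G_line[OF assms] meijer_G_line[OF meijer_line_shift[OF assms]] meijer_integrand_shift 1
    by simp
qed

section \<open>Mellin-Barnes integrals for the cosine transform\<close>

lemma powr_times_of_real:
  assumes "x > 0"
  shows "(z * complex_of_real x) powr s = z powr s * of_real x powr s"
proof (cases "z = 0")
  case False
  have "Ln (of_real x * z) = of_real (ln x) + Ln z"
    using Ln_times_of_real[of x z] assms False by (simp add: Ln_of_real)
  thus ?thesis using assms False
    by (simp add: powr_def Ln_of_real mult.commute[of z] distrib_left exp_add)
qed auto

text \<open>The end point conditions for the substitution \<open>x = t^2\<close> on the half-line,
  which turns integrals in \<open>sqrt x\<close> into Laplace integrals with exponent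
  \<open>2 * s\<close>.\<close>

lemma square_limits:
  "((ereal \<circ> (\<lambda>t. t^2) \<circ> real_of_ereal) \<longlongrightarrow> (0::ereal)) (at_right 0)"
  "((ereal \<circ> (\<lambda>t::real. t^2) \<circ> real_of_ereal) \<longlongrightarrow> \<infinity>) (at_left \<infinity>)"
proof -
  have "((\<lambda>t::real. t^2) \<longlongrightarrow> 0^2) (at_right 0)" by (intro tendsto_intros)
  thus "((ereal \<circ> (\<lambda>t. t^2) \<circ> real_of_ereal) \<longlongrightarrow> (0::ereal)) (at_right 0)"
    by (simp add: zero_ereal_def ereal_tendsto_simps)
  have "filterlim (\<lambda>t::real. t^2) at_top at_top"
    by (intro filterlim_pow_at_top filterlim_ident) auto
  thus "((ereal \<circ> (\<lambda>t::real. t^2) \<circ> real_of_ereal) \<longlongrightarrow> \<infinity>) (at_left \<infinity>)"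
    by (simp add: ereal_tendsto_simps)
qed

lemma integrable_laplace_sqrt_real:
  fixes s r :: real
  assumes "s > 0" "r > 0"
  shows "set_integrable lborel {0<..} (\<lambda>x. x powr (s - 1) * exp (- r * sqrt x))"
proof -
  let ?f = "\<lambda>x. x powr (s - 1) * exp (- r * sqrt x)"
  have "set_integrable lborel (einterval 0 \<infinity>) ?f"
  proof (rule interval_integral_substitution_nonneg(1)[where g = "\<lambda>t. t^2" and g' = "\<lambda>t. 2 * t"])
    have "set_integrable lborel {0<..} (\<lambda>t. 2 * (t powr (2 * s - 1) * exp (- r * t)))"
      using integrable_laplace_powr_real[of "2 * s" r] assms
      unfolding set_integrable_def by (auto dest!: integrable_mult_right[of 2] simp: mult_ac)
    moreover have "t powr (2 * s - 1) = (t^2) powr (s - 1) * t" if "t > 0" for t :: real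
    proof -
      have "(t^2) powr (s - 1) = t powr (2 * (s - 1))"
        using that by (simp add: powr_def ln_realpow)
      hence "(t^2) powr (s - 1) * t = t powr (2 * (s - 1)) * t powr 1" using that by simp
      also have "\<dots> = t powr (2 * s - 1)" by (simp only: powr_add[symmetric]) (simp add: algebra_simps)
      finally show ?thesis by simp
    qed
    ultimately have "set_integrable lborel {0<..} (\<lambda>t. ?f (t^2) * (2 * t))"
      by (subst set_integrable_cong[OF refl refl, where f' = "\<lambda>t. 2 * (t powr (2 * s - 1) * exp (- r * t))"]) (auto simp: mult_ac)
    thus "set_integrable lborel (einterval 0 \<infinity>) (\<lambda>t. ?f (t^2) * (2 * t))"
      by (simp add: einterval_eq zero_ereal_def)
  qed (use assms square_limits in \<open>auto intro!: derivative_eq_intros continuous_intros simp: zero_ereal_def\<close>)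
  thus ?thesis by (simp add: einterval_eq zero_ereal_def)
qed

lemma laplace_sqrt_measurable [measurable]:
  "(\<lambda>x. indicator {0<..} x *\<^sub>R (complex_of_real x powr a * exp (- w * of_real (sqrt x)))) \<in> borel_measurable borel"
  by (intro borel_measurable_continuous_on_indicator) (auto intro!: continuous_intros)

lemma norm_laplace_sqrt:
  "norm (indicator {0<..} x *\<^sub>R (complex_of_real x powr a * exp (- w * of_real (sqrt x))))
     = indicator {0<..} x * (x powr Re a * exp (- Re w * sqrt x))"
  by (auto simp: indicator_def norm_mult norm_powr_real_powr)

lemma integrable_laplace_sqrt:
  assumes "Re s > 0" "Re w > 0"
  shows "integrable lborel (\<lambda>x. indicator {0<..} x *\<^sub>R (complex_of_real x powr (s - 1) * exp (- w * of_real (sqrt x))))"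
proof (rule Bochner_Integration.integrable_bound)
  show "integrable lborel (\<lambda>x. indicator {0<..} x * (x powr (Re s - 1) * exp (- Re w * sqrt x)))"
    using integrable_laplace_sqrt_real[OF assms] by (simp add: set_integrable_def)
  show "AE x in lborel. norm (indicator {0<..} x *\<^sub>R (complex_of_real x powr (s - 1) * exp (- w * of_real (sqrt x))))
     \<le> norm (indicator {0<..} x * (x powr (Re s - 1) * exp (- Re w * sqrt x)))"
    by (subst norm_laplace_sqrt) (simp add: indicator_def)
qed auto

lemma laplace_sqrt:
  assumes "Re s > 0" "Re w > 0"
  shows "(LINT x|lborel. indicator {0<..} x *\<^sub>R (complex_of_real x powr (s - 1) * exp (- w * of_real (sqrt x)))) =
     2 * Gamma (2 * s) * w powr (- (2 * s))"
proof -
  let ?f = "\<lambda>x. complex_of_real x powr (s - 1) * exp (- w * of_real (sqrt x))"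
  let ?h = "\<lambda>t. complex_of_real t powr (2 * s - 1) * exp (- w * of_real t)"
  have eq: "(2 * t) *\<^sub>R ?f (t^2) = 2 * ?h t" if "t > 0" for t :: real
  proof -
    have "complex_of_real (t^2) powr (s - 1) = of_real t powr (2 * (s - 1))"
      using that by (simp add: powr_def Ln_of_real ln_realpow algebra_simps flip: of_real_power)
    hence "complex_of_real (t^2) powr (s - 1) * of_real t = of_real t powr (2 * (s - 1)) * of_real t powr 1" using that by simp
    also have "\<dots> = of_real t powr (2 * s - 1)" by (simp only: powr_add[symmetric]) (simp add: algebra_simps)
    finally show ?thesis using that by (simp add: scaleR_conv_of_real mult_ac)
  qed
  have "(LBINT x=0..\<infinity>. ?f x) = (LBINT t=0..\<infinity>. (2 * t) *\<^sub>R ?f (t^2))"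
  proof (rule interval_integral_substitution_integrable[where g = "\<lambda>t. t^2" and g' = "\<lambda>t. 2 * t"])
    have "set_integrable lborel {0<..} (\<lambda>t. 2 * ?h t)"
      using integrable_mult_right[OF integrable_laplace_powr[of "2 * s" w], of 2] assms
      by (simp add: set_integrable_def)
    hence "set_integrable lborel {0<..} (\<lambda>t. (2 * t) *\<^sub>R ?f (t^2))"
      by (subst set_integrable_cong[OF refl refl, where f' = "\<lambda>t. 2 * ?h t"]) (auto simp only: greaterThan_iff eq)
    thus "set_integrable lborel (einterval 0 \<infinity>) (\<lambda>t. (2 * t) *\<^sub>R ?f (t^2))"
      by (simp add: einterval_eq zero_ereal_def)
    show "set_integrable lborel (einterval 0 \<infinity>) ?f"
      using integrable_laplace_sqrt[OF assms] by (simp add: einterval_eq zero_ereal_def set_integrable_def)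
  qed (use assms square_limits in \<open>auto intro!: derivative_eq_intros continuous_intros simp: zero_ereal_def complex_nonpos_Reals_iff\<close>)
  hence "(LINT x:{0<..}|lborel. ?f x) = (LINT t:{0<..}|lborel. (2 * t) *\<^sub>R ?f (t^2))"
    by (simp only: interval_lebesgue_integral_0_infty)
  also have "\<dots> = (LINT t:{0<..}|lborel. 2 * ?h t)"
    by (intro set_lebesgue_integral_cong) (auto simp only: greaterThan_iff eq, simp)
  also have "\<dots> = 2 * (LINT t:{0<..}|lborel. ?h t)" by simp
  also have "(LINT t:{0<..}|lborel. ?h t) = Gamma (2 * s) * w powr (- (2 * s))"
    using laplace_powr[of "2 * s" w] assms by (simp add: set_lebesgue_integral_def)
  finally show ?thesis by (simp add: set_lebesgue_integral_def)
qed

text \<open>The factor \<open>exp (pi / 2 * \<bar>Im s\<bar>)\<close> stands for the growth of the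
  powers of \<open>\<i> * y\<close> and \<open>- \<i> * y\<close>, or of the cosine that they
  combine to. Against it \<open>Gamma s\<close> falls short by
  \<open>exp (a * \<bar>Im s\<bar>)\<close>. The remaining factor gains
  \<open>exp (- 2 * a * \<bar>Im s\<bar>)\<close>, because its argument moves at double speed, and a
  net decay of rate \<open>a\<close> is left.\<close>

lemma mellin_kernel_strip_bound:
  assumes "Re w > 0"
  obtains C a R where "C > 0" "a > 0" "R \<ge> 1"
    "\<And>s. x1 \<le> Re s \<Longrightarrow> Re s \<le> x2 \<Longrightarrow> \<bar>Im s\<bar> \<ge> R \<Longrightarrow>
       norm (Gamma s) * exp (pi / 2 * \<bar>Im s\<bar>) * norm (Gamma (2 * (\<upsilon> - s)) * w powr (- (2 * (\<upsilon> - s))))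
         \<le> C * exp (- a * \<bar>Im s\<bar>)"
proof -
  obtain C1 a1 where 1: "a1 > 0"
    "\<And>s. 2 * (Re \<upsilon> - x2) \<le> Re s \<Longrightarrow> Re s \<le> 2 * (Re \<upsilon> - x1) \<Longrightarrow> \<bar>Im s\<bar> \<ge> 1 \<Longrightarrow>
        norm (Gamma s * w powr (- s)) \<le> C1 * exp (- a1 * \<bar>Im s\<bar>)"
    using Gamma_powr_strip_bound[OF assms] by blast
  \<comment> \<open>At most the rate \<open>a1\<close> available from the second Gamma factor, and
    small enough that \<open>pi / 2 - a\<close> is a legitimate nonnegative rate for the first
    one.\<close>
  define a where "a = min a1 (pi / 4)"
  have a: "a > 0" "a \<le> a1" "a \<le> pi / 4" using 1(1) by (auto simp: a_def)
  have "0 \<le> pi / 2 - a" "pi / 2 - a < pi / 2" using a pi_gt_zero by linarith+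
  then obtain C2 where C2: "C2 > 0"
    "\<And>s. x1 \<le> Re s \<Longrightarrow> Re s \<le> x2 \<Longrightarrow> \<bar>Im s\<bar> \<ge> 1 \<Longrightarrow> norm (Gamma s) \<le> C2 * exp (- (pi / 2 - a) * \<bar>Im s\<bar>)"
    using norm_Gamma_strip_bound[of "pi / 2 - a"] by blast
  show ?thesis
  proof (rule that)
    show "C2 * (\<bar>C1\<bar> + 1) * exp (2 * a * \<bar>Im \<upsilon>\<bar>) > 0" using C2 by simp
    show "a > 0" by fact
    show "\<bar>Im \<upsilon>\<bar> + 1 \<ge> 1" by simp
    fix s assume s: "x1 \<le> Re s" "Re s \<le> x2" "\<bar>Im s\<bar> \<ge> \<bar>Im \<upsilon>\<bar> + 1"
    let ?u = "2 * (\<upsilon> - s)"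
    have im: "\<bar>Im ?u\<bar> \<ge> 2 * \<bar>Im s\<bar> - 2 * \<bar>Im \<upsilon>\<bar>" by simp
    have "norm (Gamma ?u * w powr (- ?u)) \<le> C1 * exp (- a1 * \<bar>Im ?u\<bar>)"
      using s im by (intro 1) auto
    also have "\<dots> \<le> (\<bar>C1\<bar> + 1) * exp (- a1 * \<bar>Im ?u\<bar>)" by (intro mult_right_mono) auto
    also have "\<dots> \<le> (\<bar>C1\<bar> + 1) * exp (- a * (2 * \<bar>Im s\<bar> - 2 * \<bar>Im \<upsilon>\<bar>))"
    proof (intro mult_left_mono)
      have "a * (2 * \<bar>Im s\<bar> - 2 * \<bar>Im \<upsilon>\<bar>) \<le> a * \<bar>Im ?u\<bar>" using a im by (intro mult_left_mono) auto
      also have "\<dots> \<le> a1 * \<bar>Im ?u\<bar>" using a by (intro mult_right_mono) auto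
      finally show "exp (- a1 * \<bar>Im ?u\<bar>) \<le> exp (- a * (2 * \<bar>Im s\<bar> - 2 * \<bar>Im \<upsilon>\<bar>))" by simp
    qed auto
    finally have A: "norm (Gamma ?u * w powr (- ?u)) \<le> (\<bar>C1\<bar> + 1) * exp (- a * (2 * \<bar>Im s\<bar> - 2 * \<bar>Im \<upsilon>\<bar>))" .
    have "norm (Gamma s) \<le> C2 * exp (- (pi / 2 - a) * \<bar>Im s\<bar>)" using s by (intro C2) auto
    hence "norm (Gamma s) * exp (pi / 2 * \<bar>Im s\<bar>) \<le> C2 * exp (- (pi / 2 - a) * \<bar>Im s\<bar>) * exp (pi / 2 * \<bar>Im s\<bar>)"
      by (intro mult_right_mono) auto
    hence "norm (Gamma s) * exp (pi / 2 * \<bar>Im s\<bar>) * norm (Gamma ?u * w powr (- ?u)) \<le>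
       C2 * exp (- (pi / 2 - a) * \<bar>Im s\<bar>) * exp (pi / 2 * \<bar>Im s\<bar>) * ((\<bar>C1\<bar> + 1) * exp (- a * (2 * \<bar>Im s\<bar> - 2 * \<bar>Im \<upsilon>\<bar>)))"
      using A C2(1) by (intro mult_mono) auto
    also have "\<dots> = C2 * (\<bar>C1\<bar> + 1) * (exp (- (pi / 2 - a) * \<bar>Im s\<bar>) * exp (pi / 2 * \<bar>Im s\<bar>) * exp (- a * (2 * \<bar>Im s\<bar> - 2 * \<bar>Im \<upsilon>\<bar>)))"
      by (simp only: mult_ac)
    also have "exp (- (pi / 2 - a) * \<bar>Im s\<bar>) * exp (pi / 2 * \<bar>Im s\<bar>) * exp (- a * (2 * \<bar>Im s\<bar> - 2 * \<bar>Im \<upsilon>\<bar>)) =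
       exp (2 * a * \<bar>Im \<upsilon>\<bar>) * exp (- a * \<bar>Im s\<bar>)"
      unfolding exp_add[symmetric] by (rule arg_cong[of _ _ exp]) (simp add: algebra_simps)
    finally show "norm (Gamma s) * exp (pi / 2 * \<bar>Im s\<bar>) * norm (Gamma ?u * w powr (- ?u)) \<le>
       C2 * (\<bar>C1\<bar> + 1) * exp (2 * a * \<bar>Im \<upsilon>\<bar>) * exp (- a * \<bar>Im s\<bar>)" by (simp only: mult_ac)
  qed
qed

text \<open>The conditions \<open>0 < c\<close> and \<open>c < 1\<close> are those of
  \<open>cahen_mellin\<close>, used for the integral in \<open>t\<close>; the condition
  \<open>c < Re \<upsilon>\<close> makes the inner integral in \<open>x\<close> converge.\<close>

lemma laplace_sqrt_exp:
  assumes "Re w > 0" "Re v > 0" "0 < c" "c < 1" "c < Re \<upsilon>"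
  shows "(LINT x|lborel. indicator {0<..} x *\<^sub>R (complex_of_real x powr (\<upsilon> - 1) * exp (- w * of_real (sqrt x))) * exp (- v * of_real x)) =
     1 / of_real pi * (LINT t|lborel. Gamma (Complex c t) * v powr (- Complex c t) *
        (Gamma (2 * (\<upsilon> - Complex c t)) * w powr (- (2 * (\<upsilon> - Complex c t)))))"
proof -
  let ?F = "\<lambda>x. indicator {0<..} x *\<^sub>R (complex_of_real x powr (\<upsilon> - 1) * exp (- w * of_real (sqrt x)))"
  let ?G = "\<lambda>t. Gamma (Complex c t) * v powr (- Complex c t)"
  \<comment> \<open>This is \<open>x powr (- s)\<close> for positive \<open>x\<close>, written with
    \<open>exp\<close> and \<open>ln\<close> for the sake of joint measurability.\<close>
  let ?e = "\<lambda>x t. exp (- Complex c t * of_real (ln x))"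
  let ?H = "\<lambda>x t. ?F x * (?G t * ?e x t)"
  have cI: "c \<notin> \<int>" using assms by (auto elim!: Ints_cases)
  have G: "integrable lborel ?G"
    using assms by (intro integrable_Gamma_powr Complex_notin_nonpos_Ints cI)
  have pe: "of_real x powr (- Complex c t) = ?e x t" if "x > 0" for x t
    using that by (simp add: powr_def Ln_of_real)
  have H1: "?H x t = ?F x * (Gamma (Complex c t) * (v * of_real x) powr (- Complex c t))" for x t
    by (cases "x > 0") (auto simp: powr_times_of_real pe)
  have H2: "?H x t = ?G t * (indicator {0<..} x *\<^sub>R (complex_of_real x powr ((\<upsilon> - Complex c t) - 1) * exp (- w * of_real (sqrt x))))" for x t
  proof (cases "x > 0")
    case True
    have "complex_of_real x powr (\<upsilon> - Complex c t - 1) = of_real x powr (\<upsilon> - 1) * ?e x t"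
      unfolding pe[OF True, symmetric] powr_add[symmetric] by (simp add: algebra_simps)
    thus ?thesis using True by (simp add: mult_ac)
  qed auto
  \<comment> \<open>On a vertical line the modulus separates into a function of \<open>x\<close> and
    a function of \<open>t\<close>, which reduces Fubini's condition to two integrals in one
    variable.\<close>
  have norm_H: "norm (?H x t) = (indicator {0<..} x * (x powr (Re (\<upsilon> - of_real c) - 1) * exp (- Re w * sqrt x))) * norm (?G t)" for x t
    unfolding H2 norm_mult[of "?G t"] norm_laplace_sqrt by simp
  have "integrable (lborel \<Otimes>\<^sub>M lborel) (case_prod ?H)"
  proof (rule lborel_pair.Fubini_integrable)
    have "?G \<in> borel_measurable lborel" using G by (rule borel_measurable_integrable)
    hence [measurable]: "?G \<in> borel_measurable borel" by simp
    have [measurable]: "(\<lambda>t. Complex c t) \<in> borel_measurable borel"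
      by (intro borel_measurable_continuous_onI continuous_intros)
    have [measurable]: "?F \<in> borel_measurable borel" by measurable
    show "case_prod ?H \<in> borel_measurable (lborel \<Otimes>\<^sub>M lborel)"
      by measurable
    have "integrable lborel (\<lambda>x. (indicator {0<..} x * (x powr (Re (\<upsilon> - of_real c) - 1) * exp (- Re w * sqrt x))) * (LINT t|lborel. norm (?G t)))"
      using integrable_laplace_sqrt_real[of "Re (\<upsilon> - of_real c)" "Re w"] assms
      by (intro integrable_mult_left) (auto simp: set_integrable_def)
    thus "integrable lborel (\<lambda>x. LINT t|lborel. norm (case_prod ?H (x, t)))"
      unfolding case_prod_conv norm_H by simp
    have "integrable lborel (?H x)" for x
    proof (rule Bochner_Integration.integrable_bound)
      show "integrable lborel (\<lambda>t. (indicator {0<..} x * (x powr (Re (\<upsilon> - of_real c) - 1) * exp (- Re w * sqrt x))) * norm (?G t))"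
        by (intro integrable_mult_right integrable_norm G)
      show "?H x \<in> borel_measurable lborel" by measurable
      show "AE t in lborel. norm (?H x t) \<le> norm ((indicator {0<..} x * (x powr (Re (\<upsilon> - of_real c) - 1) * exp (- Re w * sqrt x))) * norm (?G t))"
        unfolding norm_H by (intro AE_I2) simp
    qed
    thus "AE x in lborel. integrable lborel (\<lambda>t. case_prod ?H (x, t))" by simp
  qed
  hence "(LINT t|lborel. LINT x|lborel. ?H x t) = (LINT x|lborel. LINT t|lborel. ?H x t)"
    by (rule lborel_pair.Fubini_integral)
  also have "\<dots> = (LINT x|lborel. 2 * of_real pi * (?F x * exp (- v * of_real x)))"
  proof (intro Bochner_Integration.integral_cong refl)
    fix x :: real
    show "(LINT t|lborel. ?H x t) = 2 * of_real pi * (?F x * exp (- v * of_real x))"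
    proof (cases "x > 0")
      case True
      have "(LINT t|lborel. ?H x t) = ?F x * (LINT t|lborel. Gamma (Complex c t) * (v * of_real x) powr (- Complex c t))"
        unfolding H1 by simp
      also have "(LINT t|lborel. Gamma (Complex c t) * (v * of_real x) powr (- Complex c t)) = 2 * of_real pi * exp (- (v * of_real x))"
        using assms True by (intro cahen_mellin) auto
      finally show ?thesis by (simp add: mult.assoc)
    qed auto
  qed
  finally have "2 * of_real pi * (LINT x|lborel. ?F x * exp (- v * of_real x)) = (LINT t|lborel. LINT x|lborel. ?H x t)"
    by (simp only: integral_mult_right_zero)
  also have "\<dots> = (LINT t|lborel. 2 * (?G t * (Gamma (2 * (\<upsilon> - Complex c t)) * w powr (- (2 * (\<upsilon> - Complex c t))))))"
  proof (intro Bochner_Integration.integral_cong refl)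
    fix t :: real
    show "(LINT x|lborel. ?H x t) = 2 * (?G t * (Gamma (2 * (\<upsilon> - Complex c t)) * w powr (- (2 * (\<upsilon> - Complex c t)))))"
      unfolding H2 integral_mult_right_zero using assms by (subst laplace_sqrt) auto
  qed
  finally show ?thesis by (simp add: field_simps)
qed

text \<open>The Mellin-Barnes integrand averaged over \<open>v = \<i> * y\<close> and
  \<open>v = - \<i> * y\<close>: the mean of the two powers \<open>v powr (- s)\<close> is the
  cosine times \<open>y powr (- s)\<close>.\<close>

definition mellin_kernel :: "complex \<Rightarrow> complex \<Rightarrow> real \<Rightarrow> complex \<Rightarrow> complex" where
  "mellin_kernel \<upsilon> w y s =
     Gamma s * cos (of_real pi * s / 2) * of_real y powr (- s) *
     (Gamma (2 * (\<upsilon> - s)) * w powr (- (2 * (\<upsilon> - s))))"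

lemma notin_nonpos_Ints_Re_pos: "Re z > 0 \<Longrightarrow> z \<notin> \<int>\<^sub>\<le>\<^sub>0"
  by (auto elim!: nonpos_Ints_cases')

lemma norm_cos_le_exp: "norm (cos z) \<le> exp \<bar>Im z\<bar>" for z :: complex
proof -
  have "norm (cos z) = norm (exp (\<i> * z) + exp (- \<i> * z)) / 2"
    by (simp add: cos_exp_eq norm_divide)
  also have "\<dots> \<le> (norm (exp (\<i> * z)) + norm (exp (- \<i> * z))) / 2"
    by (intro divide_right_mono norm_triangle_ineq) auto
  also have "\<dots> \<le> (exp \<bar>Im z\<bar> + exp \<bar>Im z\<bar>) / 2"
    by (intro divide_right_mono add_mono) auto
  finally show ?thesis by simp
qed

lemma mellin_kernel_decay:
  assumes "Re w > 0" "y > 0"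
  obtains C a R where "a > 0"
    "\<And>s. x1 \<le> Re s \<Longrightarrow> Re s \<le> x2 \<Longrightarrow> \<bar>Im s\<bar> \<ge> R \<Longrightarrow> norm (mellin_kernel \<upsilon> w y s) \<le> C * exp (- a * \<bar>Im s\<bar>)"
proof -
  obtain C a R where C: "C > 0" "a > 0" "R \<ge> 1"
    "\<And>s. x1 \<le> Re s \<Longrightarrow> Re s \<le> x2 \<Longrightarrow> \<bar>Im s\<bar> \<ge> R \<Longrightarrow>
       norm (Gamma s) * exp (pi / 2 * \<bar>Im s\<bar>) * norm (Gamma (2 * (\<upsilon> - s)) * w powr (- (2 * (\<upsilon> - s))))
         \<le> C * exp (- a * \<bar>Im s\<bar>)"
    using mellin_kernel_strip_bound[OF assms(1)] by metis
  obtain K where K: "K > 0" "\<And>s. - x2 \<le> Re s \<Longrightarrow> Re s \<le> - x1 \<Longrightarrow>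
      norm (of_real y powr s) \<le> K * exp (\<bar>Arg (of_real y)\<bar> * \<bar>Im s\<bar>)"
    using norm_powr_strip_bound[of "of_real y" "- x2" "- x1"] assms(2) by auto
  show ?thesis
  proof (rule that[OF C(2)])
    fix s assume s: "x1 \<le> Re s" "Re s \<le> x2" "\<bar>Im s\<bar> \<ge> R"
    have 1: "norm (of_real y powr (- s)) \<le> K"
      using K(2)[of "- s"] s assms(2) by (simp add: Arg_of_real)
    have 2: "norm (cos (of_real pi * s / 2)) \<le> exp (pi / 2 * \<bar>Im s\<bar>)"
      using norm_cos_le_exp[of "of_real pi * s / 2"] by (simp add: abs_mult)
    let ?u = "2 * (\<upsilon> - s)"
    have "norm (mellin_kernel \<upsilon> w y s) =
        norm (Gamma s) * norm (cos (of_real pi * s / 2)) * norm (Gamma ?u * w powr (- ?u)) * norm (of_real y powr (- s))"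
      by (simp add: mellin_kernel_def norm_mult)
    also have "\<dots> \<le> norm (Gamma s) * exp (pi / 2 * \<bar>Im s\<bar>) * norm (Gamma ?u * w powr (- ?u)) * K"
      using 1 2 by (intro mult_mono mult_right_mono mult_left_mono mult_nonneg_nonneg) auto
    also have "\<dots> \<le> C * exp (- a * \<bar>Im s\<bar>) * K"
      using C(4)[OF s] K(1) by (intro mult_right_mono) auto
    finally show "norm (mellin_kernel \<upsilon> w y s) \<le> (C * K) * exp (- a * \<bar>Im s\<bar>)" by (simp add: mult_ac)
  qed
qed

text \<open>For imaginary \<open>v\<close> the integrand of \<open>cahen_mellin\<close> is no longer
  absolutely integrable, so the exchange of integrals cannot be repeated. Instead both sides of the
  exchanged formula are continued to the boundary by dominated convergence.\<close>

lemma laplace_sqrt_exp_boundary: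
  assumes "Re w > 0" "Re v = 0" "v \<noteq> 0" "0 < c" "c < 1" "c < Re \<upsilon>"
  defines "M \<equiv> (\<lambda>v t. Gamma (Complex c t) * v powr (- Complex c t) *
        (Gamma (2 * (\<upsilon> - Complex c t)) * w powr (- (2 * (\<upsilon> - Complex c t)))))"
  shows "integrable lborel (M v)"
    and "(LINT x|lborel. indicator {0<..} x *\<^sub>R (complex_of_real x powr (\<upsilon> - 1) * exp (- w * of_real (sqrt x))) * exp (- v * of_real x)) =
     1 / of_real pi * (LINT t|lborel. M v t)"
proof -
  let ?F = "\<lambda>x. indicator {0<..} x *\<^sub>R (complex_of_real x powr (\<upsilon> - 1) * exp (- w * of_real (sqrt x)))"
  define vn where "vn = (\<lambda>n. v + of_real (1 / real (Suc n)))"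
  have vn_pos: "Re (vn n) > 0" for n using assms by (simp add: vn_def)
  have "(\<lambda>n. v + of_real (1 / real (Suc n))) \<longlonglongrightarrow> v + of_real 0"
    by (intro tendsto_intros LIMSEQ_Suc lim_1_over_n)
  hence vn_lim: "vn \<longlonglongrightarrow> v" by (simp add: vn_def)
  have cI: "c \<notin> \<int>" using assms by (auto elim!: Ints_cases)
  have contM: "continuous_on UNIV (M u)" for u
    unfolding M_def using assms(4-6)
    by (intro continuous_on_mult continuous_on_Gamma_compose continuous_on_powr_const continuous_on_minus
          continuous_on_Complex continuous_on_diff continuous_on_const continuous_on_id
          Complex_notin_nonpos_Ints cI notin_nonpos_Ints_Re_pos) auto
  obtain C a R where C: "C > 0" "a > 0" "R \<ge> 1"
    "\<And>s. c \<le> Re s \<Longrightarrow> Re s \<le> c \<Longrightarrow> \<bar>Im s\<bar> \<ge> R \<Longrightarrow>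
       norm (Gamma s) * exp (pi / 2 * \<bar>Im s\<bar>) * norm (Gamma (2 * (\<upsilon> - s)) * w powr (- (2 * (\<upsilon> - s))))
         \<le> C * exp (- a * \<bar>Im s\<bar>)"
    using mellin_kernel_strip_bound[OF assms(1)] by metis
  \<comment> \<open>A majorant for all \<open>u\<close> with \<open>Re u \<ge> 0\<close> and
    \<open>norm u \<ge> norm v\<close>: there \<open>\<bar>Arg u\<bar> \<le> pi / 2\<close> and
    \<open>norm u powr (- c) \<le> norm v powr (- c)\<close>. The approximating points qualify
    because \<open>v\<close> is imaginary and they differ from it by positive reals.\<close>
  define D where "D = (\<lambda>t. norm v powr (- c) * (norm (Gamma (Complex c t)) * exp (pi / 2 * \<bar>t\<bar>) *
       norm (Gamma (2 * (\<upsilon> - Complex c t)) * w powr (- (2 * (\<upsilon> - Complex c t))))))"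
  have D: "integrable lborel D"
  proof -
    have "integrable lborel (\<lambda>t. complex_of_real (D t))"
    proof (rule integrable_exp_decay[OF _ C(2)])
      show "continuous_on UNIV (\<lambda>t. complex_of_real (D t))"
        unfolding D_def using assms(4-6)
        by (intro continuous_on_mult continuous_on_Gamma_compose continuous_on_powr_const continuous_on_minus
              continuous_on_Complex continuous_on_diff continuous_on_const continuous_on_id continuous_on_of_real
              continuous_on_norm continuous_on_exp continuous_on_rabs
              Complex_notin_nonpos_Ints cI notin_nonpos_Ints_Re_pos) auto
      fix t assume "R \<le> \<bar>t\<bar>"
      hence "D t \<le> norm v powr (- c) * (C * exp (- a * \<bar>t\<bar>))"
        unfolding D_def using C(4)[of "Complex c t"] by (intro mult_left_mono) auto
      moreover have "D t \<ge> 0" by (simp add: D_def)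
      ultimately show "norm (complex_of_real (D t)) \<le> (norm v powr (- c) * C) * exp (- a * \<bar>t\<bar>)"
        by (simp add: mult_ac)
    qed
    thus ?thesis by (simp add: complex_of_real_integrable_eq)
  qed
  have M_le: "norm (M u t) \<le> D t" if "Re u \<ge> 0" "norm u \<ge> norm v" for u t
  proof -
    have u: "u \<noteq> 0" using that assms(3) by auto
    have "norm (u powr (- Complex c t)) = exp (- c * ln (norm u)) * exp (t * Arg u)"
      by (simp add: norm_powr_complex[OF u] exp_add[symmetric])
    also have "\<dots> \<le> norm v powr (- c) * exp (pi / 2 * \<bar>t\<bar>)"
    proof (intro mult_mono)
      have "ln (norm v) \<le> ln (norm u)" using that assms(3) u by (intro ln_mono) auto
      thus "exp (- c * ln (norm u)) \<le> norm v powr (- c)"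
        using assms(3,4) by (simp add: powr_def mult_left_mono)
      have "\<bar>Arg u\<bar> \<le> pi / 2" using that(1) Arg_Re_nonneg[of u] by simp
      hence "\<bar>t\<bar> * \<bar>Arg u\<bar> \<le> \<bar>t\<bar> * (pi / 2)" by (intro mult_left_mono) auto
      moreover have "t * Arg u \<le> \<bar>t\<bar> * \<bar>Arg u\<bar>" by (metis abs_ge_self abs_mult)
      ultimately show "exp (t * Arg u) \<le> exp (pi / 2 * \<bar>t\<bar>)" by (simp add: mult.commute)
    qed auto
    finally have "norm (Gamma (Complex c t)) * norm (u powr (- Complex c t)) *
         norm (Gamma (2 * (\<upsilon> - Complex c t)) * w powr (- (2 * (\<upsilon> - Complex c t)))) \<le>
       norm (Gamma (Complex c t)) * (norm v powr (- c) * exp (pi / 2 * \<bar>t\<bar>)) *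
         norm (Gamma (2 * (\<upsilon> - Complex c t)) * w powr (- (2 * (\<upsilon> - Complex c t))))"
      by (intro mult_right_mono mult_left_mono) auto
    thus ?thesis unfolding M_def D_def norm_mult by (simp only: mult_ac)
  qed
  show M_int: "integrable lborel (M v)"
    by (rule Bochner_Integration.integrable_bound[OF D])
       (use contM M_le[of v] assms(2) in \<open>auto simp: borel_measurable_continuous_onI intro!: AE_I2 order_trans[OF _ abs_ge_self]\<close>)
  have "(\<lambda>n. LINT t|lborel. M (vn n) t) \<longlonglongrightarrow> (LINT t|lborel. M v t)"
  proof (rule integral_dominated_convergence[OF _ _ D])
    show "AE t in lborel. (\<lambda>n. M (vn n) t) \<longlonglongrightarrow> M v t"
    proof (rule AE_I2)
      fix t
      have "v \<notin> \<real>\<^sub>\<le>\<^sub>0" using assms(2,3) by (auto simp: complex_nonpos_Reals_iff complex_eq_iff)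
      hence "(\<lambda>n. vn n powr (- Complex c t)) \<longlonglongrightarrow> v powr (- Complex c t)"
        by (intro tendsto_powr_complex vn_lim tendsto_const)
      thus "(\<lambda>n. M (vn n) t) \<longlonglongrightarrow> M v t"
        unfolding M_def by (intro tendsto_mult tendsto_const)
    qed
    fix n
    have "norm v \<le> norm (vn n)"
    proof -
      have "(norm v)^2 \<le> (norm (vn n))^2" using assms(2) by (simp add: cmod_power2 vn_def)
      thus ?thesis by (simp add: power2_le_iff_abs_le)
    qed
    thus "AE t in lborel. norm (M (vn n) t) \<le> D t"
      using vn_pos[of n] by (intro AE_I2 M_le) auto
  qed (use contM in \<open>auto simp: borel_measurable_continuous_onI\<close>)
  hence "(\<lambda>n. 1 / of_real pi * (LINT t|lborel. M (vn n) t)) \<longlonglongrightarrow> 1 / of_real pi * (LINT t|lborel. M v t)"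
    by (intro tendsto_intros)
  also have "(\<lambda>n. 1 / of_real pi * (LINT t|lborel. M (vn n) t)) = (\<lambda>n. LINT x|lborel. ?F x * exp (- vn n * of_real x))"
    unfolding M_def using assms vn_pos by (intro ext laplace_sqrt_exp[symmetric]) auto
  finally have 1: "(\<lambda>n. LINT x|lborel. ?F x * exp (- vn n * of_real x)) \<longlonglongrightarrow> 1 / of_real pi * (LINT t|lborel. M v t)" .
  have "(\<lambda>n. LINT x|lborel. ?F x * exp (- vn n * of_real x)) \<longlonglongrightarrow> (LINT x|lborel. ?F x * exp (- v * of_real x))"
  proof (rule integral_dominated_convergence)
    show "integrable lborel (\<lambda>x. norm (?F x))"
      using assms by (intro integrable_norm integrable_laplace_sqrt) auto
    show "AE x in lborel. (\<lambda>n. ?F x * exp (- vn n * of_real x)) \<longlonglongrightarrow> ?F x * exp (- v * of_real x)"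
      by (intro AE_I2 tendsto_intros vn_lim)
    have ex: "(\<lambda>x. exp (- u * complex_of_real x)) \<in> borel_measurable lborel" for u
      by (simp add: borel_measurable_continuous_onI continuous_intros)
    have F: "?F \<in> borel_measurable lborel" by measurable
    show "(\<lambda>x. ?F x * exp (- v * of_real x)) \<in> borel_measurable lborel"
      by (intro borel_measurable_times ex F)
    fix n
    show "(\<lambda>x. ?F x * exp (- vn n * of_real x)) \<in> borel_measurable lborel"
      by (intro borel_measurable_times ex F)
    show "AE x in lborel. norm (?F x * exp (- vn n * of_real x)) \<le> norm (?F x)"
    proof (rule AE_I2)
      fix x :: real
      show "norm (?F x * exp (- vn n * of_real x)) \<le> norm (?F x)"
      proof (cases "x > 0")
        case True
        hence "norm (exp (- vn n * of_real x)) \<le> 1" using vn_pos[of n] by simp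
        hence "norm (?F x) * norm (exp (- vn n * of_real x)) \<le> norm (?F x) * 1"
          by (intro mult_left_mono) auto
        thus ?thesis by (simp only: norm_mult mult_1_right)
      qed auto
    qed
  qed
  from LIMSEQ_unique[OF this 1]
  show "(LINT x|lborel. ?F x * exp (- v * of_real x)) = 1 / of_real pi * (LINT t|lborel. M v t)" .
qed

lemma imaginary_powr_sum:
  assumes "y > 0"
  shows "(\<i> * of_real y) powr (- s) + (- \<i> * of_real y) powr (- s) = 2 * cos (of_real pi * s / 2) * of_real y powr (- s)"
proof -
  have 1: "(\<i> * of_real y) powr (- s) = exp (- \<i> * (of_real pi * s / 2)) * of_real y powr (- s)"
    unfolding powr_times_of_real[OF assms] by (simp add: powr_def mult_ac)
  have 2: "(- \<i> * of_real y) powr (- s) = exp (\<i> * (of_real pi * s / 2)) * of_real y powr (- s)"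
    unfolding powr_times_of_real[OF assms] by (simp add: powr_def mult_ac)
  show ?thesis unfolding 1 2 by (simp add: cos_exp_eq algebra_simps)
qed

lemma cosine_laplace_sqrt:
  assumes "Re w > 0" "y > 0" "0 < c" "c < 1" "c < Re \<upsilon>"
  shows "integrable lborel (\<lambda>t. mellin_kernel \<upsilon> w y (Complex c t))"
    "(LINT x|lborel. indicator {0<..} x *\<^sub>R (complex_of_real x powr (\<upsilon> - 1) * exp (- w * of_real (sqrt x))) * of_real (cos (x * y))) =
      1 / of_real pi * (LINT t|lborel. mellin_kernel \<upsilon> w y (Complex c t))"
proof -
  let ?F = "\<lambda>x. indicator {0<..} x *\<^sub>R (complex_of_real x powr (\<upsilon> - 1) * exp (- w * of_real (sqrt x)))"
  let ?M = "\<lambda>v t. Gamma (Complex c t) * v powr (- Complex c t) *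
        (Gamma (2 * (\<upsilon> - Complex c t)) * w powr (- (2 * (\<upsilon> - Complex c t))))"
  let ?v1 = "\<i> * of_real y" and ?v2 = "- \<i> * of_real y"
  have v: "Re ?v1 = 0" "?v1 \<noteq> 0" "Re ?v2 = 0" "?v2 \<noteq> 0" using assms by auto
  note A1 = laplace_sqrt_exp_boundary[OF assms(1) v(1,2) assms(3-5)]
  note A2 = laplace_sqrt_exp_boundary[OF assms(1) v(3,4) assms(3-5)]
  have M: "?M ?v1 t + ?M ?v2 t = 2 * mellin_kernel \<upsilon> w y (Complex c t)" for t
  proof -
    have "?M ?v1 t + ?M ?v2 t = Gamma (Complex c t) * (?v1 powr (- Complex c t) + ?v2 powr (- Complex c t)) *
        (Gamma (2 * (\<upsilon> - Complex c t)) * w powr (- (2 * (\<upsilon> - Complex c t))))"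
      by (simp only: distrib_left distrib_right)
    thus ?thesis unfolding imaginary_powr_sum[OF assms(2)] mellin_kernel_def by (simp only: mult_ac)
  qed
  have "integrable lborel (\<lambda>t. ?M ?v1 t + ?M ?v2 t)"
    by (intro Bochner_Integration.integrable_add A1 A2)
  hence i2: "integrable lborel (\<lambda>t. 2 * mellin_kernel \<upsilon> w y (Complex c t))" unfolding M .
  hence "integrable lborel (\<lambda>t. 1 / 2 * (2 * mellin_kernel \<upsilon> w y (Complex c t)))"
    by (rule integrable_mult_right)
  thus "integrable lborel (\<lambda>t. mellin_kernel \<upsilon> w y (Complex c t))" by simp
  have int: "integrable lborel (\<lambda>x. ?F x * exp (- u * of_real x))" if "Re u = 0" for u
  proof (rule Bochner_Integration.integrable_bound)
    show "integrable lborel ?F" using assms by (intro integrable_laplace_sqrt) auto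
    have "(\<lambda>x. exp (- u * complex_of_real x)) \<in> borel_measurable lborel"
      by (simp add: borel_measurable_continuous_onI continuous_intros)
    moreover have "?F \<in> borel_measurable lborel" by measurable
    ultimately show "(\<lambda>x. ?F x * exp (- u * of_real x)) \<in> borel_measurable lborel"
      by (rule borel_measurable_times[rotated])
    show "AE x in lborel. norm (?F x * exp (- u * of_real x)) \<le> norm (?F x)"
      using that by (intro AE_I2) (simp only: norm_mult norm_exp_eq_Re, simp)
  qed
  have "2 * (?F x * of_real (cos (x * y))) = ?F x * exp (- ?v1 * of_real x) + ?F x * exp (- ?v2 * of_real x)" for x
  proof -
    have "2 * of_real (cos (x * y)) = exp (\<i> * of_real (x * y)) + exp (- (\<i> * of_real (x * y)))"
      by (simp only: cos_of_real[symmetric] cos_exp_eq) simp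
    also have "\<dots> = exp (- ?v1 * of_real x) + exp (- ?v2 * of_real x)" by (simp add: mult_ac)
    finally have "?F x * (2 * of_real (cos (x * y))) = ?F x * (exp (- ?v1 * of_real x) + exp (- ?v2 * of_real x))"
      by (simp only:)
    thus ?thesis by (simp only: distrib_left mult.left_commute)
  qed
  hence "(LINT x|lborel. 2 * (?F x * of_real (cos (x * y)))) =
      (LINT x|lborel. ?F x * exp (- ?v1 * of_real x)) + (LINT x|lborel. ?F x * exp (- ?v2 * of_real x))"
    using int[OF v(1)] int[OF v(3)] by (simp only: Bochner_Integration.integral_add)
  also have "\<dots> = 1 / of_real pi * (LINT t|lborel. ?M ?v1 t + ?M ?v2 t)"
    unfolding A1(2) A2(2) Bochner_Integration.integral_add[OF A1(1) A2(1)] by (simp only: distrib_left)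
  also have "\<dots> = 1 / of_real pi * (2 * (LINT t|lborel. mellin_kernel \<upsilon> w y (Complex c t)))"
    unfolding M by (simp only: integral_mult_right_zero)
  finally have "2 * (LINT x|lborel. ?F x * of_real (cos (x * y))) =
     2 * (1 / of_real pi * (LINT t|lborel. mellin_kernel \<upsilon> w y (Complex c t)))"
    by (simp only: integral_mult_right_zero mult.left_commute)
  thus "(LINT x|lborel. ?F x * of_real (cos (x * y))) = 1 / of_real pi * (LINT t|lborel. mellin_kernel \<upsilon> w y (Complex c t))"
    by (simp only: mult_cancel_left) simp
qed

section \<open>Multiplication formulas and the special Meijer functions\<close>

text \<open>Membership in the plane cut along the nonpositive reals. Unlike the mere avoidance of
  poles it is preserved when a nonnegative real is added, so one assumption covers all arguments in
  a multiplication formula. It holds on the lines of integration and wherever the imaginary part is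
  large.\<close>

definition off_cut :: "complex \<Rightarrow> bool" where
  "off_cut z \<longleftrightarrow> Im z \<noteq> 0 \<or> Re z > 0"

lemma off_cut_notin [simp]: "off_cut z \<Longrightarrow> z \<notin> \<int>\<^sub>\<le>\<^sub>0"
  by (auto simp: off_cut_def elim!: nonpos_Ints_cases')

lemma off_cut_add: "off_cut z \<Longrightarrow> Im a = 0 \<Longrightarrow> Re a \<ge> 0 \<Longrightarrow> off_cut (z + a)"
  by (auto simp: off_cut_def)

lemma Gamma_duplication_off_cut:
  assumes "off_cut z"
  shows "Gamma z * Gamma (z + 1 / 2) = exp ((1 - 2 * z) * of_real (ln 2)) * of_real (sqrt pi) * Gamma (2 * z)"
  by (rule Gamma_legendre_duplication) (use assms in \<open>auto intro!: off_cut_notin off_cut_add\<close>)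

text \<open>Gauss's multiplication formula for 4: duplication at \<open>u\<close> and at
  \<open>u + 1/4\<close>, then at \<open>2 * u\<close>. The exponents of 2 add up to
  \<open>(1 - 2 * u) + (1/2 - 2 * u) + (1 - 4 * u)\<close>.\<close>

lemma Gamma_quadruplication:
  assumes "off_cut u"
  shows "Gamma u * Gamma (u + 1/4) * Gamma (u + 1/2) * Gamma (u + 3/4) =
    of_real (pi * sqrt pi) * exp ((5/2 - 8 * u) * of_real (ln 2)) * Gamma (4 * u)"
proof -
  let ?e = "\<lambda>a. exp (a * of_real (ln 2)) :: complex" and ?p = "complex_of_real (sqrt pi)"
  have pp: "?p * ?p = of_real pi" by (simp flip: of_real_mult)
  have o: "off_cut (u + 1/4)" "off_cut (2 * u)"
    using assms by (auto intro!: off_cut_add) (auto simp: off_cut_def)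
  have d: "Gamma u * Gamma (u + 1 / 2) = ?e (1 - 2 * u) * ?p * Gamma (2 * u)"
      "Gamma (u + 1/4) * Gamma (u + 3/4) = ?e (1/2 - 2 * u) * ?p * Gamma (2 * u + 1/2)"
      "Gamma (2 * u) * Gamma (2 * u + 1/2) = ?e (1 - 4 * u) * ?p * Gamma (4 * u)"
    using Gamma_duplication_off_cut[OF assms] Gamma_duplication_off_cut[OF o(1)] Gamma_duplication_off_cut[OF o(2)]
    by (simp_all add: algebra_simps)
  have "Gamma u * Gamma (u + 1/4) * Gamma (u + 1/2) * Gamma (u + 3/4) =
      (Gamma u * Gamma (u + 1/2)) * (Gamma (u + 1/4) * Gamma (u + 3/4))" by (simp only: mult_ac)
  also have "\<dots> = (?p * ?p) * (?e (1 - 2 * u) * ?e (1/2 - 2 * u)) * (Gamma (2 * u) * Gamma (2 * u + 1/2))"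
    unfolding d(1,2) by (simp only: mult_ac)
  also have "\<dots> = (?p * ?p) * ?p * (?e (1 - 2 * u) * ?e (1/2 - 2 * u) * ?e (1 - 4 * u)) * Gamma (4 * u)"
    unfolding d(3) by (simp only: mult_ac)
  also have "?e (1 - 2 * u) * ?e (1/2 - 2 * u) * ?e (1 - 4 * u) = ?e (5/2 - 8 * u)"
    unfolding exp_add[symmetric] by (rule arg_cong[of _ _ exp]) (simp add: algebra_simps)
  finally show ?thesis by (simp add: pp)
qed

text \<open>Gauss's multiplication formula for 8: quadruplication at \<open>u\<close> and at
  \<open>u + 1/8\<close>, then duplication at \<open>4 * u\<close>.\<close>

lemma Gamma_octuplication:
  assumes "off_cut u"
  shows "Gamma u * Gamma (u + 1/8) * Gamma (u + 1/4) * Gamma (u + 3/8) *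
      Gamma (u + 1/2) * Gamma (u + 5/8) * Gamma (u + 3/4) * Gamma (u + 7/8) =
    of_real (pi ^ 3 * sqrt pi) * exp ((5 - 24 * u) * of_real (ln 2)) * Gamma (8 * u)"
proof -
  let ?e = "\<lambda>a. exp (a * of_real (ln 2)) :: complex" and ?p = "complex_of_real (sqrt pi)"
  have o: "off_cut (u + 1/8)" "off_cut (4 * u)"
    using assms by (auto intro!: off_cut_add) (auto simp: off_cut_def)
  have q1: "Gamma (u + 1/8) * Gamma (u + 3/8) * Gamma (u + 5/8) * Gamma (u + 7/8) =
      of_real (pi * sqrt pi) * ?e (3/2 - 8 * u) * Gamma (4 * u + 1/2)"
    using Gamma_quadruplication[OF o(1)] by (simp add: algebra_simps)
  have d: "Gamma (4 * u) * Gamma (4 * u + 1/2) = ?e (1 - 8 * u) * ?p * Gamma (8 * u)"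
    using Gamma_duplication_off_cut[OF o(2)] by (simp add: algebra_simps)
  have "Gamma u * Gamma (u + 1/8) * Gamma (u + 1/4) * Gamma (u + 3/8) *
      Gamma (u + 1/2) * Gamma (u + 5/8) * Gamma (u + 3/4) * Gamma (u + 7/8) =
      (Gamma u * Gamma (u + 1/4) * Gamma (u + 1/2) * Gamma (u + 3/4)) *
      (Gamma (u + 1/8) * Gamma (u + 3/8) * Gamma (u + 5/8) * Gamma (u + 7/8))" by (simp only: mult_ac)
  also have "\<dots> = of_real (pi * sqrt pi) * of_real (pi * sqrt pi) * (?e (5/2 - 8 * u) * ?e (3/2 - 8 * u)) *
      (Gamma (4 * u) * Gamma (4 * u + 1/2))"
    unfolding Gamma_quadruplication[OF assms] q1 by (simp only: mult_ac)
  also have "\<dots> = of_real (pi * sqrt pi) * of_real (pi * sqrt pi) * ?p *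
      (?e (5/2 - 8 * u) * ?e (3/2 - 8 * u) * ?e (1 - 8 * u)) * Gamma (8 * u)"
    unfolding d by (simp only: mult_ac)
  also have "?e (5/2 - 8 * u) * ?e (3/2 - 8 * u) * ?e (1 - 8 * u) = ?e (5 - 24 * u)"
    unfolding exp_add[symmetric] by (rule arg_cong[of _ _ exp]) (simp add: algebra_simps)
  also have "of_real (pi * sqrt pi) * of_real (pi * sqrt pi) * ?p = of_real (pi ^ 3 * sqrt pi)"
    unfolding of_real_mult[symmetric] by (rule arg_cong[of _ _ of_real]) (simp add: power3_eq_cube)
  finally show ?thesis .
qed

text \<open>This is where the cosine of \<open>mellin_kernel\<close> comes from. Reflection turns
  the denominator into \<open>Gamma (1/2 - \<zeta>) * cos (pi * \<zeta>) / pi\<close>, and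
  duplication merges the two Gamma values.\<close>

lemma Gamma_quotient_cos:
  assumes "off_cut (- \<zeta>)"
  shows "Gamma (- \<zeta>) / Gamma (1/2 + \<zeta>) =
    of_real (1 / sqrt pi) * exp ((1 + 2 * \<zeta>) * of_real (ln 2)) * Gamma (- 2 * \<zeta>) * cos (of_real pi * \<zeta>)"
proof -
  have o: "off_cut (- \<zeta> + 1/2)" using assms by (rule off_cut_add) auto
  have eqs: "1 - (1/2 + \<zeta>) = - \<zeta> + 1/2" "sin (of_real pi * (1/2 + \<zeta>)) = cos (of_real pi * \<zeta>)"
    by (simp_all add: sin_cos_eq algebra_simps)
  have refl: "rGamma (1/2 + \<zeta>) * rGamma (- \<zeta> + 1/2) = cos (of_real pi * \<zeta>) / of_real pi"
    using rGamma_reflection_complex[of "1/2 + \<zeta>"] unfolding eqs .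
  have "rGamma (- \<zeta> + 1/2) * Gamma (- \<zeta> + 1/2) = 1"
    using off_cut_notin[OF o] by (simp add: rGamma_inverse_Gamma Gamma_eq_zero_iff)
  hence "rGamma (1/2 + \<zeta>) = (rGamma (1/2 + \<zeta>) * rGamma (- \<zeta> + 1/2)) * Gamma (- \<zeta> + 1/2)"
    by (simp only: mult.assoc mult_1_right)
  hence rG: "rGamma (1/2 + \<zeta>) = Gamma (- \<zeta> + 1/2) * cos (of_real pi * \<zeta>) / of_real pi"
    unfolding refl by simp
  have "Gamma (- \<zeta>) / Gamma (1/2 + \<zeta>) = Gamma (- \<zeta>) * rGamma (1/2 + \<zeta>)"
    by (simp only: rGamma_inverse_Gamma divide_inverse)
  also have "\<dots> = Gamma (- \<zeta>) * Gamma (- \<zeta> + 1/2) * cos (of_real pi * \<zeta>) / of_real pi"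
    by (simp only: rG times_divide_eq_right mult.assoc)
  also have "Gamma (- \<zeta>) * Gamma (- \<zeta> + 1/2) = exp ((1 + 2 * \<zeta>) * of_real (ln 2)) * of_real (sqrt pi) * Gamma (- 2 * \<zeta>)"
    using Gamma_duplication_off_cut[OF assms] by simp
  also have "complex_of_real (sqrt pi) = of_real pi * of_real (1 / sqrt pi)"
    unfolding of_real_mult[symmetric] by (simp add: real_div_sqrt)
  finally show ?thesis by (simp add: field_simps)
qed

text \<open>Since \<open>log_quot\<close> takes the argument of the quotient to be exactly
  \<open>- m * Arg w\<close>, its powers split into principal powers of \<open>w\<close> even when
  that argument leaves the principal range.\<close>

lemma exp_log_quot_mult:
  assumes "y > 0" "w \<noteq> 0"
  shows "exp (\<zeta> * log_quot (2 ^ k * y ^ n) w m) =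
     exp (of_nat k * \<zeta> * of_real (ln 2)) * of_real y powr (of_nat n * \<zeta>) * w powr (- (of_nat m * \<zeta>))"
proof -
  have "log_quot (2 ^ k * y ^ n) w m = of_nat k * of_real (ln 2) + of_nat n * of_real (ln y) - of_nat m * Ln w"
    using assms by (simp add: log_quot_def ln_mult ln_realpow)
  hence "exp (\<zeta> * log_quot (2 ^ k * y ^ n) w m) =
      exp (of_nat k * \<zeta> * of_real (ln 2) + of_nat n * \<zeta> * of_real (ln y) + - (of_nat m * \<zeta>) * Ln w)"
    by (intro arg_cong[of _ _ exp]) (simp only: ring_distribs mult_ac mult_minus_left mult_minus_right diff_conv_add_uminus)
  thus ?thesis
    using assms by (simp only: exp_add) (simp add: powr_def Ln_of_real)
qed

text \<open>The substitution is \<open>s = - 2 * \<zeta>\<close>, so that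
  \<open>4 * u = 2 * (\<upsilon> - s)\<close>. The powers of 2 from the cosine quotient, from
  quadruplication and from the argument have exponents \<open>1 + 2 * \<zeta>\<close>,
  \<open>5/2 - 8 * u\<close> and \<open>6 * \<zeta>\<close>; the constant 64 is the one for which
  \<zeta> drops out of their sum.\<close>

lemma meijer_integrand_four:
  assumes "off_cut (- \<zeta>)" "off_cut (\<upsilon> / 2 + \<zeta>)" "y > 0" "w \<noteq> 0"
  shows "meijer_integrand [(4 - 2*\<upsilon>)/4, (3 - 2*\<upsilon>)/4, (2 - 2*\<upsilon>)/4, (1 - 2*\<upsilon>)/4] [] [0] [1/2] (log_quot (64 * y^2) w 4) \<zeta> =
     of_real pi * exp ((7/2 - 4 * \<upsilon>) * of_real (ln 2)) * w powr (2 * \<upsilon>) * mellin_kernel \<upsilon> w y (- (2 * \<zeta>))"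
proof -
  let ?e = "\<lambda>a. exp (a * of_real (ln 2)) :: complex"
  define u where "u = \<upsilon> / 2 + \<zeta>"
  have args: "1 - (4 - 2*\<upsilon>)/4 + \<zeta> = u" "1 - (3 - 2*\<upsilon>)/4 + \<zeta> = u + 1/4" "1 - (2 - 2*\<upsilon>)/4 + \<zeta> = u + 1/2"
    "1 - (1 - 2*\<upsilon>)/4 + \<zeta> = u + 3/4" "0 - \<zeta> = - \<zeta>" "1 - 1/2 + \<zeta> = 1/2 + \<zeta>"
    by (simp_all add: u_def field_simps)
  have u4: "4 * u = 2 * (\<upsilon> - (- (2 * \<zeta>)))" by (simp add: u_def algebra_simps)
  have "meijer_integrand [(4 - 2*\<upsilon>)/4, (3 - 2*\<upsilon>)/4, (2 - 2*\<upsilon>)/4, (1 - 2*\<upsilon>)/4] [] [0] [1/2] (log_quot (64 * y^2) w 4) \<zeta> =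
     (Gamma (- \<zeta>) / Gamma (1/2 + \<zeta>)) * (Gamma u * Gamma (u + 1/4) * Gamma (u + 1/2) * Gamma (u + 3/4)) *
     exp (\<zeta> * log_quot (2 ^ 6 * y^2) w 4)"
    unfolding meijer_integrand_def list.map prod_list.Cons prod_list.Nil args by simp
  also have "\<dots> = (of_real (1 / sqrt pi) * of_real (pi * sqrt pi)) *
       (?e (1 + 2 * \<zeta>) * ?e (5/2 - 8 * u) * ?e (of_nat 6 * \<zeta>)) * w powr (- (of_nat 4 * \<zeta>)) *
       (Gamma (- 2 * \<zeta>) * cos (of_real pi * \<zeta>) * of_real y powr (of_nat 2 * \<zeta>) * Gamma (4 * u))"
    unfolding Gamma_quotient_cos[OF assms(1)] Gamma_quadruplication[OF assms(2)[folded u_def]]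
      exp_log_quot_mult[OF assms(3,4)] by (simp only: mult_ac)
  also have "?e (1 + 2 * \<zeta>) * ?e (5/2 - 8 * u) * ?e (of_nat 6 * \<zeta>) = ?e (7/2 - 4 * \<upsilon>)"
    unfolding exp_add[symmetric] by (rule arg_cong[of _ _ exp]) (simp add: u_def algebra_simps)
  also have "complex_of_real (1 / sqrt pi) * of_real (pi * sqrt pi) = of_real pi"
    unfolding of_real_mult[symmetric] by simp
  also have "w powr (- (of_nat 4 * \<zeta>)) = w powr (2 * \<upsilon>) * w powr (- (2 * (\<upsilon> - (- (2 * \<zeta>)))))"
    unfolding powr_add[symmetric] by (simp add: algebra_simps)
  finally show ?thesis
    unfolding mellin_kernel_def u4 by (simp add: mult_ac)
qed

text \<open>The substitution is \<open>s = - 4 * \<zeta>\<close>. Duplication in numerator and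
  denominator reduces the quotient of four Gamma values to that of \<open>Gamma_quotient_cos\<close>
  at \<open>2 * \<zeta>\<close>. The constant \<open>4^8 = 2^16\<close> again removes \<zeta> from
  the exponent of 2.\<close>

lemma meijer_integrand_eight:
  assumes "off_cut (- \<zeta>)" "off_cut (\<upsilon> / 4 + \<zeta>)" "off_cut (1 / 4 + \<zeta>)" "y > 0" "w \<noteq> 0"
  shows "meijer_integrand [(8 - 2*\<upsilon>)/8, (7 - 2*\<upsilon>)/8, (6 - 2*\<upsilon>)/8, (5 - 2*\<upsilon>)/8,
                   (4 - 2*\<upsilon>)/8, (3 - 2*\<upsilon>)/8, (2 - 2*\<upsilon>)/8, (1 - 2*\<upsilon>)/8] [] [0, 1/2] [1/4, 3/4]
           (log_quot (4^8 * y^4) w 8) \<zeta> =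
     of_real pi ^ 3 * exp ((13/2 - 6 * \<upsilon>) * of_real (ln 2)) * w powr (2 * \<upsilon>) * mellin_kernel \<upsilon> w y (- (4 * \<zeta>))"
proof -
  let ?e = "\<lambda>a. exp (a * of_real (ln 2)) :: complex"
  define u where "u = \<upsilon> / 4 + \<zeta>"
  have args: "1 - (8 - 2*\<upsilon>)/8 + \<zeta> = u" "1 - (7 - 2*\<upsilon>)/8 + \<zeta> = u + 1/8" "1 - (6 - 2*\<upsilon>)/8 + \<zeta> = u + 1/4"
    "1 - (5 - 2*\<upsilon>)/8 + \<zeta> = u + 3/8" "1 - (4 - 2*\<upsilon>)/8 + \<zeta> = u + 1/2" "1 - (3 - 2*\<upsilon>)/8 + \<zeta> = u + 5/8"
    "1 - (2 - 2*\<upsilon>)/8 + \<zeta> = u + 3/4" "1 - (1 - 2*\<upsilon>)/8 + \<zeta> = u + 7/8"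
    "0 - \<zeta> = - \<zeta>" "1/2 - \<zeta> = - \<zeta> + 1/2" "1 - 1/4 + \<zeta> = 1/4 + \<zeta> + 1/2" "1 - 3/4 + \<zeta> = 1/4 + \<zeta>"
    by (simp_all add: u_def field_simps)
  have u8: "8 * u = 2 * (\<upsilon> - (- (4 * \<zeta>)))" by (simp add: u_def algebra_simps)
  have o: "off_cut (- (2 * \<zeta>))" using assms(1) by (auto simp: off_cut_def)
  have den: "Gamma (1/4 + \<zeta>) * Gamma (1/4 + \<zeta> + 1/2) = ?e (1/2 - 2 * \<zeta>) * of_real (sqrt pi) * Gamma (1/2 + 2 * \<zeta>)"
    using Gamma_duplication_off_cut[OF assms(3)] by (simp add: algebra_simps)
  have num: "Gamma (- \<zeta>) * Gamma (- \<zeta> + 1/2) = ?e (1 + 2 * \<zeta>) * of_real (sqrt pi) * Gamma (- (2 * \<zeta>))"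
    using Gamma_duplication_off_cut[OF assms(1)] by simp
  have "Gamma (- \<zeta>) * Gamma (- \<zeta> + 1/2) / (Gamma (1/4 + \<zeta>) * Gamma (1/4 + \<zeta> + 1/2)) =
      ?e (1/2 + 4 * \<zeta>) * (Gamma (- (2 * \<zeta>)) / Gamma (1/2 + 2 * \<zeta>))"
  proof -
    have "?e (1 + 2 * \<zeta>) = ?e (1/2 + 4 * \<zeta>) * ?e (1/2 - 2 * \<zeta>)"
      unfolding exp_add[symmetric] by (rule arg_cong[of _ _ exp]) (simp add: algebra_simps)
    thus ?thesis unfolding num den by simp
  qed
  also have "Gamma (- (2 * \<zeta>)) / Gamma (1/2 + 2 * \<zeta>) =
      of_real (1 / sqrt pi) * ?e (1 + 2 * (2 * \<zeta>)) * Gamma (- 2 * (2 * \<zeta>)) * cos (of_real pi * (2 * \<zeta>))"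
    by (rule Gamma_quotient_cos[OF o])
  finally have quot: "Gamma (- \<zeta>) * Gamma (- \<zeta> + 1/2) / (Gamma (1/4 + \<zeta>) * Gamma (1/4 + \<zeta> + 1/2)) =
      ?e (1/2 + 4 * \<zeta>) * (of_real (1 / sqrt pi) * ?e (1 + 2 * (2 * \<zeta>)) * Gamma (- 2 * (2 * \<zeta>)) * cos (of_real pi * (2 * \<zeta>)))" .
  have "meijer_integrand [(8 - 2*\<upsilon>)/8, (7 - 2*\<upsilon>)/8, (6 - 2*\<upsilon>)/8, (5 - 2*\<upsilon>)/8,
                   (4 - 2*\<upsilon>)/8, (3 - 2*\<upsilon>)/8, (2 - 2*\<upsilon>)/8, (1 - 2*\<upsilon>)/8] [] [0, 1/2] [1/4, 3/4]
           (log_quot (4^8 * y^4) w 8) \<zeta> =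
     (Gamma (- \<zeta>) * Gamma (- \<zeta> + 1/2) / (Gamma (1/4 + \<zeta>) * Gamma (1/4 + \<zeta> + 1/2))) *
     (Gamma u * Gamma (u + 1/8) * Gamma (u + 1/4) * Gamma (u + 3/8) *
      Gamma (u + 1/2) * Gamma (u + 5/8) * Gamma (u + 3/4) * Gamma (u + 7/8)) *
     exp (\<zeta> * log_quot (2 ^ 16 * y^4) w 8)"
    unfolding meijer_integrand_def list.map prod_list.Cons prod_list.Nil args by (simp add: mult_ac)
  also have "\<dots> = (of_real (1 / sqrt pi) * of_real (pi ^ 3 * sqrt pi)) *
       (?e (1/2 + 4 * \<zeta>) * ?e (1 + 2 * (2 * \<zeta>)) * ?e (5 - 24 * u) * ?e (of_nat 16 * \<zeta>)) * w powr (- (of_nat 8 * \<zeta>)) *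
       (Gamma (- 2 * (2 * \<zeta>)) * cos (of_real pi * (2 * \<zeta>)) * of_real y powr (of_nat 4 * \<zeta>) * Gamma (8 * u))"
    unfolding quot Gamma_octuplication[OF assms(2)[folded u_def]]
      exp_log_quot_mult[OF assms(4,5)] by (simp only: mult_ac)
  also have "?e (1/2 + 4 * \<zeta>) * ?e (1 + 2 * (2 * \<zeta>)) * ?e (5 - 24 * u) * ?e (of_nat 16 * \<zeta>) = ?e (13/2 - 6 * \<upsilon>)"
    unfolding exp_add[symmetric] by (rule arg_cong[of _ _ exp]) (simp add: u_def algebra_simps)
  also have "complex_of_real (1 / sqrt pi) * of_real (pi ^ 3 * sqrt pi) = of_real pi ^ 3"
    unfolding of_real_mult[symmetric] of_real_power[symmetric] by simp
  also have "w powr (- (of_nat 8 * \<zeta>)) = w powr (2 * \<upsilon>) * w powr (- (2 * (\<upsilon> - (- (4 * \<zeta>)))))"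
    unfolding powr_add[symmetric] by (simp add: algebra_simps)
  finally show ?thesis
    unfolding mellin_kernel_def u8 by (simp add: mult_ac)
qed

text \<open>Agreement with the kernel is asked for only at large imaginary parts, because the
  multiplication formulas are available only off the cuts.\<close>

lemma kernel_vanishes_vertically:
  assumes "Re w > 0" "y > 0" "m > 0"
    and f: "\<And>\<zeta>. \<bar>Im \<zeta>\<bar> \<ge> R \<Longrightarrow> f \<zeta> = K * mellin_kernel \<upsilon> w y (- (of_real m * \<zeta>))"
  shows "vanishes_vertically f"
  unfolding vanishes_vertically_def
proof (intro allI impI)
  fix a b e :: real assume e: "e > 0"
  obtain C h R' where C: "h > 0"
    "\<And>s. - m * b \<le> Re s \<Longrightarrow> Re s \<le> - m * a \<Longrightarrow> \<bar>Im s\<bar> \<ge> R' \<Longrightarrow> norm (mellin_kernel \<upsilon> w y s) \<le> C * exp (- h * \<bar>Im s\<bar>)"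
    using mellin_kernel_decay[OF assms(1,2)] by metis
  have "filterlim (\<lambda>T. - (h * m) * T) at_bot at_top"
    using filterlim_tendsto_pos_mult_at_top[OF tendsto_const _ filterlim_ident, of "h * m"] C(1) assms(3)
    by (simp add: filterlim_uminus_at_bot)
  hence "((\<lambda>T. exp (- (h * m) * T)) \<longlongrightarrow> 0) at_top"
    by (rule filterlim_compose[OF exp_at_bot])
  hence "((\<lambda>T. norm K * C * exp (- (h * m) * T)) \<longlongrightarrow> norm K * C * 0) at_top"
    by (intro tendsto_intros)
  hence "\<forall>\<^sub>F T in at_top. norm K * C * exp (- (h * m) * T) < e"
    using e by (intro order_tendstoD(2)[of _ 0]) auto
  then obtain T where T: "\<And>t. t \<ge> T \<Longrightarrow> norm K * C * exp (- (h * m) * t) < e"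
    by (auto simp: eventually_at_top_linorder)
  have "norm (f \<zeta>) \<le> e" if \<zeta>: "a \<le> Re \<zeta>" "Re \<zeta> \<le> b" "\<bar>Im \<zeta>\<bar> \<ge> max (max R T) (R' / m)" for \<zeta>
  proof -
    have "R' \<le> m * \<bar>Im \<zeta>\<bar>" using \<zeta>(3) assms(3) by (simp add: pos_divide_le_eq mult.commute)
    hence "norm (mellin_kernel \<upsilon> w y (- (of_real m * \<zeta>))) \<le> C * exp (- h * \<bar>Im (- (of_real m * \<zeta>))\<bar>)"
      using \<zeta> assms(3) by (intro C) (auto simp: abs_mult)
    hence "norm (f \<zeta>) \<le> norm K * (C * exp (- h * \<bar>Im (- (of_real m * \<zeta>))\<bar>))"
      using f[of \<zeta>] \<zeta>(3) by (simp add: norm_mult mult_left_mono)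
    also have "\<dots> = norm K * C * exp (- (h * m) * \<bar>Im \<zeta>\<bar>)" using assms(3) by (simp add: abs_mult)
    also have "\<dots> < e" using \<zeta> by (intro T) auto
    finally show ?thesis by simp
  qed
  thus "\<exists>T. \<forall>s. a \<le> Re s \<and> Re s \<le> b \<and> T \<le> \<bar>Im s\<bar> \<longrightarrow> norm (f s) \<le> e" by blast
qed

text \<open>The map \<open>s = - m * \<zeta>\<close> carries the line at \<open>- c / m\<close> to
  the line at \<open>c\<close> and reverses it; the integral over the whole line picks up only the
  factor \<open>1 / m\<close>.\<close>

lemma kernel_line_integral:
  assumes "integrable lborel (\<lambda>t. mellin_kernel \<upsilon> w y (Complex c t))" "m > 0"
    and f: "\<And>t. f (Complex (- c / m) t) = K * mellin_kernel \<upsilon> w y (- (of_real m * Complex (- c / m) t))"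
  shows "integrable lborel (\<lambda>t. f (Complex (- c / m) t))"
    "(LINT t|lborel. f (Complex (- c / m) t)) = K / of_real m * (LINT t|lborel. mellin_kernel \<upsilon> w y (Complex c t))"
proof -
  have "- (of_real m * Complex (- c / m) t) = Complex c (0 + (- m) * t)" for t
    using assms(2) by (simp add: complex_eq_iff)
  hence feq: "f (Complex (- c / m) t) = K * mellin_kernel \<upsilon> w y (Complex c (0 + (- m) * t))" for t
    by (simp only: f)
  have i: "integrable lborel (\<lambda>t. mellin_kernel \<upsilon> w y (Complex c (0 + (- m) * t)))"
    using assms by (intro lborel_integrable_real_affine) auto
  thus "integrable lborel (\<lambda>t. f (Complex (- c / m) t))"
    unfolding feq by (rule integrable_mult_right)
  have "(LINT t|lborel. mellin_kernel \<upsilon> w y (Complex c t)) =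
      \<bar>- m\<bar> *\<^sub>R (LINT t|lborel. mellin_kernel \<upsilon> w y (Complex c (0 + (- m) * t)))"
    using assms by (intro lborel_integral_real_affine) auto
  thus "(LINT t|lborel. f (Complex (- c / m) t)) = K / of_real m * (LINT t|lborel. mellin_kernel \<upsilon> w y (Complex c t))"
    unfolding feq integral_mult_right_zero using assms(2) by (simp add: scaleR_conv_of_real)
qed

section \<open>The cosine transforms as Meijer functions\<close>

definition cosine_laplace :: "complex \<Rightarrow> complex \<Rightarrow> real \<Rightarrow> complex" where
  "cosine_laplace \<upsilon> w y =
     (LINT x:{0<..}|lborel. complex_of_real x powr (\<upsilon> - 1) * exp (- w * of_real (sqrt x)) * of_real (cos (x * y)))"

lemma cosine_laplace_eq_kernel_integral:
  assumes "Re w > 0" "y > 0" "0 < c" "c < 1" "c < Re \<upsilon>"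
  shows "cosine_laplace \<upsilon> w y = 1 / of_real pi * (LINT t|lborel. mellin_kernel \<upsilon> w y (Complex c t))"
  using cosine_laplace_sqrt(2)[OF assms] by (simp add: cosine_laplace_def set_lebesgue_integral_def)

lemma meijer_four:
  assumes "Re w > 0" "y > 0" "0 < c" "c < 1" "c < Re \<upsilon>"
  shows "meijer_line [(4 - 2*\<upsilon>)/4, (3 - 2*\<upsilon>)/4, (2 - 2*\<upsilon>)/4, (1 - 2*\<upsilon>)/4] [] [0] [1/2] (log_quot (64 * y^2) w 4) (- c / 2)"
    "meijer_G [(4 - 2*\<upsilon>)/4, (3 - 2*\<upsilon>)/4, (2 - 2*\<upsilon>)/4, (1 - 2*\<upsilon>)/4] [] [0] [1/2] (log_quot (64 * y^2) w 4) =
      of_real pi * exp ((3/2 - 4 * \<upsilon>) * of_real (ln 2)) * w powr (2 * \<upsilon>) * cosine_laplace \<upsilon> w y"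
proof -
  let ?f = "meijer_integrand [(4 - 2*\<upsilon>)/4, (3 - 2*\<upsilon>)/4, (2 - 2*\<upsilon>)/4, (1 - 2*\<upsilon>)/4] [] [0] [1/2] (log_quot (64 * y^2) w 4)"
  define K where "K = of_real pi * exp ((7/2 - 4 * \<upsilon>) * of_real (ln 2)) * w powr (2 * \<upsilon>)"
  have w0: "w \<noteq> 0" using assms by auto
  have f: "?f \<zeta> = K * mellin_kernel \<upsilon> w y (- (of_real 2 * \<zeta>))"
    if "off_cut (- \<zeta>)" "off_cut (\<upsilon> / 2 + \<zeta>)" for \<zeta>
    using meijer_integrand_four[OF that assms(2) w0] by (simp add: K_def)
  have v: "vanishes_vertically ?f"
  proof (rule kernel_vanishes_vertically[OF assms(1,2)])
    fix \<zeta> assume "\<bar>Im \<zeta>\<bar> \<ge> \<bar>Im \<upsilon>\<bar> + 1"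
    thus "?f \<zeta> = K * mellin_kernel \<upsilon> w y (- (of_real 2 * \<zeta>))"
      by (intro f) (auto simp: off_cut_def)
  qed simp
  have l: "?f (Complex (- c / 2) t) = K * mellin_kernel \<upsilon> w y (- (of_real 2 * Complex (- c / 2) t))" for t
    using assms by (intro f) (auto simp: off_cut_def)
  note i = kernel_line_integral[OF cosine_laplace_sqrt(1)[OF assms] _ l]
  show line: "meijer_line [(4 - 2*\<upsilon>)/4, (3 - 2*\<upsilon>)/4, (2 - 2*\<upsilon>)/4, (1 - 2*\<upsilon>)/4] [] [0] [1/2] (log_quot (64 * y^2) w 4) (- c / 2)"
    unfolding meijer_line_def using v i(1) assms by (auto simp: field_simps)
  \<comment> \<open>The factor 4 absorbs the \<open>1 / 2\<close> from the change of variable and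
    the \<open>1 / 2\<close> between the normalisations \<open>1 / (2 * pi)\<close> of
    \<open>meijer_G\<close> and \<open>1 / pi\<close> of the cosine transform.\<close>
  have "exp ((7/2 - 4 * \<upsilon>) * of_real (ln 2)) = 4 * exp ((3/2 - 4 * \<upsilon>) * complex_of_real (ln 2))"
  proof -
    have "exp ((7/2 - 4 * \<upsilon>) * of_real (ln 2)) = exp (2 * of_real (ln 2)) * exp ((3/2 - 4 * \<upsilon>) * complex_of_real (ln 2))"
      unfolding exp_add[symmetric] by (simp add: algebra_simps)
    also have "exp (2 * complex_of_real (ln 2)) = 4"
      by (simp add: exp_double exp_of_real flip: of_real_power)
    finally show ?thesis .
  qed
  thus "meijer_G [(4 - 2*\<upsilon>)/4, (3 - 2*\<upsilon>)/4, (2 - 2*\<upsilon>)/4, (1 - 2*\<upsilon>)/4] [] [0] [1/2] (log_quot (64 * y^2) w 4) =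
      of_real pi * exp ((3/2 - 4 * \<upsilon>) * of_real (ln 2)) * w powr (2 * \<upsilon>) * cosine_laplace \<upsilon> w y"
    unfolding meijer_G_line[OF line] cosine_laplace_eq_kernel_integral[OF assms]
    by (subst i(2)) (simp_all add: K_def)
qed

lemma meijer_eight:
  assumes "Re w > 0" "y > 0" "Re \<upsilon> > 0"
  shows "meijer_G [(8 - 2*\<upsilon>)/8, (7 - 2*\<upsilon>)/8, (6 - 2*\<upsilon>)/8, (5 - 2*\<upsilon>)/8,
                   (4 - 2*\<upsilon>)/8, (3 - 2*\<upsilon>)/8, (2 - 2*\<upsilon>)/8, (1 - 2*\<upsilon>)/8] [] [0, 1/2] [1/4, 3/4]
           (log_quot (4^8 * y^4) w 8) =
      of_real pi ^ 3 * exp ((7/2 - 6 * \<upsilon>) * of_real (ln 2)) * w powr (2 * \<upsilon>) * cosine_laplace \<upsilon> w y"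
proof -
  define c where "c = min 1 (Re \<upsilon>) / 2"
  have c: "0 < c" "c < 1" "c < Re \<upsilon>" using assms(3) by (auto simp: c_def)
  note a = assms(1,2) c
  let ?as = "[(8 - 2*\<upsilon>)/8, (7 - 2*\<upsilon>)/8, (6 - 2*\<upsilon>)/8, (5 - 2*\<upsilon>)/8,
                   (4 - 2*\<upsilon>)/8, (3 - 2*\<upsilon>)/8, (2 - 2*\<upsilon>)/8, (1 - 2*\<upsilon>)/8]"
  let ?f = "meijer_integrand ?as [] [0, 1/2] [1/4, 3/4] (log_quot (4^8 * y^4) w 8)"
  define K where "K = of_real pi ^ 3 * exp ((13/2 - 6 * \<upsilon>) * of_real (ln 2)) * w powr (2 * \<upsilon>)"
  have w0: "w \<noteq> 0" using assms by auto
  have f: "?f \<zeta> = K * mellin_kernel \<upsilon> w y (- (of_real 4 * \<zeta>))"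
    if "off_cut (- \<zeta>)" "off_cut (\<upsilon> / 4 + \<zeta>)" "off_cut (1 / 4 + \<zeta>)" for \<zeta>
    using meijer_integrand_eight[OF that assms(2) w0] by (simp add: K_def)
  have v: "vanishes_vertically ?f"
  proof (rule kernel_vanishes_vertically[OF assms(1,2)])
    fix \<zeta> assume "\<bar>Im \<zeta>\<bar> \<ge> \<bar>Im \<upsilon>\<bar> + 1"
    thus "?f \<zeta> = K * mellin_kernel \<upsilon> w y (- (of_real 4 * \<zeta>))"
      by (intro f) (auto simp: off_cut_def)
  qed simp
  \<comment> \<open>On this line \<open>1 / 4 + \<zeta>\<close> has real part
    \<open>(1 - c) / 4\<close>, so \<open>c < 1\<close> keeps it off the cut.\<close>
  have l: "?f (Complex (- c / 4) t) = K * mellin_kernel \<upsilon> w y (- (of_real 4 * Complex (- c / 4) t))" for t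
    using c by (intro f) (auto simp: off_cut_def)
  note i = kernel_line_integral[OF cosine_laplace_sqrt(1)[OF a] _ l]
  have line: "meijer_line ?as [] [0, 1/2] [1/4, 3/4] (log_quot (4^8 * y^4) w 8) (- c / 4)"
    unfolding meijer_line_def using v i(1) c by (auto simp: field_simps)
  \<comment> \<open>Here the change of variable contributes \<open>1 / 4\<close> and the
    normalisation \<open>1 / 2\<close>.\<close>
  have "exp ((13/2 - 6 * \<upsilon>) * of_real (ln 2)) = 8 * exp ((7/2 - 6 * \<upsilon>) * complex_of_real (ln 2))"
  proof -
    have "exp ((13/2 - 6 * \<upsilon>) * of_real (ln 2)) = exp (of_nat 3 * of_real (ln 2)) * exp ((7/2 - 6 * \<upsilon>) * complex_of_real (ln 2))"
      unfolding exp_add[symmetric] by (simp add: algebra_simps)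
    also have "exp (of_nat 3 * complex_of_real (ln 2)) = 8"
      unfolding exp_of_nat_mult by (simp add: exp_of_real flip: of_real_power)
    finally show ?thesis .
  qed
  thus ?thesis
    unfolding meijer_G_line[OF line] cosine_laplace_eq_kernel_integral[OF a]
    by (subst i(2)) (simp_all add: K_def)
qed

section \<open>The binomial expansion of the integrand\<close>

lemma one_minus_exp_nonzero:
  fixes u :: complex
  assumes "Re u > 0"
  shows "norm (exp (- u)) < 1" "1 - exp (- u) \<noteq> 0"
proof -
  show 1: "norm (exp (- u)) < 1" using assms by simp
  show "1 - exp (- u) \<noteq> 0"
  proof
    assume "1 - exp (- u) = 0"
    hence "norm (exp (- u)) = 1" by (metis eq_iff_diff_eq_0 norm_one)
    with 1 show False by simp
  qed
qed

lemma norm_inverse_exp_minus_one_pow: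
  "norm (1 / exp_minus_one_pow u l) = exp (- Re (l * u)) * exp (- Re (l * Ln (1 - exp (- u))))"
proof -
  have "1 / exp_minus_one_pow u l = exp (- (l * u) + - (l * Ln (1 - exp (- u))))"
    by (simp add: exp_minus_one_pow_def divide_inverse exp_minus[symmetric] distrib_left)
  thus ?thesis by (simp only: exp_add norm_mult norm_exp_eq_Re uminus_complex.sel)
qed

lemma norm_IC_integrand:
  assumes "x > 0"
  shows "norm (IC_integrand \<upsilon> b l y x) = x powr (Re \<upsilon> - 1) * \<bar>cos (x * y)\<bar> *
     (exp (- Re (l * b) * sqrt x) * exp (- Re (l * Ln (1 - exp (- (b * of_real (sqrt x)))))))"
proof -
  have "norm (IC_integrand \<upsilon> b l y x) = norm (complex_of_real x powr (\<upsilon> - 1)) * norm (complex_of_real (cos (x * y))) *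
      norm (1 / exp_minus_one_pow (b * of_real (sqrt x)) l)"
    by (simp add: IC_integrand_def norm_mult norm_divide)
  moreover have "- Re (l * (b * of_real (sqrt x))) = - Re (l * b) * sqrt x"
    by (simp add: algebra_simps)
  moreover have "norm (complex_of_real x powr (\<upsilon> - 1)) = x powr (Re \<upsilon> - 1)"
    using assms by (simp add: norm_powr_real_powr)
  ultimately show ?thesis
    by (simp only: norm_inverse_exp_minus_one_pow norm_of_real)
qed

section \<open>Integrability of the integrand forces \<open>Re (l * b) > 0\<close>\<close>

lemma inverse_shift_not_integrable:
  fixes a x0 :: real
  assumes "a \<ge> 0" "x0 > 0"
  shows "\<not> integrable lborel (\<lambda>x. indicator {x0..} x * (1 / (x + a)))"
proof
  let ?h = "\<lambda>x. indicator {x0..} x * (1 / (x + a)) :: real"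
  assume "integrable lborel ?h"
  hence I: "(?h has_integral (LINT x|lborel. ?h x)) UNIV" by (rule has_integral_integral_lborel)
  have le: "ln (n + a) - ln (x0 + a) \<le> (LINT x|lborel. ?h x)" if "n \<ge> x0" for n
  proof (rule has_integral_subset_le[OF _ _ I])
    have "((\<lambda>x. 1 / (x + a)) has_integral (ln (n + a) - ln (x0 + a))) {x0..n}"
      using that assms
      by (intro fundamental_theorem_of_calculus)
         (auto intro!: derivative_eq_intros simp flip: has_real_derivative_iff_has_vector_derivative)
    thus "(?h has_integral (ln (n + a) - ln (x0 + a))) {x0..n}"
      by (rule has_integral_eq[rotated]) auto
  qed (use assms in \<open>auto simp: indicator_def\<close>)
  \<comment> \<open>All logarithms \<open>ln (n + a)\<close> with \<open>n \<ge> x0\<close> would be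
    at most \<open>K\<close>; the choice \<open>n = exp (K + 1) + x0\<close> exceeds that
    bound.\<close>
  define K where "K = (LINT x|lborel. ?h x) + ln (x0 + a)"
  have "ln (exp (K + 1) + x0 + a) \<le> K"
    using le[of "exp (K + 1) + x0"] by (simp add: K_def)
  moreover have "ln (exp (K + 1)) \<le> ln (exp (K + 1) + x0 + a)"
    using assms by (intro ln_mono) (auto intro: add_pos_nonneg)
  ultimately show False by simp
qed

text \<open>Since \<open>\<bar>cos\<bar> + \<bar>sin\<bar> \<ge> 1\<close>, a function dominating \<open>\<bar>cos (x * y)\<bar> / x\<close> plus its translate by a
  quarter period dominates \<open>1 / (x + \<pi> / (2 y))\<close>.\<close>

lemma abs_cos_over_x_not_integrable:
  fixes y x0 :: real
  assumes "y > 0" "x0 > 0"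
  shows "\<not> integrable lborel (\<lambda>x. indicator {x0..} x * (\<bar>cos (x * y)\<bar> / x))"
proof
  let ?g = "\<lambda>x. indicator {x0..} x * (\<bar>cos (x * y)\<bar> / x) :: real"
  define a where "a = pi / (2 * y)"
  have a: "a > 0" using assms by (simp add: a_def)
  assume g: "integrable lborel ?g"
  hence "integrable lborel (\<lambda>x. ?g (a + 1 * x))"
    by (intro lborel_integrable_real_affine) auto
  with g have "integrable lborel (\<lambda>x. ?g x + ?g (a + 1 * x))" by (rule Bochner_Integration.integrable_add)
  hence "integrable lborel (\<lambda>x. indicator {x0..} x * (1 / (x + a)))"
  proof (rule Bochner_Integration.integrable_bound)
    show "AE x in lborel. norm (indicator {x0..} x * (1 / (x + a))) \<le> norm (?g x + ?g (a + 1 * x))"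
    proof (rule AE_I2)
      fix x :: real
      show "norm (indicator {x0..} x * (1 / (x + a))) \<le> norm (?g x + ?g (a + 1 * x))"
      proof (cases "x \<ge> x0")
        case True
        have "(a + x) * y = x * y + pi / 2" using assms by (simp add: a_def field_simps)
        hence c: "\<bar>cos ((a + x) * y)\<bar> = \<bar>sin (x * y)\<bar>" by (simp add: cos_add)
        have "1 = (cos (x * y))\<^sup>2 + (sin (x * y))\<^sup>2" by simp
        also have "\<dots> \<le> \<bar>cos (x * y)\<bar> + \<bar>sin (x * y)\<bar>"
          using abs_cos_le_one[of "x * y"] abs_sin_le_one[of "x * y"]
          by (intro add_mono) (metis abs_ge_zero mult_left_le power2_abs power2_eq_square)+
        finally have "1 / (x + a) \<le> (\<bar>cos (x * y)\<bar> + \<bar>sin (x * y)\<bar>) / (x + a)"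
          using True assms a by (intro divide_right_mono) auto
        also have "\<dots> = \<bar>cos (x * y)\<bar> / (x + a) + \<bar>sin (x * y)\<bar> / (x + a)" by (rule add_divide_distrib)
        also have "\<bar>cos (x * y)\<bar> / (x + a) \<le> \<bar>cos (x * y)\<bar> / x"
          using True assms a by (intro divide_left_mono) auto
        finally show ?thesis using True assms a c by (simp add: add.commute)
      qed auto
    qed
  qed auto
  thus False using inverse_shift_not_integrable[of a x0] a assms by auto
qed

text \<open>Otherwise \<open>exp (- Re (l * b) * sqrt x) \<ge> 1\<close>. For large \<open>x\<close>
  the factor from \<open>1 - exp (- u)\<close> is at least \<open>exp (- norm l)\<close>, and the
  power of \<open>x\<close> is at least \<open>1 / x\<close>, so a constant multiple of the
  integrand would dominate \<open>\<bar>cos (x * y)\<bar> / x\<close>.\<close>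

lemma IC_integrable_imp_Re_pos:
  assumes "Re \<upsilon> > 0" "y > 0" "Re b > 0"
    and int: "set_integrable lborel {0<..} (IC_integrand \<upsilon> b l y)"
  shows "Re (l * b) > 0"
proof (rule ccontr)
  assume neg: "\<not> Re (l * b) > 0"
  \<comment> \<open>Beyond \<open>x0\<close> one has \<open>Re b * sqrt x \<ge> 2\<close>, hence
    \<open>norm q \<le> exp (- 2) < 1 / 2\<close>, which is the range of the estimate of
    \<open>Ln (1 - q)\<close> by twice \<open>norm q\<close>.\<close>
  define x0 where "x0 = max 1 ((2 / Re b)\<^sup>2)"
  have x0: "x0 > 0" by (simp add: x0_def)
  have "integrable lborel (\<lambda>x. exp (norm l) *\<^sub>R (indicator {0<..} x *\<^sub>R IC_integrand \<upsilon> b l y x))"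
    using int unfolding set_integrable_def by (rule integrable_scaleR_right)
  hence "integrable lborel (\<lambda>x. indicator {x0..} x * (\<bar>cos (x * y)\<bar> / x))"
  proof (rule Bochner_Integration.integrable_bound)
    show "AE x in lborel. norm (indicator {x0..} x * (\<bar>cos (x * y)\<bar> / x)) \<le>
        norm (exp (norm l) *\<^sub>R (indicator {0<..} x *\<^sub>R IC_integrand \<upsilon> b l y x))"
    proof (rule AE_I2)
      fix x :: real
      show "norm (indicator {x0..} x * (\<bar>cos (x * y)\<bar> / x)) \<le>
        norm (exp (norm l) *\<^sub>R (indicator {0<..} x *\<^sub>R IC_integrand \<upsilon> b l y x))"
      proof (cases "x \<ge> x0")
        case True
        have x: "x \<ge> 1" "x > 0" using True by (auto simp: x0_def)
        define q where "q = exp (- (b * of_real (sqrt x)))"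
        have "(2 / Re b)\<^sup>2 \<le> x" using True by (simp add: x0_def)
        hence "2 / Re b \<le> sqrt x" by (rule real_le_rsqrt)
        hence "2 \<le> Re b * sqrt x" using assms(3) by (simp add: field_simps)
        moreover have "norm q = exp (- (Re b * sqrt x))" by (simp add: q_def)
        ultimately have "norm q \<le> exp (- 2)" by simp
        also have "exp (- 2) < (1 / 2 :: real)"
          using exp_ge_add_one_self[of "2::real"] by (simp add: exp_minus field_simps)
        finally have q: "norm q < 1 / 2" .
        hence "norm (Ln (1 - q)) \<le> 1" using norm_Ln_le[of "- q"] by simp
        hence "norm (l * Ln (1 - q)) \<le> norm l * 1" unfolding norm_mult by (intro mult_left_mono) auto
        hence "Re (l * Ln (1 - q)) \<le> norm l" using complex_Re_le_cmod[of "l * Ln (1 - q)"] by linarith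
        hence 1: "exp (- norm l) \<le> exp (- Re (l * Ln (1 - q)))" by simp
        have "Re (l * b) * sqrt x \<le> 0" using neg x by (intro mult_nonpos_nonneg) auto
        hence 2: "1 \<le> exp (- Re (l * b) * sqrt x)"
          by (simp only: one_le_exp_iff mult_minus_left neg_0_le_iff_le)
        have 3: "1 / x \<le> x powr (Re \<upsilon> - 1)"
          using powr_mono[of "-1" "Re \<upsilon> - 1" x] x assms(1) by (simp add: powr_minus divide_inverse)
        have "1 / x * \<bar>cos (x * y)\<bar> * (1 * exp (- norm l)) \<le> x powr (Re \<upsilon> - 1) * \<bar>cos (x * y)\<bar> *
            (exp (- Re (l * b) * sqrt x) * exp (- Re (l * Ln (1 - q))))"
          using 1 2 3 x by (intro mult_mono mult_right_mono mult_nonneg_nonneg) auto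
        also have "\<dots> = norm (IC_integrand \<upsilon> b l y x)"
          unfolding q_def norm_IC_integrand[OF x(2)] ..
        finally show ?thesis using True x x0 by (simp add: exp_minus field_simps)
      qed auto
    qed
  qed auto
  with abs_cos_over_x_not_integrable[OF assms(2) x0] show False by contradiction
qed

text \<open>The quotient of the two sides' Pochhammer symbols converges: it is a quotient of terms
  of \<open>rGamma_series\<close>, in which the powers of \<open>n\<close> with exponents
  \<open>l\<close> and \<open>Re l\<close> have equal modulus. A convergent sequence is
  bounded.\<close>

lemma norm_pochhammer_le:
  fixes l :: complex
  assumes "Re l > 0"
  obtains C where "C > 0" "\<And>n. norm (pochhammer l n) \<le> C * pochhammer (Re l) n"
proof -
  let ?r = "complex_of_real (Re l)"
  have "rGamma ?r \<noteq> 0" using notin_nonpos_Ints_Re_pos[of ?r] assms by (simp add: rGamma_eq_zero_iff)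
  hence "(\<lambda>n. norm (rGamma_series l n) / norm (rGamma_series ?r n)) \<longlonglongrightarrow> norm (rGamma l) / norm (rGamma ?r)"
    by (intro tendsto_intros) auto
  hence "Bseq (\<lambda>n. norm (rGamma_series l n) / norm (rGamma_series ?r n))"
    by (rule convergent_imp_Bseq[OF convergentI])
  then obtain K where K: "\<And>n. norm (norm (rGamma_series l n) / norm (rGamma_series ?r n)) \<le> K"
    by (auto simp: Bseq_def)
  have quot: "norm (rGamma_series l n) / norm (rGamma_series ?r n) = norm (pochhammer l (Suc n)) / pochhammer (Re l) (Suc n)" for n
  proof -
    have "pochhammer (Re l) (Suc n) > 0" using assms by (rule pochhammer_pos)
    moreover have "norm (pochhammer ?r (Suc n)) = \<bar>pochhammer (Re l) (Suc n)\<bar>"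
      by (simp only: pochhammer_of_real norm_of_real)
    moreover have "norm (exp (l * complex_of_real (ln (real n)))) = norm (exp (?r * complex_of_real (ln (real n))))"
      by simp
    ultimately show ?thesis
      by (simp only: rGamma_series_def norm_divide norm_mult Suc_eq_plus1 of_real_of_nat_eq) simp
  qed
  show ?thesis
  proof (rule that)
    show "max 1 K > 0" by simp
    fix n
    show "norm (pochhammer l n) \<le> max 1 K * pochhammer (Re l) n"
    \<comment> \<open>The series \<open>rGamma_series\<close> at index \<open>m\<close> contains the
      Pochhammer symbol of length \<open>Suc m\<close>; length 0 is covered by the 1 in the
      maximum.\<close>
    proof (cases n)
      case (Suc m)
      have p: "pochhammer (Re l) n > 0" using assms by (rule pochhammer_pos)
      have "norm (pochhammer l n) / pochhammer (Re l) n \<le> K"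
        using order_trans[OF abs_ge_self K[of m, unfolded real_norm_def quot]] Suc by simp
      also have "K \<le> max 1 K" by simp
      finally show ?thesis using p by (simp add: pos_divide_le_eq)
    qed auto
  qed
qed

lemma pochhammer_sum_le_powr:
  fixes r s :: real
  assumes "r > 0" "0 \<le> s" "s < 1"
  shows "(\<Sum>k<N. pochhammer r k / fact k * s ^ k) \<le> (1 - s) powr (- r)"
proof -
  have "(\<lambda>k. (- r gchoose k) * (- s) ^ k) sums (1 + - s) powr (- r)"
    using assms by (intro gen_binomial_real) auto
  also have "(\<lambda>k. (- r gchoose k) * (- s) ^ k) = (\<lambda>k. pochhammer r k / fact k * s ^ k)"
    by (auto simp: gbinomial_pochhammer power_minus[of s] fun_eq_iff)
  finally have "(\<lambda>k. pochhammer r k / fact k * s ^ k) sums (1 - s) powr (- r)" by simp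
  thus ?thesis
    using assms pochhammer_nonneg[OF assms(1)]
    by (subst sums_unique) (auto intro!: sum_le_suminf sums_summable)
qed

text \<open>The branch chosen in \<open>exp_minus_one_pow\<close> is the one for which the power is
  \<open>exp (- l * u)\<close> times a principal power of \<open>1 - exp (- u)\<close>, and the
  latter has the binomial series.\<close>

lemma inverse_exp_minus_one_pow_sums:
  assumes "Re u > 0"
  shows "(\<lambda>k. pochhammer l k / fact k * exp (- (l + of_nat k) * u)) sums (1 / exp_minus_one_pow u l)"
proof -
  define q where "q = exp (- u)"
  have q: "norm q < 1" "1 - q \<noteq> 0" using one_minus_exp_nonzero[OF assms] by (auto simp: q_def)
  have "(\<lambda>k. (- l gchoose k) * (- q) ^ k) sums (1 + - q) powr (- l)"
    using q by (intro gen_binomial_complex) auto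
  hence "(\<lambda>k. exp (- l * u) * ((- l gchoose k) * (- q) ^ k)) sums (exp (- l * u) * (1 + - q) powr (- l))"
    by (rule sums_mult)
  also have "(\<lambda>k. exp (- l * u) * ((- l gchoose k) * (- q) ^ k)) = (\<lambda>k. pochhammer l k / fact k * exp (- (l + of_nat k) * u))"
  proof
    fix k
    have "exp (- (l + of_nat k) * u) = exp (- l * u) * q ^ k"
      unfolding q_def exp_of_nat_mult[symmetric] exp_add[symmetric] by (simp add: algebra_simps)
    thus "exp (- l * u) * ((- l gchoose k) * (- q) ^ k) = pochhammer l k / fact k * exp (- (l + of_nat k) * u)"
      by (simp add: gbinomial_pochhammer power_minus[of q])
  qed
  also have "exp (- l * u) * (1 + - q) powr (- l) = 1 / exp_minus_one_pow u l"
    using q by (simp add: powr_def exp_minus_one_pow_def q_def exp_add[symmetric] distrib_left exp_minus[symmetric] divide_inverse)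
  finally show ?thesis .
qed

text \<open>Both sides are of order \<open>t\<close> near 0. On the left the derivative of
  \<open>exp\<close> is at most 1 in the left half-plane; on the right
  \<open>s \<le> (1 + s) * (1 - exp (- s))\<close> with \<open>s = Re b * t\<close>, where
  \<open>t \<le> 1\<close> bounds the first factor by \<open>1 + Re b\<close>.\<close>

lemma norm_one_minus_exp_le:
  fixes b :: complex
  assumes "Re b > 0" "0 < t" "t \<le> 1"
  shows "norm (1 - exp (- (b * of_real t))) \<le> norm b * (1 + Re b) / Re b * (1 - exp (- (Re b * t)))"
proof -
  have "norm (exp 0 - exp (- (b * of_real t))) \<le> 1 * norm (0 - (- (b * of_real t)))"
    using assms
    by (intro field_differentiable_bound[of "{z. Re z \<le> 0}" exp exp])
       (auto intro!: derivative_eq_intros convex_halfspace_Re_le)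
  hence 1: "norm (1 - exp (- (b * of_real t))) \<le> norm b * t" using assms by (simp add: norm_mult)
  let ?s = "Re b * t"
  have s: "?s > 0" using assms by simp
  have "?s \<le> (1 + ?s) * (1 - exp (- ?s))"
  proof -
    have "(1 + ?s) * exp (- ?s) \<le> exp ?s * exp (- ?s)" by (intro mult_right_mono exp_ge_add_one_self) auto
    thus ?thesis by (simp add: exp_minus algebra_simps)
  qed
  also have "\<dots> \<le> (1 + Re b) * (1 - exp (- ?s))"
    using assms s by (intro mult_right_mono) (auto simp: mult_left_le)
  finally have "norm b / Re b * ?s \<le> norm b / Re b * ((1 + Re b) * (1 - exp (- ?s)))"
    using assms by (intro mult_left_mono) auto
  thus ?thesis using 1 assms by simp
qed

text \<open>Absolute values inside the sum lead to
  \<open>(1 - exp (- Re b * t)) powr (- Re l)\<close> with \<open>t = sqrt x\<close>. For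
  \<open>t \<le> 1\<close> this is comparable to the modulus of the corresponding complex power, and
  with the cosine retained the bound is a multiple of the integrand. For larger \<open>t\<close> it
  is at most a constant, and the exponential factor gives the second summand.\<close>

lemma IC_partial_sum_bound:
  assumes "Re l > 0" "Re b > 0"
  shows "\<exists>A\<ge>0. \<exists>B\<ge>0. \<forall>x>0. \<forall>N.
     norm (\<Sum>k<N. pochhammer l k / fact k *
        (complex_of_real x powr (\<upsilon> - 1) * exp (- (l * b + b * of_nat k) * of_real (sqrt x)) * of_real (cos (x * y)))) \<le>
     A * norm (IC_integrand \<upsilon> b l y x) + B * (x powr (Re \<upsilon> - 1) * exp (- Re (l * b) * sqrt x))"
proof -
  obtain C where C: "C > 0" "\<And>n. norm (pochhammer l n) \<le> C * pochhammer (Re l) n"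
    using norm_pochhammer_le[OF assms(1)] by blast
  define M where "M = norm b * (1 + Re b) / Re b"
  have "norm b > 0" using assms(2) by auto
  hence M: "M > 0" using assms(2) by (simp add: M_def)
  \<comment> \<open>\<open>C\<close> passes from \<open>pochhammer l\<close> to
    \<open>pochhammer (Re l)\<close>, \<open>M\<close> compares the two values of one minus an
    exponential, and the last factor bounds the effect of \<open>Im l * Arg (1 - q)\<close> on the
    modulus of the complex power.\<close>
  define A where "A = C * (M powr Re l * exp (pi * \<bar>Im l\<bar>))"
  define B where "B = C * (1 - exp (- Re b)) powr (- Re l)"
  have AB: "A \<ge> 0" "B \<ge> 0" using C(1) by (auto simp: A_def B_def)
  show ?thesis
  proof (intro exI conjI allI impI AB)
    fix x :: real and N :: nat assume x: "x > 0"
    define t where "t = sqrt x"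
    have t: "t > 0" using x by (simp add: t_def)
    define s where "s = exp (- (Re b * t))"
    have s: "0 \<le> s" "s < 1" using t assms(2) by (auto simp: s_def)
    define q where "q = exp (- (b * of_real t))"
    define X where "X = x powr (Re \<upsilon> - 1) * \<bar>cos (x * y)\<bar>"
    have X: "X \<ge> 0" "X \<le> x powr (Re \<upsilon> - 1)"
      by (auto simp: X_def mult_left_le)
    define E where "E = exp (- Re (l * b) * t)"
    let ?g = "\<lambda>k. pochhammer l k / fact k *
        (complex_of_real x powr (\<upsilon> - 1) * exp (- (l * b + b * of_nat k) * of_real (sqrt x)) * of_real (cos (x * y)))"
    have norm_g: "norm (?g k) \<le> X * E * (C * (pochhammer (Re l) k / fact k * s ^ k))" for k
    proof -
      have "exp (- (l * b + b * of_nat k) * of_real t) = exp (- (l * b) * of_real t) * exp (of_nat k * (- (b * of_real t)))"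
        unfolding exp_add[symmetric] by (simp add: algebra_simps)
      moreover have "norm (exp (- (l * b) * of_real t)) = E"
        unfolding norm_exp_eq_Re E_def by (rule arg_cong[of _ _ exp]) (simp add: algebra_simps)
      moreover have "norm (exp (- (b * of_real t))) = s" by (simp add: s_def)
      ultimately have "norm (exp (- (l * b + b * of_nat k) * of_real t)) = E * s ^ k"
        by (simp only: exp_of_nat_mult norm_mult norm_power)
      hence "norm (?g k) = (norm (pochhammer l k) / fact k) * (X * (E * s ^ k))"
        using x by (simp add: norm_mult norm_divide X_def norm_powr_real_powr t_def[symmetric])
      also have "\<dots> \<le> (C * pochhammer (Re l) k / fact k) * (X * (E * s ^ k))"
        using C(2)[of k] X s by (intro mult_right_mono divide_right_mono) (auto simp: E_def)
      finally show ?thesis by (simp add: mult_ac)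
    qed
    have "norm (\<Sum>k<N. ?g k) \<le> (\<Sum>k<N. X * E * (C * (pochhammer (Re l) k / fact k * s ^ k)))"
      by (rule sum_norm_le) (rule norm_g)
    also have "\<dots> = X * E * (C * (\<Sum>k<N. pochhammer (Re l) k / fact k * s ^ k))"
      by (simp only: sum_distrib_left)
    also have "\<dots> \<le> X * E * (C * (1 - s) powr (- Re l))"
      using X C(1) pochhammer_sum_le_powr[OF assms(1) s, of N]
      by (intro mult_left_mono) (auto simp: E_def)
    finally have le: "norm (\<Sum>k<N. ?g k) \<le> X * E * (C * (1 - s) powr (- Re l))" .
    have IC0: "norm (IC_integrand \<upsilon> b l y x) = X * (E * exp (- Re (l * Ln (1 - q))))"
      unfolding norm_IC_integrand[OF x] X_def E_def q_def t_def ..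
    show "norm (\<Sum>k<N. ?g k) \<le> A * norm (IC_integrand \<upsilon> b l y x) + B * (x powr (Re \<upsilon> - 1) * exp (- Re (l * b) * sqrt x))"
    proof (cases "t \<le> 1")
      case True
      have q1: "1 - q \<noteq> 0" unfolding q_def using assms(2) t by (intro one_minus_exp_nonzero) auto
      have "norm (1 - q) / M \<le> 1 - s"
        using norm_one_minus_exp_le[OF assms(2) t True] M by (simp add: q_def s_def M_def[symmetric] pos_divide_le_eq mult.commute)
      hence "(1 - s) powr (- Re l) \<le> (norm (1 - q) / M) powr (- Re l)"
        using assms(1) M q1 by (intro powr_mono2') auto
      also have "\<dots> = M powr Re l * norm (1 - q) powr (- Re l)"
        using M q1 by (simp add: powr_divide powr_minus field_simps)
      finally have 1: "(1 - s) powr (- Re l) \<le> M powr Re l * norm (1 - q) powr (- Re l)" .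
      have "norm (1 - q) powr (- Re l) = exp (- Re (l * Ln (1 - q))) * exp (- (Im l * Arg (1 - q)))"
        using q1 by (simp add: powr_def Arg_eq_Im_Ln exp_add[symmetric])
      also have "\<dots> \<le> exp (- Re (l * Ln (1 - q))) * exp (pi * \<bar>Im l\<bar>)"
      proof (intro mult_left_mono)
        have "- (Im l * Arg (1 - q)) \<le> \<bar>Im l\<bar> * \<bar>Arg (1 - q)\<bar>" by (metis abs_ge_minus_self abs_mult)
        also have "\<dots> \<le> \<bar>Im l\<bar> * pi"
          using mpi_less_Arg[of "1 - q"] Arg_le_pi[of "1 - q"] by (intro mult_left_mono) auto
        finally show "exp (- (Im l * Arg (1 - q))) \<le> exp (pi * \<bar>Im l\<bar>)" by (simp add: mult.commute)
      qed auto
      finally have "M powr Re l * norm (1 - q) powr (- Re l) \<le>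
          M powr Re l * (exp (- Re (l * Ln (1 - q))) * exp (pi * \<bar>Im l\<bar>))"
        by (rule mult_left_mono) simp
      with 1 have "(1 - s) powr (- Re l) \<le> M powr Re l * (exp (- Re (l * Ln (1 - q))) * exp (pi * \<bar>Im l\<bar>))"
        by (rule order_trans)
      hence "X * E * (C * (1 - s) powr (- Re l)) \<le> X * E * (C * (M powr Re l * (exp (- Re (l * Ln (1 - q))) * exp (pi * \<bar>Im l\<bar>))))"
        using X C(1) by (intro mult_left_mono) (auto simp: E_def)
      also have "\<dots> = A * norm (IC_integrand \<upsilon> b l y x)" unfolding IC0 A_def by (simp only: mult_ac)
      finally have "norm (\<Sum>k<N. ?g k) \<le> A * norm (IC_integrand \<upsilon> b l y x)" using le by linarith
      moreover have "0 \<le> B * (x powr (Re \<upsilon> - 1) * exp (- Re (l * b) * sqrt x))" using AB by simp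
      ultimately show ?thesis by linarith
    next
      case False
      have "s \<le> exp (- Re b)" using False assms(2) by (simp add: s_def)
      hence "(1 - s) powr (- Re l) \<le> (1 - exp (- Re b)) powr (- Re l)"
        using assms s by (intro powr_mono2') auto
      hence "X * E * (C * (1 - s) powr (- Re l)) \<le> x powr (Re \<upsilon> - 1) * E * (C * (1 - exp (- Re b)) powr (- Re l))"
        using X C(1) by (intro mult_mono mult_nonneg_nonneg) (auto simp: E_def)
      also have "\<dots> = B * (x powr (Re \<upsilon> - 1) * exp (- Re (l * b) * sqrt x))"
        by (simp only: B_def E_def t_def mult_ac)
      finally have "norm (\<Sum>k<N. ?g k) \<le> B * (x powr (Re \<upsilon> - 1) * exp (- Re (l * b) * sqrt x))" using le by linarith
      moreover have "0 \<le> A * norm (IC_integrand \<upsilon> b l y x)" using AB by simp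
      ultimately show ?thesis by linarith
    qed
  qed (rule AB)+
qed

lemma IC_sums_cosine_laplace:
  assumes "Re \<upsilon> > 0" "Re l > 0" "Re b > 0" "Re (l * b) > 0"
    and int: "set_integrable lborel {0<..} (IC_integrand \<upsilon> b l y)"
  shows "(\<lambda>k. pochhammer l k / fact k * cosine_laplace \<upsilon> (l * b + b * of_nat k) y) sums IC \<upsilon> b l y"
proof -
  let ?w = "\<lambda>k. l * b + b * of_nat k"
  let ?g = "\<lambda>k x. pochhammer l k / fact k *
        (complex_of_real x powr (\<upsilon> - 1) * exp (- ?w k * of_real (sqrt x)) * of_real (cos (x * y)))"
  let ?G = "\<lambda>k x. indicator {0<..} x *\<^sub>R ?g k x"
  obtain A B where AB: "A \<ge> 0" "B \<ge> 0" "\<And>x N. x > 0 \<Longrightarrow> norm (\<Sum>k<N. ?g k x) \<le>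
     A * norm (IC_integrand \<upsilon> b l y x) + B * (x powr (Re \<upsilon> - 1) * exp (- Re (l * b) * sqrt x))"
    using IC_partial_sum_bound[OF assms(2,3), of \<upsilon> y] by blast
  have G: "?G k = (\<lambda>x. pochhammer l k / fact k *
     (indicator {0<..} x *\<^sub>R (complex_of_real x powr (\<upsilon> - 1) * exp (- ?w k * of_real (sqrt x))) * of_real (cos (x * y))))" for k
    by (auto simp: fun_eq_iff indicator_def)
  have int_g: "integrable lborel (?G k)" for k
    unfolding G
  proof (rule integrable_mult_right, rule Bochner_Integration.integrable_bound)
    have "Re (?w k) > 0" using assms by (simp add: add_pos_nonneg)
    thus "integrable lborel (\<lambda>x. indicator {0<..} x *\<^sub>R (complex_of_real x powr (\<upsilon> - 1) * exp (- ?w k * of_real (sqrt x))))"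
      using assms(1) by (intro integrable_laplace_sqrt)
    have "(\<lambda>x. complex_of_real (cos (x * y))) \<in> borel_measurable borel"
      by (intro borel_measurable_continuous_onI continuous_intros)
    thus "(\<lambda>x. indicator {0<..} x *\<^sub>R (complex_of_real x powr (\<upsilon> - 1) * exp (- ?w k * of_real (sqrt x))) * of_real (cos (x * y)))
        \<in> borel_measurable lborel" by simp
  next
    show "AE x in lborel. norm (indicator {0<..} x *\<^sub>R (complex_of_real x powr (\<upsilon> - 1) * exp (- ?w k * of_real (sqrt x))) * of_real (cos (x * y)))
       \<le> norm (indicator {0<..} x *\<^sub>R (complex_of_real x powr (\<upsilon> - 1) * exp (- ?w k * of_real (sqrt x))))"
      unfolding norm_mult norm_of_real by (intro AE_I2 mult_left_le) auto
  qed
  have int_IC: "integrable lborel (\<lambda>x. indicator {0<..} x *\<^sub>R IC_integrand \<upsilon> b l y x)"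
    using int by (simp add: set_integrable_def)
  have "(\<lambda>N. LINT x|lborel. (\<Sum>k<N. ?G k x)) \<longlonglongrightarrow> (LINT x|lborel. indicator {0<..} x *\<^sub>R IC_integrand \<upsilon> b l y x)"
  proof (rule integral_dominated_convergence)
    show "(\<lambda>x. indicator {0<..} x *\<^sub>R IC_integrand \<upsilon> b l y x) \<in> borel_measurable lborel"
      using int_IC by (rule borel_measurable_integrable)
    show "(\<lambda>x. \<Sum>k<N. ?G k x) \<in> borel_measurable lborel" for N
      using int_g by (intro borel_measurable_sum borel_measurable_integrable)
    show "integrable lborel (\<lambda>x. A * norm (indicator {0<..} x *\<^sub>R IC_integrand \<upsilon> b l y x) +
        B * (indicator {0<..} x * (x powr (Re \<upsilon> - 1) * exp (- Re (l * b) * sqrt x))))"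
      using integrable_laplace_sqrt_real[OF assms(1,4)]
      by (intro Bochner_Integration.integrable_add integrable_mult_right integrable_norm int_IC) (simp add: set_integrable_def)
    show "AE x in lborel. (\<lambda>N. \<Sum>k<N. ?G k x) \<longlonglongrightarrow> indicator {0<..} x *\<^sub>R IC_integrand \<upsilon> b l y x"
    proof (rule AE_I2)
      fix x :: real
      show "(\<lambda>N. \<Sum>k<N. ?G k x) \<longlonglongrightarrow> indicator {0<..} x *\<^sub>R IC_integrand \<upsilon> b l y x"
      proof (cases "x > 0")
        case True
        have "Re (b * of_real (sqrt x)) > 0" using True assms(3) by simp
        from sums_mult[OF inverse_exp_minus_one_pow_sums[OF this, of l], of "complex_of_real x powr (\<upsilon> - 1) * of_real (cos (x * y))"]
        have "(\<lambda>k. ?g k x) sums IC_integrand \<upsilon> b l y x"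
          by (simp add: IC_integrand_def algebra_simps)
        thus ?thesis using True by (simp add: sums_def)
      qed auto
    qed
    fix N
    show "AE x in lborel. norm (\<Sum>k<N. ?G k x) \<le> A * norm (indicator {0<..} x *\<^sub>R IC_integrand \<upsilon> b l y x) +
        B * (indicator {0<..} x * (x powr (Re \<upsilon> - 1) * exp (- Re (l * b) * sqrt x)))"
    proof (rule AE_I2)
      fix x :: real
      show "norm (\<Sum>k<N. ?G k x) \<le> A * norm (indicator {0<..} x *\<^sub>R IC_integrand \<upsilon> b l y x) +
        B * (indicator {0<..} x * (x powr (Re \<upsilon> - 1) * exp (- Re (l * b) * sqrt x)))"
      proof (cases "x > 0")
        case True
        hence ind: "indicator {0<..} x = (1 :: real)" by simp
        show ?thesis unfolding ind scaleR_one mult_1 by (rule AB(3)[OF True])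
      qed auto
    qed
  qed
  also have "(\<lambda>N. LINT x|lborel. (\<Sum>k<N. ?G k x)) = (\<lambda>N. \<Sum>k<N. LINT x|lborel. ?G k x)"
    using int_g by (intro ext Bochner_Integration.integral_sum) auto
  also have "(\<lambda>k. LINT x|lborel. ?G k x) = (\<lambda>k. pochhammer l k / fact k * cosine_laplace \<upsilon> (?w k) y)"
  proof
    fix k
    have "?G k = (\<lambda>x. pochhammer l k / fact k * (indicator {0<..} x *\<^sub>R
        (complex_of_real x powr (\<upsilon> - 1) * exp (- ?w k * of_real (sqrt x)) * of_real (cos (x * y)))))"
      by (auto simp: fun_eq_iff indicator_def)
    thus "(LINT x|lborel. ?G k x) = pochhammer l k / fact k * cosine_laplace \<upsilon> (?w k) y"
      by (simp only: integral_mult_right_zero cosine_laplace_def set_lebesgue_integral_def)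
  qed
  finally show ?thesis by (simp only: sums_def IC_def set_lebesgue_integral_def)
qed

section \<open>Assembly of the five series\<close>

lemma two_powr: "(2 :: complex) powr a = exp (a * of_real (ln 2))"
  using Ln_of_real[of 2] by (simp add: powr_def)

text \<open>Reduces each of the five series to the common one, with terms \<open>r / f * J\<close>.
  What is left to check each time is the identity \<open>c * (e * P) = p\<close> between the
  prefactor \<open>c\<close>, the translation factor \<open>e\<close>, the constant \<open>P\<close>
  and the power \<open>p\<close> of \<open>w k\<close>.\<close>

lemma weight_cancel:
  fixes c r f p P e J :: complex
  assumes "p \<noteq> 0" "c * (e * P) = p"
  shows "c * (r / (f * p) * (e * (P * J))) = r / f * J"
proof -
  have "c * (r / (f * p) * (e * (P * J))) = (c * (e * P)) / p * (r / f * J)" by (simp add: mult_ac)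
  thus ?thesis using assms by simp
qed

theorem theorem2:
  fixes \<upsilon> b l :: complex and y :: real
  assumes "Re \<upsilon> > 0" and "y > 0" and "Re l > 0" and "Re b > 0"
    and IC_exists: "set_integrable lborel {0<..} (IC_integrand \<upsilon> b l y)"
  defines w_def: "w \<equiv> \<lambda>k::nat. l * b + b * of_nat k"
    and rf_def: "rf \<equiv> \<lambda>k::nat. Gamma (l + of_nat k) / Gamma l"
  shows
    "(\<lambda>k. 2 powr (4 * \<upsilon> - 3/2) / of_real pi *
        (rf k / (fact k * w k powr (2 * \<upsilon>)) *
         meijer_G [(4 - 2*\<upsilon>)/4, (3 - 2*\<upsilon>)/4, (2 - 2*\<upsilon>)/4, (1 - 2*\<upsilon>)/4] [] [0] [1/2]
           (log_quot (64 * y^2) (w k) 4)))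
       sums IC \<upsilon> b l y
   \<and> (\<lambda>k. 2 powr (4 * \<upsilon>) * of_real (sqrt y) / of_real pi *
        (rf k / (fact k * w k powr (2 * \<upsilon> + 1)) *
         meijer_G [(3 - 2*\<upsilon>)/4, (2 - 2*\<upsilon>)/4, (1 - 2*\<upsilon>)/4, (- 2*\<upsilon>)/4] [] [-1/4] [1/4]
           (log_quot (64 * y^2) (w k) 4)))
       sums IC \<upsilon> b l y
   \<and> (\<lambda>k. 2 powr (4 * \<upsilon> - 9/2) / (of_real pi * of_real y) *
        (rf k / (fact k * w k powr (2 * \<upsilon> - 2)) *
         meijer_G [(6 - 2*\<upsilon>)/4, (5 - 2*\<upsilon>)/4, (4 - 2*\<upsilon>)/4, (3 - 2*\<upsilon>)/4] [] [1/2] [1]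
           (log_quot (64 * y^2) (w k) 4)))
       sums IC \<upsilon> b l y
   \<and> (\<lambda>k. of_real y * 2 powr (4 * \<upsilon> + 3/2) / of_real pi *
        (rf k / (fact k * w k powr (2 * \<upsilon> + 2)) *
         meijer_G [(2 - 2*\<upsilon>)/4, (1 - 2*\<upsilon>)/4, (- 2*\<upsilon>)/4, (- 1 - 2*\<upsilon>)/4] [] [-1/2] [0]
           (log_quot (64 * y^2) (w k) 4)))
       sums IC \<upsilon> b l y
   \<and> (\<lambda>k. 2 powr (6 * \<upsilon> - 7/2) / of_real pi ^ 3 *
        (rf k / (fact k * w k powr (2 * \<upsilon>)) *
         meijer_G [(8 - 2*\<upsilon>)/8, (7 - 2*\<upsilon>)/8, (6 - 2*\<upsilon>)/8, (5 - 2*\<upsilon>)/8,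
                   (4 - 2*\<upsilon>)/8, (3 - 2*\<upsilon>)/8, (2 - 2*\<upsilon>)/8, (1 - 2*\<upsilon>)/8] [] [0, 1/2] [1/4, 3/4]
           (log_quot (4^8 * y^4) (w k) 8)))
       sums IC \<upsilon> b l y"
proof -
  have lb: "Re (l * b) > 0" by (rule IC_integrable_imp_Re_pos[OF assms(1,2,4) IC_exists])
  have w: "Re (w k) > 0" for k using lb assms(4) by (simp add: w_def add_pos_nonneg)
  hence w0: "w k \<noteq> 0" for k by (metis less_irrefl zero_complex.sel(1))
  have "rf = pochhammer l"
    using pochhammer_Gamma[OF notin_nonpos_Ints_Re_pos[OF assms(3)]] by (simp add: rf_def fun_eq_iff)
  with IC_sums_cosine_laplace[OF assms(1,3,4) lb IC_exists]
  have sums: "(\<lambda>k. rf k / fact k * cosine_laplace \<upsilon> (w k) y) sums IC \<upsilon> b l y"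
    by (simp only: w_def)
  define c where "c = min 1 (Re \<upsilon>) / 2"
  have c: "0 < c" "c < 1" "c < Re \<upsilon>" using assms(1) by (auto simp: c_def)
  let ?as = "[(4 - 2*\<upsilon>)/4, (3 - 2*\<upsilon>)/4, (2 - 2*\<upsilon>)/4, (1 - 2*\<upsilon>)/4]"
  \<comment> \<open>The first four series belong to the translations \<rho> = 0, -1/4, 1/2 and
    -1/2.\<close>
  let ?G = "\<lambda>\<rho> k. meijer_G (map (\<lambda>x. x + of_real \<rho>) ?as) [] [of_real \<rho>] [1/2 + of_real \<rho>] (log_quot (64 * y^2) (w k) 4)"
  define P where "P = (\<lambda>k. of_real pi * exp ((3/2 - 4 * \<upsilon>) * of_real (ln 2)) * w k powr (2 * \<upsilon>))"
  define e where "e = (\<lambda>\<rho> k. exp (complex_of_real \<rho> * log_quot (64 * y^2) (w k) 4))"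
  have G4: "?G \<rho> k = e \<rho> k * (P k * cosine_laplace \<upsilon> (w k) y)" for \<rho> k
    using meijer_G_shift[OF meijer_four(1)[OF w assms(2) c], of \<rho> k] meijer_four(2)[OF w assms(2) c, of k]
    by (simp add: e_def P_def)
  \<comment> \<open>The translation factor is \<open>2 powr (6 * \<rho>) * y powr (2 * \<rho>) * w k
    powr (- 4 * \<rho>)\<close>, which accounts for the different powers of 2, \<open>y\<close> and
    \<open>w k\<close> in the first four series.\<close>
  have e_eq: "e \<rho> k = exp (6 * of_real \<rho> * of_real (ln 2) + 2 * of_real \<rho> * of_real (ln y) - 4 * of_real \<rho> * Ln (w k))" for \<rho> k
    using assms(2) w0[of k] ln_realpow[of 2 6] ln_realpow[of y 2]
    by (simp add: e_def log_quot_def ln_mult algebra_simps)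
  have "sqrt y = exp (ln y / 2)"
    using assms(2) by (simp add: powr_half_sqrt[symmetric] powr_def)
  hence sqrt_exp: "complex_of_real (sqrt y) = exp (of_real (ln y) / 2)"
    by (simp only: exp_of_real[symmetric] of_real_divide of_real_numeral)
  have "complex_of_real y = exp (of_real (ln y))"
    using assms(2) by (simp add: exp_of_real)
  note y_exp = sqrt_exp this
  have P_eq: "P k = of_real pi * exp ((3/2 - 4 * \<upsilon>) * of_real (ln 2) + 2 * \<upsilon> * Ln (w k))" for k
    using w0[of k] by (simp add: P_def powr_def exp_add)
  have w_powr: "w k powr a = exp (a * Ln (w k))" for a k using w0[of k] by (simp add: powr_def)
  have first: "2 powr (4 * \<upsilon> - 3/2) / of_real pi * (e 0 k * P k) = w k powr (2 * \<upsilon>)" for k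
    unfolding e_eq P_eq two_powr w_powr by (simp add: exp_add[symmetric] algebra_simps)
  have second: "2 powr (4 * \<upsilon>) * of_real (sqrt y) / of_real pi * (e (-1/4) k * P k) = w k powr (2 * \<upsilon> + 1)" for k
    unfolding e_eq P_eq two_powr w_powr y_exp by (simp add: exp_add[symmetric] algebra_simps)
  have third: "2 powr (4 * \<upsilon> - 9/2) / (of_real pi * of_real y) * (e (1/2) k * P k) = w k powr (2 * \<upsilon> - 2)" for k
    unfolding e_eq P_eq two_powr w_powr y_exp by (simp add: exp_add[symmetric] exp_diff[symmetric] algebra_simps)
  have fourth: "of_real y * 2 powr (4 * \<upsilon> + 3/2) / of_real pi * (e (-1/2) k * P k) = w k powr (2 * \<upsilon> + 2)" for k
    unfolding e_eq P_eq two_powr w_powr y_exp by (simp add: exp_add[symmetric] algebra_simps)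
  \<comment> \<open>The fifth series involves no translation; the factor 1 stands in its place to
    fit \<open>weight_cancel\<close>.\<close>
  have fifth: "2 powr (6 * \<upsilon> - 7/2) / of_real pi ^ 3 * (1 * (of_real pi ^ 3 * exp ((7/2 - 6 * \<upsilon>) * of_real (ln 2)) * w k powr (2 * \<upsilon>))) =
      w k powr (2 * \<upsilon>)" for k
    unfolding two_powr by (simp add: exp_add[symmetric] algebra_simps)
  have G1: "meijer_G ?as [] [0] [1/2] (log_quot (64 * y^2) (w k) 4) = e 0 k * (P k * cosine_laplace \<upsilon> (w k) y)" for k
    using G4[of 0 k] by simp
  have G2: "meijer_G [(3 - 2*\<upsilon>)/4, (2 - 2*\<upsilon>)/4, (1 - 2*\<upsilon>)/4, (- 2*\<upsilon>)/4] [] [-1/4] [1/4] (log_quot (64 * y^2) (w k) 4) =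
      e (-1/4) k * (P k * cosine_laplace \<upsilon> (w k) y)" for k
  proof -
    have m: "map (\<lambda>x. x + of_real (-1/4)) ?as = [(3 - 2*\<upsilon>)/4, (2 - 2*\<upsilon>)/4, (1 - 2*\<upsilon>)/4, (- 2*\<upsilon>)/4]"
      by (simp add: complex_eq_iff diff_divide_distrib)
    show ?thesis unfolding G4[symmetric] m by simp
  qed
  have G3: "meijer_G [(6 - 2*\<upsilon>)/4, (5 - 2*\<upsilon>)/4, (4 - 2*\<upsilon>)/4, (3 - 2*\<upsilon>)/4] [] [1/2] [1] (log_quot (64 * y^2) (w k) 4) =
      e (1/2) k * (P k * cosine_laplace \<upsilon> (w k) y)" for k
  proof -
    have m: "map (\<lambda>x. x + of_real (1/2)) ?as = [(6 - 2*\<upsilon>)/4, (5 - 2*\<upsilon>)/4, (4 - 2*\<upsilon>)/4, (3 - 2*\<upsilon>)/4]"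
      by (simp add: complex_eq_iff diff_divide_distrib)
    show ?thesis unfolding G4[symmetric] m by simp
  qed
  have G4': "meijer_G [(2 - 2*\<upsilon>)/4, (1 - 2*\<upsilon>)/4, (- 2*\<upsilon>)/4, (- 1 - 2*\<upsilon>)/4] [] [-1/2] [0] (log_quot (64 * y^2) (w k) 4) =
      e (-1/2) k * (P k * cosine_laplace \<upsilon> (w k) y)" for k
  proof -
    have m: "map (\<lambda>x. x + of_real (-1/2)) ?as = [(2 - 2*\<upsilon>)/4, (1 - 2*\<upsilon>)/4, (- 2*\<upsilon>)/4, (- 1 - 2*\<upsilon>)/4]"
      by (simp add: complex_eq_iff diff_divide_distrib)
    show ?thesis unfolding G4[symmetric] m by simp
  qed
  have G5: "meijer_G [(8 - 2*\<upsilon>)/8, (7 - 2*\<upsilon>)/8, (6 - 2*\<upsilon>)/8, (5 - 2*\<upsilon>)/8,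
                   (4 - 2*\<upsilon>)/8, (3 - 2*\<upsilon>)/8, (2 - 2*\<upsilon>)/8, (1 - 2*\<upsilon>)/8] [] [0, 1/2] [1/4, 3/4]
           (log_quot (4^8 * y^4) (w k) 8) =
      1 * ((of_real pi ^ 3 * exp ((7/2 - 6 * \<upsilon>) * of_real (ln 2)) * w k powr (2 * \<upsilon>)) * cosine_laplace \<upsilon> (w k) y)" for k
    unfolding meijer_eight[OF w assms(2,1)] by (simp only: mult_1)
  have wp: "w k powr a \<noteq> 0" for k a using w0[of k] by simp
  show ?thesis
    unfolding G1 G2 G3 G4' G5
    unfolding weight_cancel[OF wp first] weight_cancel[OF wp second] weight_cancel[OF wp third]
      weight_cancel[OF wp fourth] weight_cancel[OF wp fifth]
    using sums by blast
qed

end
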